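(* Every $\lambda\in(1,2)$ is an eigenvalue of infinitely many equations PS-3. That is, for every $\lambda\in(1,2)$ there are infinitely many, pairwise gauge inequivalent, degree three rational functions $R_3$ satisfying the standing assumptions listed in the context for which the integral equation $$\lambda\ \mathrm{V.p.}\!\int_{-1}^{1}\frac{u(t)}{t-x}\,dt-\mathrm{V.p.}\!\int_{-1}^{1}\frac{u(t)\,dR_3(t)}{R_3(t)-R_3(x)}=\mathrm{const},\qquad x\in(-1,1),$$ has a nonzero solution $u$ (for some constant on the right-hand side).
   Context: **Standing assumptions on $R_3$.** $\hat{\mathbb R}=\mathbb R\cup\{\infty\}$. $R_3$ is a real rational function of degree 3 with four distinct critical values $a_1,\dots,a_4\in\hat{\mathbb R}$, all different from $\pm1$. Over $a_s$ lie one double (critical) point $b_s$ and one ordinary point $c_s$, all in $\hat{\mathbb R}$. The $a_s$ are numbered in the natural cyclic order of $\hat{\mathbb R}$ so that every $y$ in $(a_1,a_2)$ or $(a_3,a_4)$ has one real and two complex conjugate preimages, while the other points $y\in\hat{\mathbb R}$, $y\ne a_s$, have three distinct real preimages. $R_3$ is a nondegenerate change of variable on $[-1,1]$: it maps $[-1,1]$ onto itself with $R_3'\neq0$ on $[-1,1]$. Moreover $[-1,1]\subset(b_2,b_3)$, where $(b_2,b_3)$ is the interval of $\hat{\mathbb R}$ between $b_2$ and $b_3$ containing no other critical point. **Gauge equivalence.** $R_3$ and $L_2\circ R_3\circ L_1$ are gauge equivalent when $L_1,L_2$ are real linear fractional maps keeping the segment $[-1,1]$. Gauge equivalent parameters give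 equations with the same spectrum, and such equations are not distinguished. Solutions $u$ are of Hölder class on $[-1,1]$, with the Cauchy integral $\int_{-1}^1 u(t)(t-x)^{-1}dt$ having Hölder boundary values on $[-1,1]$. *)

theory Defs
  imports
    "HOL-Analysis.Analysis"
    "HOL-Computational_Algebra.Computational_Algebra"
    "HOL-Computational_Algebra.Field_as_Ring"
    "HOL-Library.Option_ord"
begin

section \<open>Real rational functions as maps of the Riemann sphere\<close>

text \<open>
  A real rational function is an element of the field of fractions of the ring of real polynomials;
  its numerator and denominator are taken in lowest terms.
  The Riemann sphere is \<^typ>\<open>complex option\<close> and its real circle is \<^typ>\<open>real option\<close>,
  with \<^term>\<open>None\<close> as the point at infinity.
\<close>

type_synonym ratfun = "real poly fract"

definition numer :: "ratfun \<Rightarrow> real poly" where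
  "numer R = fst (quot_of_fract R)"

definition denom :: "ratfun \<Rightarrow> real poly" where
  "denom R = snd (quot_of_fract R)"

definition rat_degree :: "ratfun \<Rightarrow> nat" where
  "rat_degree R = max (degree (numer R)) (degree (denom R))"

text \<open>The values on the real line, meaningful away from the real poles.\<close>

definition rat_fun :: "ratfun \<Rightarrow> real \<Rightarrow> real" where
  "rat_fun R x = poly (numer R) x / poly (denom R) x"

abbreviation cpoly :: "real poly \<Rightarrow> complex poly" where
  "cpoly \<equiv> map_poly complex_of_real"

abbreviation cpoint :: "real option \<Rightarrow> complex option" where
  "cpoint \<equiv> map_option complex_of_real"

definition rat_map :: "ratfun \<Rightarrow> complex option \<Rightarrow> complex option" where
  "rat_map R z =
     (case z of
        None \<Rightarrow>
          (if degree (denom R) < degree (numer R) then None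
           else Some (complex_of_real
                        (coeff (numer R) (degree (denom R)) / lead_coeff (denom R))))
      | Some w \<Rightarrow>
          (if poly (cpoly (denom R)) w = 0 then None
           else Some (poly (cpoly (numer R)) w / poly (cpoly (denom R)) w)))"

text \<open>
  The finite points over \<open>y\<close> are the zeros of the following polynomial, with multiplicities.
  Read as a form of degree \<^term>\<open>rat_degree R\<close>, it vanishes at infinity to the order by which its
  degree falls short of \<^term>\<open>rat_degree R\<close>.
\<close>

definition fibre_poly :: "ratfun \<Rightarrow> complex option \<Rightarrow> complex poly" where
  "fibre_poly R y =
     (case y of
        None \<Rightarrow> cpoly (denom R)
      | Some v \<Rightarrow> cpoly (numer R) - smult v (cpoly (denom R)))"

definition local_degree :: "ratfun \<Rightarrow> complex option \<Rightarrow> nat" where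
  "local_degree R z =
     (let h = fibre_poly R (rat_map R z) in
      case z of
        None \<Rightarrow> rat_degree R - degree h
      | Some w \<Rightarrow> order w h)"

definition critical_points :: "ratfun \<Rightarrow> complex option set" where
  "critical_points R = {z. local_degree R z \<ge> 2}"

definition critical_values :: "ratfun \<Rightarrow> complex option set" where
  "critical_values R = rat_map R ` critical_points R"

definition fibre :: "ratfun \<Rightarrow> complex option \<Rightarrow> complex option set" where
  "fibre R y = {z. rat_map R z = y}"


section \<open>The cyclic order of the real circle\<close>

text \<open>
  \<^theory>\<open>HOL-Library.Option_ord\<close> puts \<^term>\<open>None\<close> below all reals.  Only the induced cyclic order
  is used, which would be the same with \<^term>\<open>None\<close> above all reals.
\<close>

definition cyclic :: "real option \<Rightarrow> real option \<Rightarrow> real option \<Rightarrow> bool" where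
  "cyclic x y z \<longleftrightarrow> (x < y \<and> y < z) \<or> (y < z \<and> z < x) \<or> (z < x \<and> x < y)"

definition open_arc :: "real option \<Rightarrow> real option \<Rightarrow> real option set" where
  "open_arc x z = {y. cyclic x y z}"


section \<open>The standing assumptions on \<open>R\<^sub>3\<close>\<close>

definition unit_segment :: "real option set" where
  "unit_segment = Some ` {-1..1}"

definition admissible :: "ratfun \<Rightarrow> bool" where
  "admissible R \<longleftrightarrow>
     rat_degree R = 3 \<and>
     rat_map R ` cpoint ` unit_segment = cpoint ` unit_segment \<and>
     (\<forall>t\<in>{-1..1}. deriv (rat_fun R) t \<noteq> 0) \<and>
     (\<exists>a b c :: nat \<Rightarrow> real option.
        inj_on a {1..4} \<and>
        critical_values R = cpoint ` a ` {1..4} \<and>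
        (\<forall>s\<in>{1..4}.
           a s \<noteq> Some 1 \<and> a s \<noteq> Some (-1) \<and>
           fibre R (cpoint (a s)) = {cpoint (b s), cpoint (c s)} \<and>
           local_degree R (cpoint (b s)) = 2 \<and>
           local_degree R (cpoint (c s)) = 1) \<and>
        cyclic (a 1) (a 2) (a 3) \<and> cyclic (a 1) (a 3) (a 4) \<and>
        (\<forall>y \<in> open_arc (a 1) (a 2) \<union> open_arc (a 3) (a 4).
           \<exists>x w. Im w \<noteq> 0 \<and> fibre R (cpoint y) = {cpoint x, Some w, Some (cnj w)}) \<and>
        (\<forall>y. y \<notin> open_arc (a 1) (a 2) \<union> open_arc (a 3) (a 4) \<and> y \<notin> a ` {1..4} \<longrightarrow>
           (\<exists>X :: real option set. card X = 3 \<and> fibre R (cpoint y) = cpoint ` X)) \<and>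
        (\<exists>I \<in> {open_arc (b 2) (b 3), open_arc (b 3) (b 2)}.
           cpoint ` I \<inter> critical_points R = {} \<and> unit_segment \<subseteq> I))"


section \<open>Gauge equivalence\<close>

definition linear_fractional :: "ratfun \<Rightarrow> bool" where
  "linear_fractional L \<longleftrightarrow>
     (\<exists>\<alpha> \<beta> \<gamma> \<delta>. \<alpha> * \<delta> - \<beta> * \<gamma> \<noteq> 0 \<and> L = Fract [:\<beta>, \<alpha>:] [:\<delta>, \<gamma>:])"

definition keeps_unit_segment :: "ratfun \<Rightarrow> bool" where
  "keeps_unit_segment L \<longleftrightarrow> rat_map L ` cpoint ` unit_segment = cpoint ` unit_segment"

definition gauge_equivalent :: "ratfun \<Rightarrow> ratfun \<Rightarrow> bool" where
  "gauge_equivalent R R' \<longleftrightarrow>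
     (\<exists>L\<^sub>1 L\<^sub>2. linear_fractional L\<^sub>1 \<and> keeps_unit_segment L\<^sub>1 \<and>
              linear_fractional L\<^sub>2 \<and> keeps_unit_segment L\<^sub>2 \<and>
              rat_map R' = rat_map L\<^sub>2 \<circ> rat_map R \<circ> rat_map L\<^sub>1)"


section \<open>The integral equation\<close>

definition hoelder_on :: "real set \<Rightarrow> (real \<Rightarrow> 'a::real_normed_vector) \<Rightarrow> bool" where
  "hoelder_on S f \<longleftrightarrow>
     (\<exists>\<alpha> C. 0 < \<alpha> \<and> \<alpha> \<le> 1 \<and>
        (\<forall>x\<in>S. \<forall>y\<in>S. norm (f x - f y) \<le> C * \<bar>x - y\<bar> powr \<alpha>))"

definition cauchy_integral :: "(real \<Rightarrow> real) \<Rightarrow> complex \<Rightarrow> complex" where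
  "cauchy_integral u z =
     integral {-1..1} (\<lambda>t. complex_of_real (u t) / (complex_of_real t - z))"

text \<open>Boundary values are taken on both sides of the slit, up to and including the endpoints.\<close>

definition hoelder_boundary_values :: "(complex \<Rightarrow> complex) \<Rightarrow> bool" where
  "hoelder_boundary_values \<Phi> \<longleftrightarrow>
     (\<exists>\<Phi>\<^sub>p \<Phi>\<^sub>m. hoelder_on {-1..1} \<Phi>\<^sub>p \<and> hoelder_on {-1..1} \<Phi>\<^sub>m \<and>
        (\<forall>x\<in>{-1..1}.
           (\<Phi> \<longlongrightarrow> \<Phi>\<^sub>p x) (at (complex_of_real x) within {z. Im z > 0}) \<and>
           (\<Phi> \<longlongrightarrow> \<Phi>\<^sub>m x) (at (complex_of_real x) within {z. Im z < 0})))"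

definition has_pv_integral ::
    "(real \<Rightarrow> real) \<Rightarrow> real \<Rightarrow> real \<Rightarrow> real \<Rightarrow> real \<Rightarrow> bool" where
  "has_pv_integral f a b x I \<longleftrightarrow>
     (\<forall>\<epsilon>>0. f integrable_on ({a..b} - {x-\<epsilon><..<x+\<epsilon>})) \<and>
     ((\<lambda>\<epsilon>. integral ({a..b} - {x-\<epsilon><..<x+\<epsilon>}) f) \<longlongrightarrow> I) (at_right 0)"

definition PS_solution :: "real \<Rightarrow> ratfun \<Rightarrow> (real \<Rightarrow> real) \<Rightarrow> bool" where
  "PS_solution lam R u \<longleftrightarrow>
     hoelder_on {-1..1} u \<and>
     hoelder_boundary_values (cauchy_integral u) \<and>
     (\<exists>const. \<forall>x\<in>{-1<..<1}. \<exists>I J.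
        has_pv_integral (\<lambda>t. u t / (t - x)) (-1) 1 x I \<and>
        has_pv_integral
          (\<lambda>t. u t * deriv (rat_fun R) t / (rat_fun R t - rat_fun R x)) (-1) 1 x J \<and>
        lam * I - J = const)"

definition PS_eigenvalue :: "real \<Rightarrow> ratfun \<Rightarrow> bool" where
  "PS_eigenvalue lam R \<longleftrightarrow>
     (\<exists>u. PS_solution lam R u \<and> (\<exists>x\<in>{-1..1}. u x \<noteq> 0))"

end

theory Submission
  imports Defs "HOL-Complex_Analysis.Complex_Analysis"
begin

text \<open>
  For \<open>0 < b < 1\<close> let \<open>r\<close> be the odd cubic function with poles \<open>1\<close>, \<open>-1\<close>, \<open>\<infinity>\<close> and critical points
  \<open>\<plusminus>b\<close>, \<open>\<plusminus>B\<close>, and for \<open>0 < e < b\<close> put \<open>R(x) = r(e x) / r(e)\<close>.  Expanding \<open>R'(t) / (R(t) - R(x))\<close> in partial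
  fractions leaves, besides the Cauchy kernel, the two poles at the other preimages of \<open>R(x)\<close>, which lie
  off \<open>[-1,1]\<close>.  Writing \<open>u\<close> as a sine series in \<open>arccos x\<close> and differentiating turns the equation into
  \<open>\<delta> v = T\<^sub>e v\<close> with \<open>\<delta> = lam - 1 \<in> (0,1)\<close> and a positive integral operator \<open>T\<^sub>e\<close> on \<open>[-1,1]\<close> that
  depends continuously on \<open>e\<close> and vanishes at \<open>e = 0\<close>.

  As \<open>e\<close> tends to \<open>b\<close>, the operator near an endpoint approaches, on a logarithmic scale, convolution with a
  probability density, so a long tent function satisfies \<open>T\<^sub>e v \<ge> \<delta> v\<close> for some \<open>e\<close>.  At the infimum of
  the \<open>e\<close> admitting such a subsolution, \<open>\<delta>\<close> is an eigenvalue with a positive eigenfunction.  This gives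
  one \<open>R\<close> for each \<open>b\<close>, and the critical values \<open>\<plusminus>\<alpha>/r(e)\<close>, \<open>\<plusminus>\<beta>/r(e)\<close>, with \<open>\<beta>/\<alpha>\<close>
  decreasing in \<open>b\<close>, tell these functions apart up to gauge equivalence.
\<close>

section \<open>Positive kernels depending on a parameter\<close>

text \<open>With \<open>x = cos \<theta>\<close> the principal value of the density becomes
  \<open>\<Sum> c n * cos (n * \<theta>)\<close>, while its Cauchy integral at an outside point with
  Joukowski coordinate \<open>s\<close> becomes \<open>\<Sum> c n * s ^ n\<close>. The equation thus
  compares one series on the circle with two series inside the disc, up to an unknown constant.
  Differentiating in \<open>x\<close> removes the constant and puts the derivative of
  \<open>s\<close> in front of each term; it is positive because the preimage \<open>f\<close>
  decreases, and this is the source of the positive kernel.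

  The threshold 1 is the mass of the limiting convolution. As \<open>e\<close> tends to
  \<open>b\<close> the outer preimages run into the endpoints and the kernel becomes singular, so
  the argument stays at \<open>e < b\<close> and uses only a lower bound for the kernel there.

  Subsolutions take the place of spectral theory: the inequality passes to uniform limits, and where
  it is strict everywhere it survives a small decrease of \<open>e\<close>. Oddness of
  \<open>r\<close> lets one normalisation fix both endpoints and makes the two outer preimages
  mirror images of each other.\<close>

lemma integral_pos_continuous:
  fixes f :: "real \<Rightarrow> real"
  assumes ab: "a < b" and f: "continuous_on {a..b} f" and nn: "\<And>t. t \<in> {a..b} \<Longrightarrow> 0 \<le> f t"
    and t0: "t0 \<in> {a..b}" "0 < f t0"
  shows "0 < integral {a..b} f"
proof (rule ccontr)
  assume "\<not> 0 < integral {a..b} f"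
  moreover have "0 \<le> integral {a..b} f"
    by (rule integral_nonneg) (use nn f in \<open>auto intro: integrable_continuous_real\<close>)
  ultimately have "integral {a..b} f = 0" by simp
  then have "\<And>t. t \<in> {a..b} \<Longrightarrow> f t = 0"
    using integral_eq_0_iff[OF f ab] nn by auto
  then show False using t0 by force
qed

lemma continuous_on_via:
  assumes "continuous_on S g" "continuous_on A f" "f ` A \<subseteq> S" "\<And>x. x \<in> A \<Longrightarrow> h x = g (f x)"
  shows "continuous_on A h"
  using continuous_on_compose2[OF assms(1-3)] assms(4) by (simp cong: continuous_on_cong)

text \<open>Strict positivity is asked only for \<open>t\<close> in the open interval, because the
  kernel to be used carries the factor \<open>sqrt (1 - t\<^sup>2)\<close> and vanishes at both
  ends.\<close>

locale positive_kernel =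
  fixes K :: "real \<Rightarrow> real \<Rightarrow> real \<Rightarrow> real" and e1 :: real
  assumes e1: "0 < e1"
    and cont: "continuous_on ({0..e1} \<times> {-1..1} \<times> {-1..1}) (\<lambda>(e, x, t). K e x t)"
    and zero: "\<And>x t. \<lbrakk>x \<in> {-1..1}; t \<in> {-1..1}\<rbrakk> \<Longrightarrow> K 0 x t = 0"
    and nonneg: "\<And>e x t. \<lbrakk>e \<in> {0..e1}; x \<in> {-1..1}; t \<in> {-1..1}\<rbrakk> \<Longrightarrow> 0 \<le> K e x t"
    and pos: "\<And>e x t. \<lbrakk>e \<in> {0<..e1}; x \<in> {-1..1}; t \<in> {-1<..<1}\<rbrakk> \<Longrightarrow> 0 < K e x t"
begin

definition T :: "real \<Rightarrow> (real \<Rightarrow> real) \<Rightarrow> real \<Rightarrow> real" where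
  "T e v x = integral {-1..1} (\<lambda>t. K e x t * v t)"

lemma cont_K_t: "\<lbrakk>e \<in> {0..e1}; x \<in> {-1..1}\<rbrakk> \<Longrightarrow> continuous_on {-1..1} (\<lambda>t. K e x t)"
  by (rule continuous_on_via[OF cont, where f = "\<lambda>t. (e, x, t)"]) (auto intro!: continuous_intros)

lemma integrable: "\<lbrakk>e \<in> {0..e1}; x \<in> {-1..1}; continuous_on {-1..1} v\<rbrakk>
    \<Longrightarrow> (\<lambda>t. K e x t * v t) integrable_on {-1..1}"
  by (intro integrable_continuous_real continuous_intros cont_K_t)

lemma continuous_T2:
  assumes v: "continuous_on {-1..1} v"
  shows "continuous_on ({0..e1} \<times> {-1..1}) (\<lambda>p. T (fst p) v (snd p))"
proof -
  have "continuous_on (({0..e1} \<times> {-1..1}) \<times> cbox (-1) 1) (\<lambda>(p, t). K (fst p) (snd p) t * v t)"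
  proof -
    have 1: "continuous_on (({0..e1} \<times> {-1..1}) \<times> cbox (-1) 1)
             (\<lambda>q. K (fst (fst q)) (snd (fst q)) (snd q))"
      by (rule continuous_on_via[OF cont, where f = "\<lambda>q. (fst (fst q), snd (fst q), snd q)"])
         (auto intro!: continuous_intros)
    have 2: "continuous_on (({0..e1} \<times> {-1..1::real}) \<times> cbox (-1) 1) (\<lambda>q. v (snd q))"
      by (rule continuous_on_compose2[OF v]) (auto intro!: continuous_intros)
    show ?thesis using continuous_on_mult[OF 1 2] by (simp add: case_prod_unfold)
  qed
  from integral_continuous_on_param[OF this] show ?thesis
    by (simp add: T_def)
qed

lemma continuous_T:
  assumes v: "continuous_on {-1..1} v" and e: "e \<in> {0..e1}"
  shows "continuous_on {-1..1} (T e v)"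
  by (rule continuous_on_via[OF continuous_T2[OF v], where f = "\<lambda>x. (e, x)"])
     (use e in \<open>auto intro!: continuous_intros\<close>)

lemma T_mono:
  assumes "continuous_on {-1..1} v" "continuous_on {-1..1} w" "e \<in> {0..e1}" "x \<in> {-1..1}"
    "\<And>t. t \<in> {-1..1} \<Longrightarrow> v t \<le> w t"
  shows "T e v x \<le> T e w x"
  unfolding T_def by (intro integral_le integrable mult_left_mono nonneg assms) auto

lemma T_nonneg:
  assumes "continuous_on {-1..1} v" "e \<in> {0..e1}" "x \<in> {-1..1}"
    "\<And>t. t \<in> {-1..1} \<Longrightarrow> 0 \<le> v t"
  shows "0 \<le> T e v x"
  unfolding T_def by (intro integral_nonneg integrable mult_nonneg_nonneg nonneg assms) auto

lemma T_scale: "T e (\<lambda>t. c * v t) x = c * T e v x"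
  unfolding T_def by (simp add: mult.left_commute)

lemma T_diff:
  assumes "continuous_on {-1..1} v" "continuous_on {-1..1} w" "e \<in> {0..e1}" "x \<in> {-1..1}"
  shows "T e (\<lambda>t. v t - w t) x = T e v x - T e w x"
  unfolding T_def using integral_diff[OF integrable integrable] assms by (simp add: right_diff_distrib)

lemma T_pos:
  assumes v: "continuous_on {-1..1} v" and e: "e \<in> {0<..e1}" and x: "x \<in> {-1..1}"
    and nn: "\<And>t. t \<in> {-1..1} \<Longrightarrow> 0 \<le> v t" and t0: "t0 \<in> {-1..1}" "0 < v t0"
  shows "0 < T e v x"
proof -
  have "\<exists>s\<in>{-1<..<1}. 0 < v s"
  proof (rule ccontr)
    assume neg: "\<not> ?thesis"
    have z: "v s = 0" if "s \<in> {-1<..<1}" for s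
    proof -
      have "\<not> 0 < v s" using neg that by blast
      moreover have "0 \<le> v s" using nn[of s] that by auto
      ultimately show ?thesis by simp
    qed
    \<comment> \<open>Vanishing on the open interval would spread to its closure by continuity. So
      positivity of \<open>v\<close> at an endpoint, where the kernel may vanish, still provides an
      interior point of positivity.\<close>
    have "v t0 = 0"
      using continuous_constant_on_closure[of "{-1<..<1}" v 0 t0] v z t0 by simp
    then show False using t0 by simp
  qed
  then obtain s where s: "s \<in> {-1<..<1}" "0 < v s" by blast
  have e': "e \<in> {0..e1}" using e by auto
  show ?thesis unfolding T_def
  proof (rule integral_pos_continuous)
    show "continuous_on {-1..1} (\<lambda>t. K e x t * v t)" by (intro continuous_intros cont_K_t e' x v)
    show "0 < K e x s * v s" using pos[OF e x s(1)] s by simp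
  qed (use s nn nonneg e' x in auto)
qed

text \<open>Subsolutions stand in for eigenfunctions: here \<open>d\<close> stays fixed and
  \<open>e\<close> is the parameter that is moved until the inequality becomes an equality.\<close>

definition sub :: "real \<Rightarrow> real \<Rightarrow> (real \<Rightarrow> real) \<Rightarrow> bool" where
  "sub d e v \<longleftrightarrow> continuous_on {-1..1} v \<and> (\<forall>t\<in>{-1..1}. 0 \<le> v t) \<and> (\<exists>t\<in>{-1..1}. 0 < v t)
     \<and> (\<forall>x\<in>{-1..1}. d * v x \<le> T e v x)"

lemma K_bounded: obtains C where "0 < C" "\<And>e x t. \<lbrakk>e \<in> {0..e1}; x \<in> {-1..1}; t \<in> {-1..1}\<rbrakk> \<Longrightarrow> K e x t \<le> C"
proof -
  have "compact ((\<lambda>(e, x, t). K e x t) ` ({0..e1} \<times> {-1..1} \<times> {-1..1}))"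
    by (intro compact_continuous_image cont compact_Times compact_Icc)
  then obtain C where C: "\<forall>y\<in>(\<lambda>(e, x, t). K e x t) ` ({0..e1} \<times> {-1..1} \<times> {-1..1}). norm y \<le> C"
    using compact_imp_bounded bounded_iff by metis
  show ?thesis
  proof (rule that[of "max C 1"])
    fix e x t :: real assume "e \<in> {0..e1}" "x \<in> {-1..1}" "t \<in> {-1..1}"
    then have "norm (K e x t) \<le> C" using C by force
    then show "K e x t \<le> max C 1" by auto
  qed simp
qed

lemma T_upper:
  assumes v: "continuous_on {-1..1} v" "e \<in> {0..e1}" "x \<in> {-1..1}"
    and C: "\<And>t. t \<in> {-1..1} \<Longrightarrow> \<bar>K e x t * v t\<bar> \<le> M"
  shows "\<bar>T e v x\<bar> \<le> 2 * M"
proof -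
  have "norm (integral {-1..1} (\<lambda>t. K e x t * v t)) \<le> M * (1 - (-1))"
    by (rule integral_bound) (use assms in \<open>auto intro!: continuous_intros cont_K_t\<close>)
  then show ?thesis by (simp add: T_def)
qed

lemma normalised_sub:
  assumes "sub d e v" and e: "e \<in> {0..e1}" and d: "0 < d"
  obtains w where "continuous_on {-1..1} w" "\<And>t. t \<in> {-1..1} \<Longrightarrow> 0 \<le> w t \<and> w t \<le> 1"
     "\<exists>t\<in>{-1..1}. w t = 1" "\<And>x. x \<in> {-1..1} \<Longrightarrow> d * w x \<le> T e w x"
proof -
  have v: "continuous_on {-1..1} v" "\<And>t. t\<in>{-1..1} \<Longrightarrow> 0 \<le> v t" "\<exists>t\<in>{-1..1}. 0 < v t"
     "\<And>x. x\<in>{-1..1} \<Longrightarrow> d * v x \<le> T e v x" using assms unfolding sub_def by auto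
  obtain t0 where t0: "t0 \<in> {-1..1}" "\<And>t. t \<in> {-1..1} \<Longrightarrow> v t \<le> v t0"
    using continuous_attains_sup[OF _ _ v(1)] by auto
  define M where "M = v t0"
  have M: "0 < M" using v(3) t0 unfolding M_def by force
  show ?thesis
  proof (rule that[of "\<lambda>t. (1/M) * v t"])
    show "continuous_on {-1..1} (\<lambda>t. (1/M) * v t)" by (intro continuous_intros v)
    show "0 \<le> (1/M) * v t \<and> (1/M) * v t \<le> 1" if "t \<in> {-1..1}" for t
      using v(2)[OF that] t0(2)[OF that] M by (simp add: M_def)
    show "\<exists>t\<in>{-1..1}. (1/M) * v t = 1" using t0(1) M by (auto simp: M_def intro!: bexI[of _ t0])
    show "d * ((1/M) * v x) \<le> T e (\<lambda>t. (1/M) * v t) x" if "x \<in> {-1..1}" for x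
      unfolding T_scale using v(4)[OF that] M by (simp add: field_simps)
  qed
qed

text \<open>At the infimum of the parameters that admit a subsolution, a limit of normalised
  subsolutions is again one. If it were strict at one point, one application of the positive
  operator would make it strict everywhere with a uniform margin, and the parameter could be lowered
  further.\<close>

theorem eigenvalue_attained:
  assumes d: "0 < d" and sub1: "sub d e1 v0"
  obtains e v where "e \<in> {0<..e1}" "continuous_on {-1..1} v" "\<And>x. x \<in> {-1..1} \<Longrightarrow> 0 < v x"
    "\<And>x. x \<in> {-1..1} \<Longrightarrow> T e v x = d * v x"
proof -
  define S where "S = {e \<in> {0..e1}. \<exists>v. sub d e v}"
  have e1S: "e1 \<in> S" using sub1 e1 by (auto simp: S_def)
  have Sb: "bdd_below S" by (rule bdd_belowI[of _ 0]) (auto simp: S_def)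
  define es where "es = Inf S"
  have es0: "0 \<le> es" unfolding es_def using e1S by (intro cInf_greatest) (auto simp: S_def)
  have es1: "es \<le> e1" unfolding es_def using e1S Sb by (rule cInf_lower)
  have esI: "es \<in> {0..e1}" using es0 es1 by simp
  have "\<forall>n. \<exists>e. e \<in> S \<and> e < es + 1 / real (Suc n)"
  proof
    fix n
    have "Inf S < es + 1 / real (Suc n)" unfolding es_def by simp
    then show "\<exists>e. e \<in> S \<and> e < es + 1 / real (Suc n)" using e1S Sb cInf_less_iff by blast
  qed
  then obtain en where en: "\<And>n. en n \<in> S" "\<And>n. en n < es + 1 / real (Suc n)" by metis
  have en_ge: "es \<le> en n" for n unfolding es_def using en(1) Sb by (rule cInf_lower)
  have enI: "en n \<in> {0..e1}" for n using en(1)[of n] by (simp add: S_def)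
  have en_lim: "en \<longlonglongrightarrow> es"
  proof (rule tendsto_sandwich[of "\<lambda>_. es" en sequentially "\<lambda>n. es + 1 / real (Suc n)"])
    show "(\<lambda>n. es + 1 / real (Suc n)) \<longlonglongrightarrow> es"
      using tendsto_add[OF tendsto_const LIMSEQ_inverse_real_of_nat, of es] by (simp add: inverse_eq_divide)
  qed (use en_ge en(2) in \<open>auto simp: less_imp_le intro!: always_eventually\<close>)
  have "\<exists>w. continuous_on {-1..1} w \<and> (\<forall>t\<in>{-1..1}. 0 \<le> w t \<and> w t \<le> 1)
     \<and> (\<exists>t\<in>{-1..1}. w t = 1) \<and> (\<forall>x\<in>{-1..1}. d * w x \<le> T (en n) w x)" for n
  proof -
    obtain v where "sub d (en n) v" using en(1)[of n] by (auto simp: S_def)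
    from normalised_sub[OF this enI d] show ?thesis by metis
  qed
  then obtain w where w: "\<And>n. continuous_on {-1..1} (w n)"
     "\<And>n t. t\<in>{-1..1} \<Longrightarrow> 0 \<le> w n t" "\<And>n t. t\<in>{-1..1} \<Longrightarrow> w n t \<le> 1"
     "\<And>n. \<exists>t\<in>{-1..1}. w n t = 1" "\<And>n x. x\<in>{-1..1} \<Longrightarrow> d * w n x \<le> T (en n) (w n) x"
    by metis
  obtain C where C: "0 < C" "\<And>e x t. \<lbrakk>e \<in> {0..e1}; x \<in> {-1..1}; t \<in> {-1..1}\<rbrakk> \<Longrightarrow> K e x t \<le> C"
    using K_bounded by blast
  have unif: "uniformly_continuous_on ({0..e1} \<times> {-1..1} \<times> {-1..1}) (\<lambda>(e, x, t). K e x t)"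
    by (intro compact_uniformly_continuous cont compact_Times compact_Icc)
  \<comment> \<open>The modulus of continuity in \<open>x\<close> has to be uniform in
    \<open>e\<close> as well, since the parameter varies along the minimising sequence.\<close>
  have equi: "\<exists>\<delta>>0. \<forall>e x y t. e \<in> {0..e1} \<longrightarrow> x \<in> {-1..1} \<longrightarrow> y \<in> {-1..1} \<longrightarrow> t \<in> {-1..1} \<longrightarrow>
       \<bar>x - y\<bar> < \<delta> \<longrightarrow> \<bar>K e x t - K e y t\<bar> < \<eta>" if "0 < \<eta>" for \<eta>
  proof -
    from unif that obtain \<delta> where \<delta>: "0 < \<delta>" and
      H: "\<forall>p\<in>{0..e1} \<times> {-1..1} \<times> {-1..1}. \<forall>q\<in>{0..e1} \<times> {-1..1} \<times> {-1..1}. dist q p < \<delta> \<longrightarrow>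
          dist ((\<lambda>(e, x, t). K e x t) q) ((\<lambda>(e, x, t). K e x t) p) < \<eta>"
      unfolding uniformly_continuous_on_def by blast
    show ?thesis
    proof (intro exI[of _ \<delta>] conjI \<delta> allI impI)
      fix e x y t :: real
      assume a: "e \<in> {0..e1}" "x \<in> {-1..1}" "y \<in> {-1..1}" "t \<in> {-1..1}" "\<bar>x - y\<bar> < \<delta>"
      have "dist (e, x, t) (e, y, t) < \<delta>" using a(5) by (simp add: dist_Pair_Pair dist_real_def)
      then show "\<bar>K e x t - K e y t\<bar> < \<eta>" using H[rule_format, of "(e,y,t)" "(e,x,t)"] a
        by (auto simp: dist_real_def)
    qed
  qed
  \<comment> \<open>The functions \<open>w n\<close> share no modulus of continuity. Their images
    do, inherited from the kernel, and they are still subsolutions because \<open>T\<close> is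
    monotone; Arzela-Ascoli is therefore applied to the images.\<close>
  define W where "W n = T (en n) (w n)" for n
  have Wc: "continuous_on {-1..1} (W n)" for n unfolding W_def by (rule continuous_T[OF w(1) enI])
  have W0: "0 \<le> W n x" if "x \<in> {-1..1}" for n x
    unfolding W_def by (rule T_nonneg[OF w(1) enI that]) (use w in auto)
  have Wsub: "d * W n x \<le> T (en n) (W n) x" if x: "x \<in> {-1..1}" for n x
  proof -
    have "T (en n) (\<lambda>t. d * w n t) x \<le> T (en n) (W n) x"
      by (rule T_mono) (use w Wc enI x in \<open>auto simp: W_def intro!: continuous_intros\<close>)
    then show ?thesis by (simp add: T_scale W_def)
  qed
  obtain g k where g: "continuous_on {-1..1} g" "strict_mono (k :: nat \<Rightarrow> nat)"
      "\<And>e. 0 < e \<Longrightarrow> \<exists>N. \<forall>n x. n \<ge> N \<and> x \<in> {-1..1} \<longrightarrow> norm (W (k n) x - g x) < e"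
  proof (rule Arzela_Ascoli[of "{-1..1::real}" W "2 * C"])
    show "norm (W n x) \<le> 2 * C" if "x \<in> {-1..1}" for n x
    proof -
      have "\<bar>T (en n) (w n) x\<bar> \<le> 2 * C"
      proof (rule T_upper[OF w(1) enI that])
        fix t :: real assume t: "t \<in> {-1..1}"
        have "0 \<le> K (en n) x t" "K (en n) x t \<le> C" using nonneg[OF enI that t] C(2)[OF enI that t] by auto
        then show "\<bar>K (en n) x t * w n t\<bar> \<le> C" using w(2,3)[OF t, of n] C(1)
          by (metis abs_of_nonneg mult_left_le mult_nonneg_nonneg order_trans)
      qed
      then show ?thesis by (simp add: W_def)
    qed
    show "\<exists>\<delta>. 0 < \<delta> \<and> (\<forall>n y. y \<in> {-1..1} \<and> norm (x - y) < \<delta> \<longrightarrow> norm (W n x - W n y) < \<eta>)"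
      if x: "x \<in> {-1..1}" and \<eta>: "0 < \<eta>" for x \<eta>
    proof -
      from equi[of "\<eta>/4"] \<eta> obtain \<delta> where \<delta>: "0 < \<delta>"
        "\<And>e x y t. \<lbrakk>e \<in> {0..e1}; x \<in> {-1..1}; y \<in> {-1..1}; t \<in> {-1..1}; \<bar>x - y\<bar> < \<delta>\<rbrakk>
           \<Longrightarrow> \<bar>K e x t - K e y t\<bar> < \<eta>/4" by auto
      show ?thesis
      proof (intro exI[of _ \<delta>] conjI \<delta>(1) allI impI)
        fix n y assume y: "y \<in> {-1..1} \<and> norm (x - y) < \<delta>"
        have "W n x - W n y = integral {-1..1} (\<lambda>t. (K (en n) x t - K (en n) y t) * w n t)"
          unfolding W_def T_def
          by (subst integral_diff[symmetric]) (use y x w(1) enI in \<open>auto intro!: integrable simp: left_diff_distrib\<close>)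
        also have "norm \<dots> \<le> (\<eta>/4) * (1 - (-1))"
        proof (rule integral_bound)
          show "continuous_on {-1..1} (\<lambda>t. (K (en n) x t - K (en n) y t) * w n t)"
            using y x enI[of n] by (intro continuous_intros cont_K_t w(1)) auto
          fix t :: real assume t: "t \<in> {-1..1}"
          have "\<bar>K (en n) x t - K (en n) y t\<bar> < \<eta>/4" using y x t enI by (intro \<delta>(2)) auto
          then have "\<bar>K (en n) x t - K (en n) y t\<bar> * \<bar>w n t\<bar> \<le> \<eta>/4 * 1"
            using w(2,3)[OF t, of n] \<eta> by (intro mult_mono) auto
          then show "norm ((K (en n) x t - K (en n) y t) * w n t) \<le> \<eta>/4" by (simp add: abs_mult)
        qed simp
        also have "\<dots> < \<eta>" using \<eta> by simp
        finally show "norm (W n x - W n y) < \<eta>" .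
      qed
    qed
  qed auto
  have kn: "en (k n) \<in> {0..e1}" for n by (rule enI)
  have glim: "(\<lambda>n. W (k n) x) \<longlonglongrightarrow> g x" if "x \<in> {-1..1}" for x
    unfolding LIMSEQ_iff using g(3) that by meson
  have g0: "0 \<le> g x" if "x \<in> {-1..1}" for x
    by (rule LIMSEQ_le_const[OF glim[OF that]]) (use W0[OF that] in auto)
  have klim: "(\<lambda>n. en (k n)) \<longlonglongrightarrow> es"
    using LIMSEQ_subseq_LIMSEQ[OF en_lim g(2)] by (simp add: o_def)
  \<comment> \<open>At a point where \<open>w\<close> equals 1 the image \<open>W\<close> is at
    least \<open>d\<close>, so a uniform limit of these images cannot be zero.\<close>
  have gpos: "\<exists>t\<in>{-1..1}. 0 < g t"
  proof (rule ccontr)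
    assume "\<not> ?thesis"
    then have gz: "g t = 0" if "t \<in> {-1..1}" for t using g0[OF that] that by force
    obtain N where N: "\<forall>n x. n \<ge> N \<and> x \<in> {-1..1} \<longrightarrow> norm (W (k n) x - g x) < d" using g(3)[OF d] by blast
    obtain t where t: "t \<in> {-1..1}" "w (k N) t = 1" using w(4) by blast
    have "d \<le> W (k N) t" using w(5)[OF t(1), of "k N"] t by (simp add: W_def)
    moreover have "norm (W (k N) t - g t) < d" using N t(1) by blast
    ultimately show False using gz[OF t(1)] by simp
  qed
  have gsub: "d * g x \<le> T es g x" if x: "x \<in> {-1..1}" for x
  proof -
    have A: "(\<lambda>n. T (en (k n)) g x) \<longlonglongrightarrow> T es g x"
    proof -
      have "continuous (at (es, x) within {0..e1} \<times> {-1..1}) (\<lambda>p. T (fst p) g (snd p))"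
        using continuous_T2[OF g(1)] esI x by (auto simp: continuous_on_eq_continuous_within)
      then show ?thesis
        unfolding continuous_within_sequentially
        using kn x klim by (auto simp: o_def dest!: spec[of _ "\<lambda>n. (en (k n), x)"] intro!: tendsto_Pair)
    qed
    have B: "(\<lambda>n. T (en (k n)) (W (k n)) x - T (en (k n)) g x) \<longlonglongrightarrow> 0"
    proof (rule LIMSEQ_I)
      fix r :: real assume r: "0 < r"
      obtain N where N: "\<forall>n x. n \<ge> N \<and> x \<in> {-1..1} \<longrightarrow> norm (W (k n) x - g x) < r / (4 * C)"
        using g(3)[of "r / (4*C)"] r C by auto
      show "\<exists>no. \<forall>n\<ge>no. norm (T (en (k n)) (W (k n)) x - T (en (k n)) g x - 0) < r"
      proof (intro exI[of _ N] allI impI)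
        fix n assume n: "n \<ge> N"
        have "\<bar>T (en (k n)) (\<lambda>t. W (k n) t - g t) x\<bar> \<le> 2 * (r/4)"
        proof (rule T_upper[OF _ kn x])
          show "continuous_on {-1..1} (\<lambda>t. W (k n) t - g t)" by (intro continuous_intros Wc g)
          fix t :: real assume t: "t \<in> {-1..1}"
          have "\<bar>K (en (k n)) x t\<bar> * \<bar>W (k n) t - g t\<bar> \<le> C * (r/(4*C))"
            using N n t nonneg[OF kn x t] C(2)[OF kn x t] C(1) by (intro mult_mono) (auto simp: less_imp_le)
          then show "\<bar>K (en (k n)) x t * (W (k n) t - g t)\<bar> \<le> r/4" using C by (simp add: abs_mult)
        qed
        then show "norm (T (en (k n)) (W (k n)) x - T (en (k n)) g x - 0) < r"
          using r by (simp add: T_diff[OF Wc g(1) kn x])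
      qed
    qed
    have Lim: "(\<lambda>n. T (en (k n)) (W (k n)) x) \<longlonglongrightarrow> T es g x"
      using tendsto_add[OF A B] by simp
    show ?thesis
      by (rule LIMSEQ_le[OF tendsto_mult[OF tendsto_const glim[OF x]] Lim]) (use Wsub[OF x] in auto)
  qed
  \<comment> \<open>The kernel vanishes at \<open>e = 0\<close>, which leaves no room for a nonzero
    subsolution there.\<close>
  have es_pos: "0 < es"
  proof (rule ccontr)
    assume "\<not> 0 < es"
    then have "es = 0" using es0 by simp
    then have "T es g x = 0" if "x \<in> {-1..1}" for x
      unfolding T_def using zero[OF that] \<open>es = 0\<close> integral_cong[of "{-1..1}" "\<lambda>t. K es x t * g t" "\<lambda>_. 0"] by simp
    then show False using gsub gpos d by (metis mult_pos_pos not_less)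
  qed
  have esp: "es \<in> {0<..e1}" using es_pos es1 by simp
  \<comment> \<open>The test function for the contradiction: \<open>T h - d * h\<close> is the image
    under \<open>T\<close> of \<open>T g - d * g\<close>. As soon as the latter is nonnegative and
    not zero, the former is positive on the whole compact interval.\<close>
  define h where "h = T es g"
  have hc: "continuous_on {-1..1} h" unfolding h_def by (rule continuous_T[OF g(1) esI])
  have hpos: "0 < h x" if "x \<in> {-1..1}" for x
    unfolding h_def using gpos T_pos[OF g(1) esp that] g0 by blast
  have gh: "d * g x = h x" if x: "x \<in> {-1..1}" for x
  proof (rule ccontr)
    assume "d * g x \<noteq> h x"
    then have lt: "d * g x < h x" using gsub[OF x] by (simp add: h_def)
    define q where "q y = h y - d * g y" for y
    have qc: "continuous_on {-1..1} q" unfolding q_def by (intro continuous_intros hc g)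
    have q0: "0 \<le> q y" if "y \<in> {-1..1}" for y using gsub[OF that] by (simp add: q_def h_def)
    have qp: "0 < T es q y" if "y \<in> {-1..1}" for y
      by (rule T_pos[OF qc esp that q0 x]) (use lt in \<open>auto simp: q_def\<close>)
    have qe: "T es h y - d * h y = T es q y" if y: "y \<in> {-1..1}" for y
      unfolding q_def using T_diff[OF hc _ esI y, of "\<lambda>y. d * g y"] g(1)
      by (simp add: T_scale continuous_on_mult_left h_def)
    define G where "G p = T (fst p) h (snd p) - d * h (snd p)" for p
    have Gc: "continuous_on ({0..e1} \<times> {-1..1}) G"
      unfolding G_def by (intro continuous_intros continuous_T2[OF hc] continuous_on_compose2[OF hc]) auto
    obtain y0 where y0: "y0 \<in> {-1..1}" "\<And>y. y \<in> {-1..1} \<Longrightarrow> T es q y0 \<le> T es q y"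
      using continuous_attains_inf[OF _ _ continuous_T[OF qc esI]] by auto
    define m where "m = T es q y0"
    have m: "0 < m" unfolding m_def by (rule qp[OF y0(1)])
    have "uniformly_continuous_on ({0..e1} \<times> {-1..1}) G"
      by (intro compact_uniformly_continuous Gc compact_Times compact_Icc)
    then obtain \<delta> where \<delta>: "0 < \<delta>" and H: "\<And>p p'. \<lbrakk>p \<in> {0..e1} \<times> {-1..1}; p' \<in> {0..e1} \<times> {-1..1}; dist p' p < \<delta>\<rbrakk>
         \<Longrightarrow> dist (G p') (G p) < m"
      unfolding uniformly_continuous_on_def using m by metis
    \<comment> \<open>A step of half the modulus of uniform continuity of \<open>G\<close> costs
      less than the margin \<open>m\<close>; the maximum with 0 keeps the new parameter in
      range.\<close>
    define e' where "e' = max 0 (es - \<delta>/2)"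
    have e': "0 \<le> e'" "e' < es" "\<bar>e' - es\<bar> < \<delta>" "e' \<in> {0..e1}"
      using \<delta> es_pos es1 by (auto simp: e'_def)
    have "sub d e' h"
      unfolding sub_def
    proof (intro conjI hc ballI)
      show "0 \<le> h t" if "t \<in> {-1..1}" for t using hpos[OF that] by simp
      show "\<exists>t\<in>{-1..1}. 0 < h t" using hpos[of 0] by force
      fix y :: real assume y: "y \<in> {-1..1}"
      have "dist (e', y) (es, y) < \<delta>" using e' by (simp add: dist_Pair_Pair dist_real_def)
      then have "dist (G (e', y)) (G (es, y)) < m" using y e' esI by (intro H) auto
      moreover have "G (es, y) \<ge> m" using y0(2)[OF y] qe[OF y] by (simp add: G_def m_def)
      ultimately have "0 < G (e', y)" by (auto simp: dist_real_def)
      then show "d * h y \<le> T e' h y" by (simp add: G_def)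
    qed
    then have "e' \<in> S" using e' by (auto simp: S_def)
    then have "es \<le> e'" unfolding es_def using Sb by (rule cInf_lower)
    then show False using e' by simp
  qed
  show ?thesis
  proof (rule that[OF esp g(1)])
    show "0 < g x" if "x \<in> {-1..1}" for x using gh[OF that] hpos[OF that] d
      by (metis zero_less_mult_pos)
    show "T es g x = d * g x" if "x \<in> {-1..1}" for x using gh[OF that] by (simp add: h_def)
  qed
qed

end

section \<open>Sine series\<close>

lemma integral_cos_substitution:
  fixes h :: "real \<Rightarrow> 'a::euclidean_space"
  assumes "continuous_on {-1..1} h"
  shows "integral {-1..1} h = integral {0..pi} (\<lambda>\<phi>. sin \<phi> *\<^sub>R h (cos \<phi>))"
proof -
  have "((\<lambda>\<phi>. (- sin \<phi>) *\<^sub>R h (cos \<phi>)) has_integral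
          (integral {cos 0..cos pi} h - integral {cos pi..cos 0} h)) {0..pi}"
    by (rule has_integral_substitution_general[where s = "{}" and c = "-1" and d = 1])
       (use assms in \<open>auto intro!: derivative_eq_intros continuous_intros\<close>)
  then have "((\<lambda>\<phi>. - (sin \<phi> *\<^sub>R h (cos \<phi>))) has_integral (- integral {-1..1} h)) {0..pi}"
    by simp
  from has_integral_neg[OF this] have "((\<lambda>\<phi>. sin \<phi> *\<^sub>R h (cos \<phi>)) has_integral (integral {-1..1} h)) {0..pi}"
    by simp
  then show ?thesis by (rule integral_unique[symmetric])
qed

lemma has_integral_cos_multiple:
  assumes "n \<noteq> (0::int)"
  shows "((\<lambda>\<phi>. cos (of_int n * \<phi>)) has_integral 0) {0..pi}"
proof -
  have "((\<lambda>\<phi>. cos (of_int n * \<phi>)) has_integral (sin (of_int n * pi) / n - sin (of_int n * 0) / n)) {0..pi}"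
    by (rule fundamental_theorem_of_calculus)
       (use assms in \<open>auto intro!: derivative_eq_intros simp: has_real_derivative_iff_has_vector_derivative[symmetric]\<close>)
  then show ?thesis by (simp add: sin_integer_2pi mult.commute[of _ pi])
qed

lemma integral_sin_sin:
  "integral {0..pi} (\<lambda>\<phi>. sin (real n * \<phi>) * sin (real m * \<phi>)) = (if n = m \<and> n \<noteq> 0 then pi / 2 else 0)"
proof -
  have eq: "sin (real n * \<phi>) * sin (real m * \<phi>)
        = (1/2) * cos (of_int (int n - int m) * \<phi>) - (1/2) * cos (of_int (int n + int m) * \<phi>)" for \<phi>
    by (simp add: cos_add cos_diff algebra_simps)
  have one: "((\<lambda>\<phi>. cos (of_int k * \<phi>)) has_integral (if k = 0 then pi else 0)) {0..pi}" for k :: int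
    using has_integral_cos_multiple[of k] has_integral_const_real[of "1::real" 0 pi] by auto
  have "((\<lambda>\<phi>. sin (real n * \<phi>) * sin (real m * \<phi>)) has_integral
      ((1/2) * (if int n - int m = 0 then pi else 0) - (1/2) * (if int n + int m = 0 then pi else 0))) {0..pi}"
    unfolding eq by (intro has_integral_diff has_integral_mult_right one)
  then show ?thesis by (auto dest!: integral_unique)
qed

lemma integral_cos_cos:
  "integral {0..pi} (\<lambda>\<phi>. cos (real n * \<phi>) * cos (real m * \<phi>)) = (if n = m then if n = 0 then pi else pi / 2 else 0)"
proof -
  have eq: "cos (real n * \<phi>) * cos (real m * \<phi>)
        = (1/2) * cos (of_int (int n - int m) * \<phi>) + (1/2) * cos (of_int (int n + int m) * \<phi>)" for \<phi>
    by (simp add: cos_add cos_diff algebra_simps)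
  have one: "((\<lambda>\<phi>. cos (of_int k * \<phi>)) has_integral (if k = 0 then pi else 0)) {0..pi}" for k :: int
    using has_integral_cos_multiple[of k] has_integral_const_real[of "1::real" 0 pi] by auto
  have "((\<lambda>\<phi>. cos (real n * \<phi>) * cos (real m * \<phi>)) has_integral
      ((1/2) * (if int n - int m = 0 then pi else 0) + (1/2) * (if int n + int m = 0 then pi else 0))) {0..pi}"
    unfolding eq by (intro has_integral_add has_integral_mult_right one)
  then show ?thesis by (auto dest!: integral_unique)
qed

text \<open>Each power of cosine is a combination of the functions \<open>cos (n \<phi>)\<close>, so a function whose
  cosine coefficients vanish is orthogonal to every polynomial in \<open>cos \<phi>\<close>.\<close>

lemma cosine_coefficients_zero:
  fixes h :: "real \<Rightarrow> real"
  assumes h: "continuous_on {0..pi} h"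
    and z: "\<And>n. integral {0..pi} (\<lambda>\<phi>. h \<phi> * cos (real n * \<phi>)) = 0"
    and \<phi>: "\<phi> \<in> {0..pi}"
  shows "h \<phi> = 0"
proof -
  have ci: "(\<lambda>\<phi>. h \<phi> * g \<phi>) integrable_on {0..pi}" if "continuous_on {0..pi} g" for g
    by (intro integrable_continuous_real continuous_intros h that)
  have pw: "integral {0..pi} (\<lambda>\<phi>. h \<phi> * (cos \<phi> ^ k * cos (real n * \<phi>))) = 0" for k n
  proof (induction k arbitrary: n)
    case 0
    then show ?case using z by simp
  next
    case (Suc k)
    \<comment> \<open>The product of \<open>cos \<phi>\<close> and \<open>cos (n * \<phi>)\<close>
      is the mean of the neighbours \<open>n + 1\<close> and \<open>n - 1\<close>. For
      \<open>n = 0\<close> the lower neighbour is \<open>cos (- \<phi>)\<close>, hence the value 1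
      in place of the truncated \<open>n - 1\<close>.\<close>
    have eq: "h \<phi> * (cos \<phi> ^ Suc k * cos (real n * \<phi>)) =
        (1/2) * (h \<phi> * (cos \<phi> ^ k * cos (real (Suc n) * \<phi>)))
        + (1/2) * (h \<phi> * (cos \<phi> ^ k * cos (real (if n = 0 then 1 else n - 1) * \<phi>)))" for \<phi>
    proof -
      have "cos \<phi> * cos (real n * \<phi>) = (1/2) * cos (real (Suc n) * \<phi>) + (1/2) * cos (real n * \<phi> - \<phi>)"
        by (simp add: cos_add cos_diff algebra_simps)
      also have "cos (real n * \<phi> - \<phi>) = cos (real (if n = 0 then 1 else n - 1) * \<phi>)"
        by (cases n) (auto simp: algebra_simps)
      finally have *: "cos \<phi> * cos (real n * \<phi>) = (1/2) * cos (real (Suc n) * \<phi>)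
          + (1/2) * cos (real (if n = 0 then 1 else n - 1) * \<phi>)" .
      have "h \<phi> * (cos \<phi> ^ Suc k * cos (real n * \<phi>)) = h \<phi> * cos \<phi> ^ k * (cos \<phi> * cos (real n * \<phi>))"
        by simp
      then show ?thesis unfolding * by (simp only: algebra_simps)
    qed
    have "((\<lambda>\<phi>. h \<phi> * (cos \<phi> ^ Suc k * cos (real n * \<phi>))) has_integral
        ((1/2) * integral {0..pi} (\<lambda>\<phi>. h \<phi> * (cos \<phi> ^ k * cos (real (Suc n) * \<phi>)))
        + (1/2) * integral {0..pi} (\<lambda>\<phi>. h \<phi> * (cos \<phi> ^ k * cos (real (if n = 0 then 1 else n - 1) * \<phi>))))) {0..pi}"
      unfolding eq
      by (intro has_integral_add has_integral_mult_right integrable_integral ci continuous_intros)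
    then show ?case unfolding Suc.IH by (simp add: integral_unique)
  qed
  have poly: "integral {0..pi} (\<lambda>\<phi>. h \<phi> * p (cos \<phi>)) = 0" if "real_polynomial_function p" for p
  proof -
    have "\<exists>a n::nat. p = (\<lambda>x. \<Sum>i\<le>n. a i * x ^ i)"
      by (rule real_polynomial_function_imp_sum[OF that])
    then obtain a n where p: "p = (\<lambda>x. \<Sum>i\<le>(n::nat). a i * x ^ i)"
      by (elim exE)
    have "integral {0..pi} (\<lambda>\<phi>. h \<phi> * p (cos \<phi>)) = integral {0..pi} (\<lambda>\<phi>. \<Sum>i\<le>n. a i * (h \<phi> * cos \<phi> ^ i))"
      by (simp add: p sum_distrib_left mult_ac)
    also have "\<dots> = (\<Sum>i\<le>n. a i * integral {0..pi} (\<lambda>\<phi>. h \<phi> * cos \<phi> ^ i))"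
      by (subst integral_sum) (auto intro!: integrable_on_mult_right ci continuous_intros)
    also have "\<dots> = 0" using pw[of _ 0] by simp
    finally show ?thesis .
  qed
  have arc: "continuous_on {-1..1} (\<lambda>x. h (arccos x))"
    by (rule continuous_on_compose2[OF h]) (auto intro!: continuous_intros arccos_lbound arccos_ubound)
  define A where "A = integral {0..pi} (\<lambda>\<phi>. \<bar>h \<phi>\<bar>)"
  have A: "0 \<le> A" unfolding A_def by (intro integral_nonneg integrable_continuous_real continuous_intros h) auto
  \<comment> \<open>Subtracting a polynomial in \<open>cos \<phi>\<close> changes nothing by
    orthogonality, so the integral of \<open>h\<^sup>2\<close> equals that of
    \<open>h * (h - p)\<close>, which Weierstrass approximation makes as small as desired.\<close>
  have small: "integral {0..pi} (\<lambda>\<phi>. h \<phi> * h \<phi>) \<le> e * A" if e: "0 < e" for e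
  proof -
    obtain p where p: "real_polynomial_function p" "\<And>x. x \<in> {-1..1} \<Longrightarrow> \<bar>h (arccos x) - p x\<bar> < e"
      using Stone_Weierstrass_real_polynomial_function[OF _ arc e] by auto
    have pc: "continuous_on {0..pi} (\<lambda>\<phi>. p (cos \<phi>))"
    proof (rule continuous_on_compose2[of UNIV p])
      show "continuous_on UNIV p"
        by (rule continuous_on_polymonial_function) (use p(1) real_polynomial_function_eq in blast)
    qed (auto intro!: continuous_intros)
    have "integral {0..pi} (\<lambda>\<phi>. h \<phi> * h \<phi>) = integral {0..pi} (\<lambda>\<phi>. h \<phi> * h \<phi>) - integral {0..pi} (\<lambda>\<phi>. h \<phi> * p (cos \<phi>))"
      using poly[OF p(1)] by simp
    also have "\<dots> = integral {0..pi} (\<lambda>\<phi>. h \<phi> * h \<phi> - h \<phi> * p (cos \<phi>))"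
      by (rule integral_diff[symmetric]) (intro ci h pc)+
    also have "\<dots> \<le> integral {0..pi} (\<lambda>\<phi>. e * \<bar>h \<phi>\<bar>)"
    proof (rule integral_le)
      show "(\<lambda>\<phi>. h \<phi> * h \<phi> - h \<phi> * p (cos \<phi>)) integrable_on {0..pi}"
        by (intro integrable_continuous_real continuous_intros h pc)
      show "(\<lambda>\<phi>. e * \<bar>h \<phi>\<bar>) integrable_on {0..pi}"
        by (intro integrable_continuous_real continuous_intros h)
      fix \<phi> :: real assume \<phi>: "\<phi> \<in> {0..pi}"
      have "\<bar>h \<phi> - p (cos \<phi>)\<bar> \<le> e" using p(2)[of "cos \<phi>"] \<phi> by (simp add: arccos_cos)
      then have "\<bar>h \<phi>\<bar> * \<bar>h \<phi> - p (cos \<phi>)\<bar> \<le> \<bar>h \<phi>\<bar> * e" by (intro mult_left_mono) auto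
      then show "h \<phi> * h \<phi> - h \<phi> * p (cos \<phi>) \<le> e * \<bar>h \<phi>\<bar>"
        by (metis abs_le_D1 abs_mult mult.commute right_diff_distrib)
    qed
    also have "\<dots> = e * A" unfolding A_def by simp
    finally show ?thesis .
  qed
  have "integral {0..pi} (\<lambda>\<phi>. h \<phi> * h \<phi>) \<le> 0"
  proof (rule field_le_epsilon)
    fix r :: real assume "0 < r"
    then have "integral {0..pi} (\<lambda>\<phi>. h \<phi> * h \<phi>) \<le> r / (A + 1) * A" using A by (intro small) auto
    also have "\<dots> \<le> r" using \<open>0 < r\<close> A by (simp add: field_simps)
    finally show "integral {0..pi} (\<lambda>\<phi>. h \<phi> * h \<phi>) \<le> 0 + r" by simp
  qed
  moreover have "0 \<le> integral {0..pi} (\<lambda>\<phi>. h \<phi> * h \<phi>)"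
    by (intro integral_nonneg ci h) auto
  ultimately have "integral {0..pi} (\<lambda>\<phi>. h \<phi> * h \<phi>) = 0" by simp
  then have "\<forall>\<phi>\<in>{0..pi}. h \<phi> * h \<phi> = 0"
    by (subst (asm) integral_eq_0_iff) (auto intro!: continuous_intros h)
  then show ?thesis using \<phi> by simp
qed

text \<open>The generating function of the Chebyshev polynomials of the second kind, multiplied by
  \<open>sin \<phi>\<close>. It is the difference of two geometric series with ratios
  \<open>s * cis \<phi>\<close> and \<open>s * cnj (cis \<phi>)\<close>.\<close>

lemma sine_kernel_expansion:
  fixes s :: complex
  assumes s: "norm s < 1"
  shows "(\<lambda>n. s ^ n * of_real (sin (real (Suc n) * \<phi>))) sums (of_real (sin \<phi>) / (1 - 2 * s * of_real (cos \<phi>) + s\<^sup>2))"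
proof -
  define w where "w = cis \<phi>"
  have w: "w * cnj w = 1" "norm w = 1" "w + cnj w = 2 * of_real (cos \<phi>)" "w - cnj w = 2 * \<i> * of_real (sin \<phi>)"
    by (auto simp: w_def complex_eq_iff cis_cnj power2_eq_square[symmetric])
  have n1: "norm (s * w) < 1" "norm (s * cnj w) < 1" using s w(2) by (auto simp: norm_mult)
  have "(\<lambda>n. w * (s * w) ^ n - cnj w * (s * cnj w) ^ n) sums (w * (1 / (1 - s * w)) - cnj w * (1 / (1 - s * cnj w)))"
    by (intro sums_diff sums_mult geometric_sums n1)
  then have "(\<lambda>n. (1 / (2 * \<i>)) * (w * (s * w) ^ n - cnj w * (s * cnj w) ^ n)) sums
      ((1 / (2 * \<i>)) * (w * (1 / (1 - s * w)) - cnj w * (1 / (1 - s * cnj w))))"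
    by (rule sums_mult)
  moreover have "(1 / (2 * \<i>)) * (w * (s * w) ^ n - cnj w * (s * cnj w) ^ n) = s ^ n * of_real (sin (real (Suc n) * \<phi>))" for n
  proof -
    have "w * (s * w) ^ n - cnj w * (s * cnj w) ^ n = s ^ n * (w ^ Suc n - cnj w ^ Suc n)"
      by (simp add: power_mult_distrib algebra_simps)
    also have "w ^ Suc n - cnj w ^ Suc n = 2 * \<i> * of_real (sin (real (Suc n) * \<phi>))"
    proof -
      have "w ^ Suc n = cis (real (Suc n) * \<phi>)" unfolding w_def by (rule Complex.DeMoivre)
      then have "w ^ Suc n - cnj w ^ Suc n = cis (real (Suc n) * \<phi>) - cnj (cis (real (Suc n) * \<phi>))"
        unfolding complex_cnj_power[symmetric] by (simp only:)
      also have "\<dots> = 2 * \<i> * of_real (sin (real (Suc n) * \<phi>))"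
        unfolding complex_eq_iff by (simp del: of_nat_Suc)
      finally show ?thesis .
    qed
    finally have eq: "w * (s * w) ^ n - cnj w * (s * cnj w) ^ n = (2 * \<i>) * (s ^ n * of_real (sin (real (Suc n) * \<phi>)))"
      by (simp only: mult_ac)
    have "(1 / (2 * \<i>)) * ((2 * \<i>) * z) = z" for z by (simp add: mult.assoc[symmetric])
    then show ?thesis unfolding eq .
  qed
  moreover have "(1 / (2 * \<i>)) * (w * (1 / (1 - s * w)) - cnj w * (1 / (1 - s * cnj w)))
      = of_real (sin \<phi>) / (1 - 2 * s * of_real (cos \<phi>) + s\<^sup>2)"
  proof -
    have nz: "1 - s * w \<noteq> 0" "1 - s * cnj w \<noteq> 0" using n1 by auto
    have "w * (1 / (1 - s * w)) - cnj w * (1 / (1 - s * cnj w)) = (w - cnj w) / ((1 - s * w) * (1 - s * cnj w))"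
      using nz w(1) by (simp add: field_simps)
    also have "(1 - s * w) * (1 - s * cnj w) = 1 - s * (w + cnj w) + s\<^sup>2 * (w * cnj w)"
      by (simp add: algebra_simps power2_eq_square)
    finally show ?thesis unfolding w(1,3,4) by simp
  qed
  ultimately show ?thesis by simp
qed

lemma sine_kernel_denominator_nonzero:
  fixes s :: complex
  assumes "norm s < 1"
  shows "1 - 2 * s * of_real (cos \<phi>) + s\<^sup>2 \<noteq> 0"
proof -
  have "(1 - s * cis \<phi>) * (1 - s * cnj (cis \<phi>)) = 1 - s * (cis \<phi> + cnj (cis \<phi>)) + s\<^sup>2 * (cis \<phi> * cnj (cis \<phi>))"
    by (simp add: algebra_simps power2_eq_square)
  also have "cis \<phi> + cnj (cis \<phi>) = 2 * of_real (cos \<phi>)" by (simp add: complex_eq_iff)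
  also have "cis \<phi> * cnj (cis \<phi>) = 1" by (simp add: cis_cnj cis_mult)
  finally have *: "1 - 2 * s * of_real (cos \<phi>) + s\<^sup>2 = (1 - s * cis \<phi>) * (1 - s * cnj (cis \<phi>))" by simp
  have "norm (s * cis \<phi>) < 1" "norm (s * cnj (cis \<phi>)) < 1" using assms by (auto simp: norm_mult)
  then have "1 - s * cis \<phi> \<noteq> 0" "1 - s * cnj (cis \<phi>) \<noteq> 0" by auto
  then show ?thesis unfolding * by simp
qed

text \<open>Termwise integration under a geometric majorant. The formula serves twice: in real form
  it expands the kernel of the operator, in complex form it computes the Cauchy integral.\<close>

lemma sine_series_integral:
  fixes s :: complex and w :: "real \<Rightarrow> real"
  assumes s: "norm s < 1" and w: "continuous_on {0..pi} w"
  shows "(\<lambda>n. s ^ n * of_real (integral {0..pi} (\<lambda>\<phi>. w \<phi> * sin (real (Suc n) * \<phi>)))) sums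
     integral {0..pi} (\<lambda>\<phi>. of_real (w \<phi>) * (of_real (sin \<phi>) / (1 - 2 * s * of_real (cos \<phi>) + s\<^sup>2)))"
proof -
  have "bounded (w ` {0..pi})" by (intro compact_imp_bounded compact_continuous_image w) simp
  then obtain B where "\<forall>y\<in>w ` {0..pi}. norm y \<le> B" unfolding bounded_iff by blast
  then have B: "\<And>\<phi>. \<phi> \<in> {0..pi} \<Longrightarrow> \<bar>w \<phi>\<bar> \<le> B" by simp
  define f where "f n \<phi> = s ^ n * of_real (w \<phi> * sin (real (Suc n) * \<phi>))" for n \<phi>
  define F where "F \<phi> = of_real (w \<phi>) * (of_real (sin \<phi>) / (1 - 2 * s * of_real (cos \<phi>) + s\<^sup>2))" for \<phi>
  have sm: "(\<lambda>n. f n \<phi>) sums F \<phi>" for \<phi>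
    using sums_mult[OF sine_kernel_expansion[OF s, of \<phi>], of "of_real (w \<phi>)"]
    by (simp add: f_def F_def mult_ac)
  have U: "uniform_limit {0..pi} (\<lambda>N \<phi>. \<Sum>n<N. f n \<phi>) (\<lambda>\<phi>. \<Sum>n. f n \<phi>) sequentially"
  proof (rule Weierstrass_m_test)
    show "norm (f n \<phi>) \<le> B * norm s ^ n" if \<phi>: "\<phi> \<in> {0..pi}" for n \<phi>
    proof -
      have "\<bar>w \<phi>\<bar> * \<bar>sin (real (Suc n) * \<phi>)\<bar> \<le> B * 1"
        using B[OF \<phi>] by (intro mult_mono abs_sin_le_one) auto
      then have "norm s ^ n * (\<bar>w \<phi>\<bar> * \<bar>sin (real (Suc n) * \<phi>)\<bar>) \<le> norm s ^ n * (B * 1)"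
        by (intro mult_left_mono) auto
      then show ?thesis unfolding f_def norm_mult norm_power norm_of_real abs_mult by (simp add: mult.commute)
    qed
    show "summable (\<lambda>n. B * norm s ^ n)" using s by (intro summable_mult summable_geometric) auto
  qed
  have "(\<lambda>\<phi>. \<Sum>n. f n \<phi>) = F" using sm by (auto simp: sums_iff)
  note U = U[unfolded this]
  obtain I J where IJ: "\<And>N. ((\<lambda>\<phi>. \<Sum>n<N. f n \<phi>) has_integral I N) {0..pi}" "(F has_integral J) {0..pi}" "I \<longlonglongrightarrow> J"
  proof (rule uniform_limit_integral[OF U])
    show "continuous_on {0..pi} (\<lambda>\<phi>. \<Sum>n<N. f n \<phi>)" for N
      unfolding f_def by (intro continuous_intros w)
  qed auto
  have "I N = (\<Sum>n<N. s ^ n * of_real (integral {0..pi} (\<lambda>\<phi>. w \<phi> * sin (real (Suc n) * \<phi>))))" for N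
  proof -
    have "((\<lambda>\<phi>. \<Sum>n<N. f n \<phi>) has_integral (\<Sum>n<N. s ^ n * of_real (integral {0..pi} (\<lambda>\<phi>. w \<phi> * sin (real (Suc n) * \<phi>))))) {0..pi}"
      unfolding f_def
      by (intro has_integral_sum has_integral_mult_right has_integral_of_real integrable_integral
            integrable_continuous_real continuous_intros w) auto
    then show ?thesis using IJ(1) has_integral_unique by blast
  qed
  then have "(\<lambda>N. \<Sum>n<N. s ^ n * of_real (integral {0..pi} (\<lambda>\<phi>. w \<phi> * sin (real (Suc n) * \<phi>)))) \<longlonglongrightarrow> J"
    using IJ(3) by presburger
  moreover have "J = integral {0..pi} F" using IJ(2) by (rule integral_unique[symmetric])
  ultimately show ?thesis unfolding sums_def F_def[symmetric] by simp
qed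

lemma real_sine_series_integral:
  fixes s :: real and w :: "real \<Rightarrow> real"
  assumes s: "\<bar>s\<bar> < 1" and w: "continuous_on {0..pi} w"
  shows "(\<lambda>n. s ^ n * integral {0..pi} (\<lambda>\<phi>. w \<phi> * sin (real (Suc n) * \<phi>))) sums
     integral {0..pi} (\<lambda>\<phi>. w \<phi> * sin \<phi> / (1 - 2 * s * cos \<phi> + s\<^sup>2))"
proof -
  have ne: "1 - 2 * s * cos \<phi> + s\<^sup>2 \<noteq> 0" for \<phi>
  proof -
    have "complex_of_real (1 - 2 * s * cos \<phi> + s\<^sup>2) \<noteq> 0"
      using sine_kernel_denominator_nonzero[of "of_real s" \<phi>] s by simp
    then show ?thesis by (simp only: of_real_eq_0_iff not_False_eq_True)
  qed
  have "((\<lambda>\<phi>. complex_of_real (w \<phi> * sin \<phi> / (1 - 2 * s * cos \<phi> + s\<^sup>2))) has_integral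
          of_real (integral {0..pi} (\<lambda>\<phi>. w \<phi> * sin \<phi> / (1 - 2 * s * cos \<phi> + s\<^sup>2)))) {0..pi}"
    by (intro has_integral_of_real integrable_integral integrable_continuous_real continuous_intros w) (use ne in auto)
  from integral_unique[OF this] sine_series_integral[of "of_real s", OF _ w] s
  have "(\<lambda>n. complex_of_real (s ^ n * integral {0..pi} (\<lambda>\<phi>. w \<phi> * sin (real (Suc n) * \<phi>)))) sums
     of_real (integral {0..pi} (\<lambda>\<phi>. w \<phi> * sin \<phi> / (1 - 2 * s * cos \<phi> + s\<^sup>2)))"
    by simp
  then show ?thesis by (simp only: sums_of_real_iff)
qed

section \<open>From an eigenfunction to its trigonometric series\<close>

text \<open>One integration by parts; the boundary terms drop out because \<open>q\<close> vanishes
  at both ends. A second factor \<open>1 / n\<close> comes later, when the series is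
  integrated.\<close>

lemma sine_coefficient_decay:
  fixes q q' :: "real \<Rightarrow> real"
  assumes q: "\<And>\<phi>. \<phi> \<in> {0..pi} \<Longrightarrow> (q has_real_derivative q' \<phi>) (at \<phi> within {0..pi})"
    and q': "continuous_on {0..pi} q'" and q0: "q 0 = 0" "q pi = 0"
  obtains C where "0 \<le> C" "\<And>n. \<bar>integral {0..pi} (\<lambda>\<phi>. q \<phi> * sin (real (Suc n) * \<phi>))\<bar> \<le> C / real (Suc n)"
proof -
  have "bounded (q' ` {0..pi})" by (intro compact_imp_bounded compact_continuous_image q') simp
  then obtain B where "\<forall>y\<in>q' ` {0..pi}. norm y \<le> B" unfolding bounded_iff by blast
  then have B: "\<And>\<phi>. \<phi> \<in> {0..pi} \<Longrightarrow> \<bar>q' \<phi>\<bar> \<le> B" by simp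
  have B0: "0 \<le> B" using B[of 0] by force
  have qc: "continuous_on {0..pi} q" using q by (meson DERIV_continuous_on)
  show ?thesis
  proof (rule that[of "B * pi"])
    fix n
    define m where "m = real (Suc n)"
    have m: "m > 0" by (simp add: m_def)
    have "((\<lambda>\<phi>. q \<phi> * sin (m * \<phi>) - q' \<phi> * cos (m * \<phi>) / m) has_integral
            (- q pi * cos (m * pi) / m - (- q 0 * cos (m * 0) / m))) {0..pi}"
      by (rule fundamental_theorem_of_calculus)
         (use m in \<open>auto intro!: derivative_eq_intros q simp: has_real_derivative_iff_has_vector_derivative[symmetric] field_simps\<close>)
    then have 1: "integral {0..pi} (\<lambda>\<phi>. q \<phi> * sin (m * \<phi>) - q' \<phi> * cos (m * \<phi>) / m) = 0"
      using q0 by (simp add: integral_unique)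
    have "integral {0..pi} (\<lambda>\<phi>. q \<phi> * sin (m * \<phi>) - q' \<phi> * cos (m * \<phi>) / m) =
      integral {0..pi} (\<lambda>\<phi>. q \<phi> * sin (m * \<phi>)) - integral {0..pi} (\<lambda>\<phi>. q' \<phi> * cos (m * \<phi>) / m)"
      by (intro integral_diff integrable_continuous_real continuous_intros qc q') (use m in auto)
    then have 2: "integral {0..pi} (\<lambda>\<phi>. q \<phi> * sin (m * \<phi>)) = integral {0..pi} (\<lambda>\<phi>. q' \<phi> * cos (m * \<phi>) / m)"
      using 1 by simp
    have "norm (integral {0..pi} (\<lambda>\<phi>. q' \<phi> * cos (m * \<phi>) / m)) \<le> (B / m) * (pi - 0)"
    proof (rule integral_bound)
      show "continuous_on {0..pi} (\<lambda>\<phi>. q' \<phi> * cos (m * \<phi>) / m)" by (intro continuous_intros q') (use m in auto)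
      fix \<phi> :: real assume "\<phi> \<in> {0..pi}"
      then have "\<bar>q' \<phi>\<bar> * \<bar>cos (m * \<phi>)\<bar> \<le> B * 1" using B B0 by (intro mult_mono abs_cos_le_one) auto
      then show "norm (q' \<phi> * cos (m * \<phi>) / m) \<le> B / m" using m by (simp add: abs_mult divide_right_mono)
    qed simp
    then show "\<bar>integral {0..pi} (\<lambda>\<phi>. q \<phi> * sin (real (Suc n) * \<phi>))\<bar> \<le> B * pi / real (Suc n)"
      using 2 by (simp add: m_def)
  qed (use B0 in simp)
qed

lemma summable_over_squares:
  assumes "\<And>n. \<bar>c (Suc n)\<bar> \<le> C / (real (Suc n))\<^sup>2"
  shows "summable (\<lambda>n. \<bar>c n\<bar> :: real)"
proof -
  have "summable (\<lambda>n. C * (1 / (real (Suc n))\<^sup>2))"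
    using inverse_power_summable[of 2, where 'a = real] summable_Suc_iff[of "\<lambda>n. inverse (real n ^ 2)"]
    by (intro summable_mult) (simp add: inverse_eq_divide)
  then have "summable (\<lambda>n. \<bar>c (Suc n)\<bar>)"
    by (rule summable_comparison_test'[where N = 0]) (use assms in auto)
  then show ?thesis by (rule summable_Suc_iff[THEN iffD1])
qed

lemma summable_power_bounded:
  fixes b :: "nat \<Rightarrow> real"
  assumes "\<And>n. \<bar>b n\<bar> \<le> M" "\<bar>s\<bar> < 1"
  shows "summable (\<lambda>n. b n * s ^ n)"
proof (rule summable_comparison_test'[where N = 0])
  show "summable (\<lambda>n. M * \<bar>s\<bar> ^ n)" using assms by (intro summable_mult summable_geometric) auto
  show "norm (b n * s ^ n) \<le> M * \<bar>s\<bar> ^ n" for n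
    using mult_right_mono[OF assms(1)[of n], of "\<bar>s\<bar> ^ n"] by (simp add: abs_mult power_abs)
qed

text \<open>The eigenvalue equation is the derivative in \<open>x\<close> of the desired identity,
  and the coefficients \<open>c\<close> are the cosine coefficients of an antiderivative of
  \<open>v\<close>. Continuity of \<open>v\<close> alone would not give the quadratic decay, but the
  equation writes \<open>v\<close> through power series evaluated at the smooth functions
  \<open>s i\<close>, so \<open>v\<close> is continuously differentiable.\<close>

lemma eigenfunction_sine_series:
  fixes v :: "real \<Rightarrow> real" and s s' s'' :: "'i \<Rightarrow> real \<Rightarrow> real"
  assumes I: "finite I" and d: "d \<noteq> 0"
    and v: "continuous_on {-1..1} v" and vpos: "\<And>x. x \<in> {-1..1} \<Longrightarrow> 0 < v x"
    and s: "\<And>i x. \<lbrakk>i \<in> I; x \<in> {-1..1}\<rbrakk> \<Longrightarrow> \<bar>s i x\<bar> < 1"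
    and s': "\<And>i x. \<lbrakk>i \<in> I; x \<in> {-1..1}\<rbrakk> \<Longrightarrow> (s i has_real_derivative s' i x) (at x within {-1..1})"
    and s'': "\<And>i x. \<lbrakk>i \<in> I; x \<in> {-1..1}\<rbrakk> \<Longrightarrow> (s' i has_real_derivative s'' i x) (at x within {-1..1})"
    and s''_cont: "\<And>i. i \<in> I \<Longrightarrow> continuous_on {-1..1} (s'' i)"
    and eigen: "\<And>x. x \<in> {-1..1} \<Longrightarrow> d * v x =
       (\<Sum>i\<in>I. s' i x * (2 / pi * integral {-1..1} (\<lambda>t. sqrt (1 - t\<^sup>2) * v t / (1 - 2 * s i x * t + (s i x)\<^sup>2))))"
  obtains c :: "nat \<Rightarrow> real" and C k :: real
  where "c 0 = 0" "\<And>n. \<bar>c (Suc n)\<bar> \<le> C / (real (Suc n))\<^sup>2" "\<exists>n. c n \<noteq> 0"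
    "\<And>\<theta>. \<theta> \<in> {0..pi} \<Longrightarrow>
        d * (\<Sum>n. c n * cos (real n * \<theta>)) = (\<Sum>i\<in>I. \<Sum>n. c n * s i (cos \<theta>) ^ n) + k"
proof -
  \<comment> \<open>The factor \<open>sin \<phi>\<close> makes \<open>q\<close> vanish at both ends,
    as the decay estimate requires, and comes from the measure \<open>dt\<close> under
    \<open>t = cos \<phi>\<close>. The index of \<open>b\<close> is shifted: \<open>b n\<close> is
    the coefficient of \<open>sin ((n + 1) * \<phi>)\<close>.\<close>
  define q where "q \<phi> = v (cos \<phi>) * sin \<phi>" for \<phi>
  define b where "b n = 2 / pi * integral {0..pi} (\<lambda>\<phi>. q \<phi> * sin (real (Suc n) * \<phi>))" for n
  have vc: "continuous_on {0..pi} (\<lambda>\<phi>. v (cos \<phi>))"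
    by (rule continuous_on_compose2[OF v]) (auto intro!: continuous_intros)
  have qc: "continuous_on {0..pi} q" unfolding q_def by (intro continuous_intros vc)
  define G where "G r = (\<Sum>n. b n * r ^ n)" for r
  \<comment> \<open>Under \<open>t = cos \<phi>\<close> the weight
    \<open>sqrt (1 - t\<^sup>2)\<close> and the measure give one factor \<open>sin \<phi>\<close>
    each. One belongs to \<open>q\<close>, the other to the numerator of the sine kernel.\<close>
  have Geq: "2 / pi * integral {-1..1} (\<lambda>t. sqrt (1 - t\<^sup>2) * v t / (1 - 2 * r * t + r\<^sup>2)) = G r" if r: "\<bar>r\<bar> < 1" for r
  proof -
    have pos: "1 - 2 * r * t + r\<^sup>2 \<noteq> 0" if "t \<in> {-1..1}" for t
    proof -
      have "\<bar>r * t\<bar> \<le> \<bar>r\<bar>" using that mult_left_le[of "\<bar>t\<bar>" "\<bar>r\<bar>"] by (simp add: abs_mult abs_le_iff)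
      then have "r * t \<le> \<bar>r\<bar>" by simp
      then have "(1 - \<bar>r\<bar>)\<^sup>2 \<le> 1 - 2 * r * t + r\<^sup>2" by (simp add: power2_eq_square algebra_simps)
      moreover have "0 < (1 - \<bar>r\<bar>)\<^sup>2" using r by simp
      ultimately show ?thesis by linarith
    qed
    have "integral {-1..1} (\<lambda>t. sqrt (1 - t\<^sup>2) * v t / (1 - 2 * r * t + r\<^sup>2))
       = integral {0..pi} (\<lambda>\<phi>. sin \<phi> *\<^sub>R (sqrt (1 - (cos \<phi>)\<^sup>2) * v (cos \<phi>) / (1 - 2 * r * cos \<phi> + r\<^sup>2)))"
      by (rule integral_cos_substitution) (use pos in \<open>auto intro!: continuous_intros v simp: abs_square_le_1\<close>)
    also have "\<dots> = integral {0..pi} (\<lambda>\<phi>. q \<phi> * sin \<phi> / (1 - 2 * r * cos \<phi> + r\<^sup>2))"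
    proof (rule integral_cong)
      fix \<phi> :: real assume "\<phi> \<in> {0..pi}"
      then have "sqrt (1 - (cos \<phi>)\<^sup>2) = sin \<phi>"
        by (simp add: sin_squared_eq[symmetric] sin_ge_zero)
      then show "sin \<phi> *\<^sub>R (sqrt (1 - (cos \<phi>)\<^sup>2) * v (cos \<phi>) / (1 - 2 * r * cos \<phi> + r\<^sup>2)) = q \<phi> * sin \<phi> / (1 - 2 * r * cos \<phi> + r\<^sup>2)"
        by (simp add: q_def)
    qed
    finally have 1: "integral {-1..1} (\<lambda>t. sqrt (1 - t\<^sup>2) * v t / (1 - 2 * r * t + r\<^sup>2)) = 
        integral {0..pi} (\<lambda>\<phi>. q \<phi> * sin \<phi> / (1 - 2 * r * cos \<phi> + r\<^sup>2))" .
    show ?thesis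
      unfolding 1 G_def using sums_mult[OF real_sine_series_integral[OF r qc], of "2/pi"]
      by (auto simp: sums_iff b_def mult_ac)
  qed
  obtain M where M: "\<And>n. \<bar>b n\<bar> \<le> M"
  proof -
    have "bounded (q ` {0..pi})" by (intro compact_imp_bounded compact_continuous_image qc) simp
    then obtain B where "\<forall>y\<in>q ` {0..pi}. norm y \<le> B" unfolding bounded_iff by blast
    then have B: "\<And>\<phi>. \<phi> \<in> {0..pi} \<Longrightarrow> \<bar>q \<phi>\<bar> \<le> B" by simp
    have B0: "0 \<le> B" using B[of 0] by force
    have "\<bar>b n\<bar> \<le> 2 * B" for n
    proof -
      have "norm (integral {0..pi} (\<lambda>\<phi>. q \<phi> * sin (real (Suc n) * \<phi>))) \<le> B * (pi - 0)"
      proof (rule integral_bound)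
        show "continuous_on {0..pi} (\<lambda>\<phi>. q \<phi> * sin (real (Suc n) * \<phi>))" by (intro continuous_intros qc)
        fix \<phi> :: real assume "\<phi> \<in> {0..pi}"
        then have "\<bar>q \<phi>\<bar> * \<bar>sin (real (Suc n) * \<phi>)\<bar> \<le> B * 1" using B B0 by (intro mult_mono abs_sin_le_one) auto
        then show "norm (q \<phi> * sin (real (Suc n) * \<phi>)) \<le> B" by (simp add: abs_mult)
      qed simp
      then have "2 / pi * \<bar>integral {0..pi} (\<lambda>\<phi>. q \<phi> * sin (real (Suc n) * \<phi>))\<bar> \<le> 2 / pi * (B * pi)"
        by (intro mult_left_mono) auto
      then show ?thesis by (simp add: b_def abs_mult del: of_nat_Suc)
    qed
    then show ?thesis by (rule that)
  qed
  have bsum: "summable (\<lambda>n. b n * r ^ n)" if "norm r < 1" for r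
    using summable_power_bounded[of b M r] M that by simp
  have dG: "(G has_real_derivative (\<Sum>n. diffs b n * r ^ n)) (at r)" if "\<bar>r\<bar> < 1" for r
    unfolding G_def by (rule termdiffs_strong'[where K = 1]) (use bsum that in auto)
  define G' where "G' r = (\<Sum>n. diffs b n * r ^ n)" for r
  have dsum: "summable (\<lambda>n. diffs b n * r ^ n)" if "norm r < 1" for r
    by (rule termdiff_converges[OF that bsum])
  have dG': "(G' has_real_derivative (\<Sum>n. diffs (diffs b) n * r ^ n)) (at r)" if "\<bar>r\<bar> < 1" for r
    unfolding G'_def by (rule termdiffs_strong'[where K = 1]) (use dsum that in auto)
  have G'c: "continuous_on {-1..1} (\<lambda>x. G' (s i x))" if i: "i \<in> I" for i
  proof (rule continuous_on_compose2[of "{-1<..<1}" G' _ "s i"])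
    show "continuous_on {-1<..<1} G'"
      by (intro continuous_at_imp_continuous_on ballI DERIV_isCont[OF dG']) auto
    show "continuous_on {-1..1} (s i)" using s'[OF i] by (meson DERIV_continuous_on)
    show "s i ` {-1..1} \<subseteq> {-1<..<1}"
    proof
      fix r assume "r \<in> s i ` {-1..1}"
      then obtain x where "x \<in> {-1..1}" "r = s i x" by blast
      then show "r \<in> {-1<..<1}" using s[OF i, of x] by (simp add: abs_less_iff)
    qed
  qed
  have Gi: "((\<lambda>x. G (s i x)) has_real_derivative (G' (s i x) * s' i x)) (at x within {-1..1})"
    if "i \<in> I" "x \<in> {-1..1}" for i x
    unfolding G'_def by (rule DERIV_chain2[OF dG[OF s[OF that]] s'[OF that]])
  \<comment> \<open>The gain of regularity happens here: the right-hand side is differentiable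
    because \<open>G\<close> is a power series and the arguments stay inside the unit
    interval.\<close>
  have veq: "v x = (\<Sum>i\<in>I. s' i x * G (s i x)) / d" if x: "x \<in> {-1..1}" for x
  proof -
    have "d * v x = (\<Sum>i\<in>I. s' i x * G (s i x))"
      unfolding eigen[OF x] by (intro sum.cong refl) (simp only: Geq[OF s[OF _ x]])
    then show ?thesis using d by (simp add: field_simps)
  qed
  define v' where "v' x = (\<Sum>i\<in>I. s'' i x * G (s i x) + (G' (s i x) * s' i x) * s' i x) / d" for x
  have dv: "(v has_real_derivative v' x) (at x within {-1..1})" if x: "x \<in> {-1..1}" for x
  proof -
    have "((\<lambda>x. (\<Sum>i\<in>I. s' i x * G (s i x)) / d) has_real_derivative v' x) (at x within {-1..1})"
      unfolding v'_def using d
      by (auto intro!: DERIV_cdivide DERIV_sum DERIV_mult s'' Gi x)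
    then show ?thesis
      by (rule has_field_derivative_transform_within[OF _ zero_less_one x]) (simp add: veq)
  qed
  have sc: "continuous_on {-1..1} (s' i)" "continuous_on {-1..1} (\<lambda>x. G (s i x))" if "i \<in> I" for i
    using s'' Gi that by (meson DERIV_continuous_on)+
  have v'c: "continuous_on {-1..1} v'"
    unfolding v'_def using d by (intro continuous_intros s''_cont sc G'c) auto
  define q' where "q' \<phi> = v (cos \<phi>) * cos \<phi> - v' (cos \<phi>) * sin \<phi> * sin \<phi>" for \<phi>
  have dq: "(q has_real_derivative q' \<phi>) (at \<phi> within {0..pi})" if "\<phi> \<in> {0..pi}" for \<phi>
  proof -
    have "((v \<circ> cos) has_real_derivative (v' (cos \<phi>) * - sin \<phi>)) (at \<phi> within {0..pi})"
    proof (rule DERIV_image_chain)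
      show "(v has_real_derivative v' (cos \<phi>)) (at (cos \<phi>) within cos ` {0..pi})"
        by (rule DERIV_subset[OF dv]) auto
      show "(cos has_real_derivative - sin \<phi>) (at \<phi> within {0..pi})" by (auto intro!: derivative_eq_intros)
    qed
    then have vd: "((\<lambda>\<phi>. v (cos \<phi>)) has_real_derivative (v' (cos \<phi>) * - sin \<phi>)) (at \<phi> within {0..pi})"
      by (simp add: o_def)
    show ?thesis unfolding q_def q'_def
      by (rule derivative_eq_intros vd refl | simp)+
  qed
  have q'c: "continuous_on {0..pi} q'"
    unfolding q'_def
    by (intro continuous_intros vc continuous_on_compose2[OF v'c, of _ cos]) auto
  obtain C0 where C0: "0 \<le> C0" "\<And>n. \<bar>integral {0..pi} (\<lambda>\<phi>. q \<phi> * sin (real (Suc n) * \<phi>))\<bar> \<le> C0 / real (Suc n)"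
    using sine_coefficient_decay[OF dq q'c] by (auto simp: q_def)
  \<comment> \<open>Integrating the sine series of \<open>q\<close> divides the coefficient of
    \<open>sin (n * \<phi>)\<close> by \<open>n\<close>. The constant term is set to 0; the true
    mean of the antiderivative is carried separately by \<open>m0\<close>.\<close>
  define c where "c n = (case n of 0 \<Rightarrow> 0 | Suc m \<Rightarrow> b m / real (Suc m))" for n
  have c0: "c 0 = 0" and cS: "c (Suc n) = b n / real (Suc n)" for n by (auto simp: c_def)
  have cb: "\<bar>c (Suc n)\<bar> \<le> (2 / pi * C0) / (real (Suc n))\<^sup>2" for n
  proof -
    have "\<bar>b n\<bar> \<le> 2 / pi * (C0 / real (Suc n))"
      using mult_left_mono[OF C0(2)[of n], of "2/pi"] by (simp add: b_def abs_mult del: of_nat_Suc)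
    then have "\<bar>b n\<bar> / real (Suc n) \<le> 2 / pi * (C0 / real (Suc n)) / real (Suc n)"
      by (intro divide_right_mono) auto
    then show ?thesis unfolding cS by (simp add: power2_eq_square mult.assoc del: of_nat_Suc)
  qed
  have csum: "summable (\<lambda>n. \<bar>c n\<bar>)" by (rule summable_over_squares[OF cb])
  define S where "S \<theta> = (\<Sum>n. c n * cos (real n * \<theta>))" for \<theta>
  define P where "P r = (\<Sum>n. c n * r ^ n)" for r
  define U where "U x = integral {-1..x} v" for x
  have dU: "(U has_real_derivative v x) (at x within {-1..1})" if "x \<in> {-1..1}" for x
    unfolding U_def by (rule integral_has_real_derivative[OF v that])
  have Uc: "continuous_on {-1..1} U" using dU by (meson DERIV_continuous_on)
  have Ucc: "continuous_on {0..pi} (\<lambda>\<phi>. U (cos \<phi>))"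
    by (rule continuous_on_compose2[OF Uc]) (auto intro!: continuous_intros)
  have cbnd: "norm (c n * cos (real n * \<theta>)) \<le> \<bar>c n\<bar>" for n \<theta>
    using mult_left_mono[OF abs_cos_le_one[of "real n * \<theta>"], of "\<bar>c n\<bar>"] by (simp add: abs_mult)
  have Sunif: "uniform_limit A (\<lambda>N \<theta>. \<Sum>n<N. c n * cos (real n * \<theta>)) S sequentially" for A
    unfolding S_def[abs_def] by (rule Weierstrass_m_test[OF cbnd csum])
  have Sc: "continuous_on {0..pi} S"
    by (rule uniform_limit_theorem[OF _ Sunif]) (auto intro!: always_eventually continuous_intros)
  have Scoef: "integral {0..pi} (\<lambda>\<phi>. S \<phi> * cos (real m * \<phi>)) = (pi / 2) * c m" for m
  proof -
    have "uniform_limit {0..pi} (\<lambda>N \<theta>. (\<Sum>n<N. c n * cos (real n * \<theta>)) * cos (real m * \<theta>)) (\<lambda>\<theta>. S \<theta> * cos (real m * \<theta>)) sequentially"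
    proof (rule uniform_lim_mult[OF Sunif uniform_limit_const])
      have "bounded (S ` {0..pi})" by (intro compact_imp_bounded compact_continuous_image Sc) simp
      then show "bounded (S ` {0..pi})" .
      show "bounded ((\<lambda>\<theta>. cos (real m * \<theta>)) ` {0..pi})"
        by (intro compact_imp_bounded compact_continuous_image continuous_intros) simp
    qed
    then obtain I' J where IJ: "\<And>N. ((\<lambda>\<phi>. (\<Sum>n<N. c n * cos (real n * \<phi>)) * cos (real m * \<phi>)) has_integral I' N) {0..pi}"
       "((\<lambda>\<theta>. S \<theta> * cos (real m * \<theta>)) has_integral J) {0..pi}" "I' \<longlonglongrightarrow> J"
      by (rule uniform_limit_integral) (auto intro!: continuous_intros)
    have "I' N = (pi / 2) * c m" if N: "N > m" for N
    proof -
      have "I' N = integral {0..pi} (\<lambda>\<phi>. \<Sum>n<N. c n * (cos (real n * \<phi>) * cos (real m * \<phi>)))"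
        using integral_unique[OF IJ(1)[of N]] by (simp add: sum_distrib_right mult.assoc)
      also have "\<dots> = (\<Sum>n<N. c n * (if n = m then if n = 0 then pi else pi / 2 else 0))"
        by (subst integral_sum) (auto intro!: integrable_continuous_real continuous_intros simp: integral_cos_cos)
      also have "\<dots> = (\<Sum>n<N. if n = m then c m * (pi / 2) else 0)"
        by (intro sum.cong) (auto simp: c0)
      also have "\<dots> = (pi / 2) * c m" using N by simp
      finally show ?thesis .
    qed
    then have "I' \<longlonglongrightarrow> (pi / 2) * c m"
      by (intro tendsto_eventually eventually_sequentiallyI[of "Suc m"]) auto
    then have "J = (pi / 2) * c m" using IJ(3) LIMSEQ_unique by blast
    then show ?thesis using IJ(2) by (simp add: integral_unique)
  qed
  have dUc: "((\<lambda>\<phi>. U (cos \<phi>)) has_real_derivative (- q \<phi>)) (at \<phi> within {0..pi})" if "\<phi> \<in> {0..pi}" for \<phi>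
  proof -
    have "((U \<circ> cos) has_real_derivative (v (cos \<phi>) * - sin \<phi>)) (at \<phi> within {0..pi})"
    proof (rule DERIV_image_chain)
      show "(U has_real_derivative v (cos \<phi>)) (at (cos \<phi>) within cos ` {0..pi})"
        by (rule DERIV_subset[OF dU]) auto
      show "(cos has_real_derivative - sin \<phi>) (at \<phi> within {0..pi})" by (auto intro!: derivative_eq_intros)
    qed
    then show ?thesis by (simp add: o_def q_def)
  qed
  have Ucoef: "integral {0..pi} (\<lambda>\<phi>. U (cos \<phi>) * cos (real (Suc m) * \<phi>)) = (pi / 2) * c (Suc m)" for m
  proof -
    define M where "M = real (Suc m)"
    have Mp: "M > 0" by (simp add: M_def)
    have "((\<lambda>\<phi>. U (cos \<phi>) * cos (M * \<phi>) - q \<phi> * sin (M * \<phi>) / M) has_integral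
            (U (cos pi) * sin (M * pi) / M - U (cos 0) * sin (M * 0) / M)) {0..pi}"
      by (rule fundamental_theorem_of_calculus)
         (use Mp in \<open>auto intro!: derivative_eq_intros dUc simp: has_real_derivative_iff_has_vector_derivative[symmetric] field_simps\<close>)
    moreover have "sin (M * pi) = 0" unfolding M_def by (metis sin_npi)
    ultimately have "integral {0..pi} (\<lambda>\<phi>. U (cos \<phi>) * cos (M * \<phi>) - q \<phi> * sin (M * \<phi>) / M) = 0"
      by (simp add: integral_unique)
    moreover have "integral {0..pi} (\<lambda>\<phi>. U (cos \<phi>) * cos (M * \<phi>) - q \<phi> * sin (M * \<phi>) / M) =
        integral {0..pi} (\<lambda>\<phi>. U (cos \<phi>) * cos (M * \<phi>)) - integral {0..pi} (\<lambda>\<phi>. q \<phi> * sin (M * \<phi>) / M)"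
      by (intro integral_diff integrable_continuous_real continuous_intros Ucc qc) (use Mp in auto)
    ultimately have "integral {0..pi} (\<lambda>\<phi>. U (cos \<phi>) * cos (M * \<phi>)) = integral {0..pi} (\<lambda>\<phi>. q \<phi> * sin (M * \<phi>)) / M"
      by simp
    then show ?thesis by (simp add: M_def cS b_def del: of_nat_Suc)
  qed
  define m0 where "m0 = integral {0..pi} (\<lambda>\<phi>. U (cos \<phi>)) / pi"
  \<comment> \<open>Both sides are continuous and have the same cosine coefficients: for positive
    index by integration by parts, for index 0 by the choice of \<open>m0\<close>.\<close>
  have US: "U (cos \<theta>) = S \<theta> + m0" if \<theta>: "\<theta> \<in> {0..pi}" for \<theta>
  proof -
    have "U (cos \<theta>) - S \<theta> - m0 = 0"
    proof (rule cosine_coefficients_zero[OF _ _ \<theta>])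
      show "continuous_on {0..pi} (\<lambda>\<phi>. U (cos \<phi>) - S \<phi> - m0)" by (intro continuous_intros Ucc Sc)
      fix n
      have eq: "integral {0..pi} (\<lambda>\<phi>. (U (cos \<phi>) - S \<phi> - m0) * cos (real n * \<phi>)) =
         integral {0..pi} (\<lambda>\<phi>. U (cos \<phi>) * cos (real n * \<phi>)) - integral {0..pi} (\<lambda>\<phi>. S \<phi> * cos (real n * \<phi>))
         - m0 * integral {0..pi} (\<lambda>\<phi>. cos (real n * \<phi>))"
        unfolding left_diff_distrib integral_mult_right[symmetric]
        by (subst integral_diff integral_diff, (intro integrable_continuous_real continuous_intros Ucc Sc)+)+ simp
      show "integral {0..pi} (\<lambda>\<phi>. (U (cos \<phi>) - S \<phi> - m0) * cos (real n * \<phi>)) = 0"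
      proof (cases n)
        case 0
        then show ?thesis unfolding eq Scoef using c0 by (simp add: m0_def)
      next
        case (Suc m)
        then show ?thesis unfolding eq Scoef using Ucoef[of m] integral_unique[OF has_integral_cos_multiple[of "int n"]] by simp
      qed
    qed
    then show ?thesis by simp
  qed
  \<comment> \<open>Since \<open>P\<close> is a primitive of \<open>G\<close>, the sum in the
    eigenvalue equation is the derivative of \<open>\<Sum> P (s i x)\<close>. Integrating the
    equation produces the constant \<open>k0\<close>.\<close>
  have dP: "(P has_real_derivative G r) (at r)" if r: "\<bar>r\<bar> < 1" for r
  proof -
    obtain Mc where Mc: "\<And>n. \<bar>c n\<bar> \<le> Mc"
    proof -
      have "(\<lambda>n. \<bar>c n\<bar>) \<longlonglongrightarrow> 0" by (rule summable_LIMSEQ_zero[OF csum])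
      then have "Bseq (\<lambda>n. \<bar>c n\<bar>)" by (intro convergent_imp_Bseq) (auto simp: convergent_def)
      then show ?thesis using that by (auto simp: Bseq_def)
    qed
    have "(P has_real_derivative (\<Sum>n. diffs c n * r ^ n)) (at r)"
      unfolding P_def by (rule termdiffs_strong'[where K = 1])
         (use summable_power_bounded[OF Mc] r in auto)
    moreover have "diffs c = b" by (auto simp: diffs_def cS fun_eq_iff simp del: of_nat_Suc)
    ultimately show ?thesis by (simp add: G_def)
  qed
  obtain k0 where k0: "\<And>x. x \<in> {-1..1} \<Longrightarrow> d * U x - (\<Sum>i\<in>I. P (s i x)) = k0"
  proof -
    have "((\<lambda>x. d * U x - (\<Sum>i\<in>I. P (s i x))) has_real_derivative 0) (at x within {-1..1})" if x: "x \<in> {-1..1}" for x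
    proof -
      have "((\<lambda>x. d * U x - (\<Sum>i\<in>I. P (s i x))) has_real_derivative (d * v x - (\<Sum>i\<in>I. G (s i x) * s' i x))) (at x within {-1..1})"
        by (intro DERIV_diff DERIV_cmult dU x DERIV_sum DERIV_chain2[OF dP] s s')
      moreover have "d * v x - (\<Sum>i\<in>I. G (s i x) * s' i x) = 0"
        using veq[OF x] d by (simp add: mult.commute)
      ultimately show ?thesis by simp
    qed
    then have "\<exists>k. \<forall>x\<in>{-1..1}. d * U x - (\<Sum>i\<in>I. P (s i x)) = k"
      by (intro has_field_derivative_zero_constant) auto
    then show ?thesis using that by blast
  qed
  show ?thesis
  proof (rule that[of c "2 / pi * C0" "k0 - d * m0"])
    show "\<exists>n. c n \<noteq> 0"
    proof (rule ccontr)
      assume "\<not> ?thesis"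
      \<comment> \<open>With all coefficients zero the antiderivative would take equal values at
        both ends, which is impossible for a positive \<open>v\<close>.\<close>
      then have "S \<theta> = 0" for \<theta> by (simp add: S_def)
      then have "U 1 = U (-1)" using US[of 0] US[of pi] by simp
      then have "integral {-1..1} v = 0" by (simp add: U_def)
      then have "\<forall>x\<in>{-1..1}. v x = 0"
        using vpos by (subst (asm) integral_eq_0_iff[OF v]) (auto simp: less_imp_le)
      then show False using vpos[of 0] by simp
    qed
    show "d * (\<Sum>n. c n * cos (real n * \<theta>)) = (\<Sum>i\<in>I. \<Sum>n. c n * s i (cos \<theta>) ^ n) + (k0 - d * m0)"
      if "\<theta> \<in> {0..pi}" for \<theta>
      using k0[of "cos \<theta>"] US[OF that] by (simp add: S_def P_def algebra_simps)
  qed (use c0 cb in auto)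
qed

section \<open>Principal value integrals\<close>

lemma punctured_interval_eq:
  fixes x :: real
  assumes "0 < \<epsilon>"
  shows "{a..b} - {x-\<epsilon><..<x+\<epsilon>} = {a..min b (x-\<epsilon>)} \<union> {max a (x+\<epsilon>)..b}"
  using assms by auto

lemma integrable_punctured:
  fixes f :: "real \<Rightarrow> real"
  assumes "0 < \<epsilon>" "continuous_on ({a..b} - {x}) f"
  shows "f integrable_on ({a..b} - {x-\<epsilon><..<x+\<epsilon>})"
proof -
  have "f integrable_on {a..min b (x-\<epsilon>)}" "f integrable_on {max a (x+\<epsilon>)..b}"
    using assms by (auto intro!: integrable_continuous_real elim!: continuous_on_subset)
  moreover have "{a..min b (x-\<epsilon>)} \<inter> {max a (x+\<epsilon>)..b} = {}" using assms(1) by auto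
  ultimately show ?thesis
    unfolding punctured_interval_eq[OF assms(1)] by (intro integrable_Un) auto
qed

text \<open>Dominated convergence along every sequence of radii. The value 0 at \<open>x\<close>
  makes the truncated functions converge at the puncture as well.\<close>

lemma tendsto_punctured_integral:
  fixes f h :: "real \<Rightarrow> real"
  assumes f: "continuous_on ({a..b} - {x}) f" and h: "h integrable_on {a..b}"
    and le: "\<And>t. t \<in> {a..b} \<Longrightarrow> \<bar>f t\<bar> \<le> h t" and fx: "f x = 0"
  shows "((\<lambda>\<epsilon>. integral ({a..b} - {x-\<epsilon><..<x+\<epsilon>}) f) \<longlongrightarrow> integral {a..b} f) (at_right 0)"
  unfolding tendsto_at_iff_sequentially
proof (intro allI impI)
  fix X :: "nat \<Rightarrow> real" assume X: "\<forall>i. X i \<in> {0<..} - {0}" "X \<longlonglongrightarrow> 0"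
  have Xp: "0 < X i" for i using X(1) by auto
  define F where "F i t = (if t \<in> - {x - X i<..<x + X i} then f t else 0)" for i t
  have eq: "- {x - X i<..<x + X i} \<inter> {a..b} = {a..b} - {x - X i<..<x + X i}" for i by auto
  have "(\<lambda>i. integral {a..b} (F i)) \<longlonglongrightarrow> integral {a..b} f"
  proof (rule dominated_convergence(2)[OF _ h])
    show "F i integrable_on {a..b}" for i
      unfolding F_def[abs_def] integrable_restrict_Int eq by (rule integrable_punctured[OF Xp f])
    show "norm (F i t) \<le> h t" if "t \<in> {a..b}" for i t
      using le[OF that] by (auto simp: F_def)
    show "(\<lambda>i. F i t) \<longlonglongrightarrow> f t" if "t \<in> {a..b}" for t
    proof (cases "t = x")
      case True
      then show ?thesis using fx Xp by (simp add: F_def)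
    next
      case False
      then have "\<forall>\<^sub>F i in sequentially. X i < \<bar>t - x\<bar>" using X(2) by (intro order_tendstoD) auto
      then have "\<forall>\<^sub>F i in sequentially. F i t = f t" by eventually_elim (auto simp: F_def)
      then show ?thesis by (rule tendsto_eventually)
    qed
  qed
  moreover have "integral {a..b} (F i) = integral ({a..b} - {x - X i<..<x + X i}) f" for i
    unfolding F_def[abs_def] integral_restrict_Int eq ..
  ultimately show "((\<lambda>\<epsilon>. integral ({a..b} - {x-\<epsilon><..<x+\<epsilon>}) f) \<circ> X) \<longlonglongrightarrow> integral {a..b} f"
    by (simp add: o_def)
qed

text \<open>A continuous remainder contributes its ordinary integral. This reduces the second
  integral of the equation to the first one, once the Cauchy kernel has been split off.\<close>

lemma has_pv_integral_add_continuous: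
  fixes f g :: "real \<Rightarrow> real"
  assumes f: "has_pv_integral f a b x I" and g: "continuous_on {a..b} g"
    and eq: "\<And>t. \<lbrakk>t \<in> {a..b}; t \<noteq> x\<rbrakk> \<Longrightarrow> F t = f t + g t"
  shows "has_pv_integral F a b x (I + integral {a..b} g)"
  unfolding has_pv_integral_def
proof (intro conjI allI impI)
  define g0 where "g0 t = (if t = x then 0 else g t)" for t
  have g0c: "continuous_on ({a..b} - {x}) g0"
    by (rule continuous_on_eq[OF continuous_on_subset[OF g]]) (auto simp: g0_def)
  have "bounded (g ` {a..b})" by (intro compact_imp_bounded compact_continuous_image g) simp
  then obtain B where "\<forall>y\<in>g ` {a..b}. norm y \<le> B" unfolding bounded_iff by blast
  then have B: "\<bar>g t\<bar> \<le> B" if "t \<in> {a..b}" for t using that by auto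
  have sum: "integral ({a..b} - {x-\<epsilon><..<x+\<epsilon>}) F = integral ({a..b} - {x-\<epsilon><..<x+\<epsilon>}) f + integral ({a..b} - {x-\<epsilon><..<x+\<epsilon>}) g0"
    and int: "F integrable_on ({a..b} - {x-\<epsilon><..<x+\<epsilon>})" if \<epsilon>: "0 < \<epsilon>" for \<epsilon>
  proof -
    have i: "f integrable_on ({a..b} - {x-\<epsilon><..<x+\<epsilon>})" using f \<epsilon> unfolding has_pv_integral_def by blast
    have j: "g0 integrable_on ({a..b} - {x-\<epsilon><..<x+\<epsilon>})" by (rule integrable_punctured[OF \<epsilon> g0c])
    have e: "F t = f t + g0 t" if "t \<in> {a..b} - {x-\<epsilon><..<x+\<epsilon>}" for t using that \<epsilon> eq[of t] by (auto simp: g0_def)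
    show "integral ({a..b} - {x-\<epsilon><..<x+\<epsilon>}) F = integral ({a..b} - {x-\<epsilon><..<x+\<epsilon>}) f + integral ({a..b} - {x-\<epsilon><..<x+\<epsilon>}) g0"
      using integral_add[OF i j] integral_cong[of "{a..b} - {x-\<epsilon><..<x+\<epsilon>}" F "\<lambda>t. f t + g0 t", OF e] by simp
    show "F integrable_on ({a..b} - {x-\<epsilon><..<x+\<epsilon>})"
      using integrable_add[OF i j] integrable_cong[of "{a..b} - {x-\<epsilon><..<x+\<epsilon>}" F "\<lambda>t. f t + g0 t", OF e] by simp
  qed
  show "F integrable_on {a..b} - {x-\<epsilon><..<x+\<epsilon>}" if "0 < \<epsilon>" for \<epsilon> by (rule int[OF that])
  have "((\<lambda>\<epsilon>. integral ({a..b} - {x-\<epsilon><..<x+\<epsilon>}) g0) \<longlongrightarrow> integral {a..b} g0) (at_right 0)"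
  proof (rule tendsto_punctured_integral[OF g0c, of "\<lambda>_. max B 0"])
    show "\<bar>g0 t\<bar> \<le> max B 0" if "t \<in> {a..b}" for t using B[OF that] by (auto simp: g0_def)
  qed (auto simp: g0_def)
  moreover have "integral {a..b} g0 = integral {a..b} g"
    by (rule integral_spike[of "{x}"]) (auto simp: g0_def)
  ultimately have "((\<lambda>\<epsilon>. integral ({a..b} - {x-\<epsilon><..<x+\<epsilon>}) f + integral ({a..b} - {x-\<epsilon><..<x+\<epsilon>}) g0)
      \<longlongrightarrow> I + integral {a..b} g) (at_right 0)"
    using f by (intro tendsto_add) (auto simp: has_pv_integral_def)
  moreover have "\<forall>\<^sub>F \<epsilon> in at_right (0::real). 0 < \<epsilon>" by (rule eventually_at_right_less)
  ultimately show "((\<lambda>\<epsilon>. integral ({a..b} - {x-\<epsilon><..<x+\<epsilon>}) F) \<longlongrightarrow> I + integral {a..b} g) (at_right 0)"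
    by (elim Lim_transform_eventually) (auto elim!: eventually_mono simp: sum)
qed

text \<open>This is the majorant for the difference quotient of a Hoelder function. Its
  antiderivative \<open>sgn (t - x) * \<bar>t - x\<bar> powr \<alpha> / \<alpha>\<close> is
  continuous across \<open>x\<close>, so the fundamental theorem applies with one exceptional
  point.\<close>

lemma integrable_abs_powr:
  fixes x \<alpha> :: real
  assumes \<alpha>: "0 < \<alpha>" and x: "-1 \<le> x" "x \<le> 1"
  shows "(\<lambda>t. \<bar>t - x\<bar> powr (\<alpha> - 1)) integrable_on {-1..1}"
proof -
  define P where "P t = sgn (t - x) * \<bar>t - x\<bar> powr \<alpha> / \<alpha>" for t
  have "((\<lambda>t. \<bar>t - x\<bar> powr (\<alpha> - 1)) has_integral (P 1 - P (-1))) {-1..1}"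
  proof (rule fundamental_theorem_of_calculus_interior_strong[where S = "{x}"])
    fix t assume t: "t \<in> {-1<..<1} - {x}"
    show "(P has_vector_derivative \<bar>t - x\<bar> powr (\<alpha> - 1)) (at t)"
    proof (cases "t > x")
      case True
      have "((\<lambda>t. (t - x) powr \<alpha> / \<alpha>) has_real_derivative (t - x) powr (\<alpha> - 1)) (at t)"
        using True \<alpha> by (auto intro!: derivative_eq_intros)
      then have "(P has_real_derivative (t - x) powr (\<alpha> - 1)) (at t)"
        by (rule has_field_derivative_transform_within_open[of _ _ _ "{x<..}"])
           (use True in \<open>auto simp: P_def\<close>)
      then show ?thesis using True by (simp add: has_real_derivative_iff_has_vector_derivative)
    next
      case False
      have "((\<lambda>t. - ((x - t) powr \<alpha>) / \<alpha>) has_real_derivative (x - t) powr (\<alpha> - 1)) (at t)"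
        using False t \<alpha> by (auto intro!: derivative_eq_intros)
      then have "(P has_real_derivative (x - t) powr (\<alpha> - 1)) (at t)"
        by (rule has_field_derivative_transform_within_open[of _ _ _ "{..<x}"])
           (use False t in \<open>auto simp: P_def\<close>)
      then show ?thesis using False t by (simp add: has_real_derivative_iff_has_vector_derivative)
    qed
  next
    have "isCont P t" for t
    proof (cases "t = x")
      case False
      have "isCont (\<lambda>t. (t - x) / \<bar>t - x\<bar> * \<bar>t - x\<bar> powr \<alpha> / \<alpha>) t"
        using False \<alpha> by (intro continuous_intros) auto
      moreover have "(\<lambda>t. (t - x) / \<bar>t - x\<bar> * \<bar>t - x\<bar> powr \<alpha> / \<alpha>) = P"
        by (auto simp: P_def real_sgn_eq)
      ultimately show ?thesis by simp
    next
      case True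
      have "((\<lambda>t. \<bar>t - x\<bar> powr \<alpha> / \<alpha>) \<longlongrightarrow> \<bar>x - x\<bar> powr \<alpha> / \<alpha>) (at x)"
        using \<alpha> by (intro tendsto_intros) auto
      then have "((\<lambda>t. \<bar>t - x\<bar> powr \<alpha> / \<alpha>) \<longlongrightarrow> 0) (at x)" using \<alpha> by simp
      then have "(P \<longlongrightarrow> 0) (at x)"
        by (rule Lim_null_comparison[rotated]) (use \<alpha> in \<open>auto simp: P_def abs_mult sgn_if intro!: always_eventually\<close>)
      then show ?thesis using True \<alpha> by (simp add: isCont_def P_def)
    qed
    then show "continuous_on {-1..1} P" by (simp add: continuous_at_imp_continuous_on)
  qed auto
  then show ?thesis by blast
qed

lemma hoelder_on_imp_continuous_on:
  assumes "hoelder_on S f"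
  shows "continuous_on S f"
proof -
  obtain \<alpha> C where \<alpha>: "0 < \<alpha>" and H: "\<And>x y. \<lbrakk>x\<in>S; y\<in>S\<rbrakk> \<Longrightarrow> norm (f x - f y) \<le> C * \<bar>x - y\<bar> powr \<alpha>"
    using assms unfolding hoelder_on_def by blast
  show ?thesis unfolding continuous_on_def
  proof
    fix x assume x: "x \<in> S"
    have "((\<lambda>y. C * \<bar>y - x\<bar> powr \<alpha>) \<longlongrightarrow> C * \<bar>x - x\<bar> powr \<alpha>) (at x within S)"
      using \<alpha> by (intro tendsto_intros) auto
    then have "((\<lambda>y. C * \<bar>y - x\<bar> powr \<alpha>) \<longlongrightarrow> 0) (at x within S)" using \<alpha> by simp
    then have "((\<lambda>y. f y - f x) \<longlongrightarrow> 0) (at x within S)"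
      by (rule Lim_null_comparison[rotated]) (use H x in \<open>auto simp: eventually_at_filter\<close>)
    then show "(f \<longlongrightarrow> f x) (at x within S)" by (simp add: LIM_zero_iff)
  qed
qed

text \<open>Both the truncated integrals and the real parts of the Cauchy integral above \<open>x\<close> converge to
  the integral of the difference quotient plus a logarithm.\<close>

lemma has_pv_integral_hoelder:
  assumes u: "hoelder_on {-1..1} u" and x: "-1 < x" "x < 1"
    and L: "((\<lambda>\<epsilon>. Re (cauchy_integral u (Complex x \<epsilon>))) \<longlongrightarrow> L) (at_right 0)"
  shows "has_pv_integral (\<lambda>t. u t / (t - x)) (-1) 1 x L"
proof -
  obtain \<alpha> C where \<alpha>: "0 < \<alpha>" and H: "\<And>s t. \<lbrakk>s\<in>{-1..1}; t\<in>{-1..1}\<rbrakk> \<Longrightarrow> \<bar>u s - u t\<bar> \<le> C * \<bar>s - t\<bar> powr \<alpha>"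
    using u unfolding hoelder_on_def real_norm_def by blast
  have uc: "continuous_on {-1..1} u" by (rule hoelder_on_imp_continuous_on[OF u])
  have xI: "x \<in> {-1..1}" using x by simp
  define D where "D t = (u t - u x) / (t - x)" for t
  define h where "h t = \<bar>C\<bar> * \<bar>t - x\<bar> powr (\<alpha> - 1)" for t
  have h: "h integrable_on {-1..1}"
    unfolding h_def by (intro integrable_on_mult_right integrable_abs_powr \<alpha>) (use x in auto)
  have Dh: "\<bar>D t\<bar> \<le> h t" if "t \<in> {-1..1}" for t
  proof (cases "t = x")
    case False
    have "\<bar>u t - u x\<bar> \<le> \<bar>C\<bar> * \<bar>t - x\<bar> powr \<alpha>"
      using H[OF that xI] by (meson abs_ge_self mult_right_mono order_trans powr_ge_zero)
    then have "\<bar>D t\<bar> \<le> \<bar>C\<bar> * \<bar>t - x\<bar> powr \<alpha> / \<bar>t - x\<bar>"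
      unfolding D_def abs_divide by (rule divide_right_mono) simp
    also have "\<dots> = h t" using False by (simp add: h_def powr_diff)
    finally show ?thesis .
  qed (simp add: D_def h_def)
  have Dc: "continuous_on ({-1..1} - {x}) D"
    unfolding D_def by (intro continuous_intros continuous_on_subset[OF uc]) auto
  have A: "((\<lambda>\<epsilon>. integral ({-1..1} - {x-\<epsilon><..<x+\<epsilon>}) D) \<longlongrightarrow> integral {-1..1} D) (at_right 0)"
    by (rule tendsto_punctured_integral[OF Dc h Dh]) (auto simp: D_def)
  \<comment> \<open>The regularised kernel
    \<open>(t - x) / ((t - x)\<^sup>2 + \<epsilon>\<^sup>2)\<close> is at most
    \<open>1 / \<bar>t - x\<bar>\<close> in modulus, so the majorant of the difference quotient also
    serves here.\<close>
  have B: "((\<lambda>\<epsilon>. integral {-1..1} (\<lambda>t. (u t - u x) * (t - x) / ((t - x)\<^sup>2 + \<epsilon>\<^sup>2))) \<longlongrightarrow> integral {-1..1} D) (at_right 0)"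
    unfolding tendsto_at_iff_sequentially
  proof (intro allI impI)
    fix X :: "nat \<Rightarrow> real" assume X: "\<forall>i. X i \<in> {0<..} - {0}" "X \<longlonglongrightarrow> 0"
    have Xp: "0 < X i" for i using X(1) by auto
    have pos: "0 < (t - x)\<^sup>2 + (X i)\<^sup>2" for t i using Xp[of i] by (simp add: add_nonneg_pos)
    have "(\<lambda>i. integral {-1..1} (\<lambda>t. (u t - u x) * (t - x) / ((t - x)\<^sup>2 + (X i)\<^sup>2))) \<longlonglongrightarrow> integral {-1..1} D"
    proof (rule dominated_convergence(2)[OF _ h])
      show "(\<lambda>t. (u t - u x) * (t - x) / ((t - x)\<^sup>2 + (X i)\<^sup>2)) integrable_on {-1..1}" for i
        by (intro integrable_continuous_real continuous_intros uc) (use Xp[of i] in auto)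
      fix t :: real assume t: "t \<in> {-1..1}"
      show "norm ((u t - u x) * (t - x) / ((t - x)\<^sup>2 + (X i)\<^sup>2)) \<le> h t" for i
      proof (cases "t = x")
        case False
        have "(u t - u x) * (t - x) / ((t - x)\<^sup>2 + (X i)\<^sup>2) = D t * ((t - x)\<^sup>2 / ((t - x)\<^sup>2 + (X i)\<^sup>2))"
          using False by (simp add: D_def power2_eq_square)
        also have "norm \<dots> \<le> \<bar>D t\<bar> * 1"
        proof -
          have "\<bar>(t - x)\<^sup>2 / ((t - x)\<^sup>2 + (X i)\<^sup>2)\<bar> \<le> 1" using pos[of t i] by (simp add: divide_le_eq_1)
          then show ?thesis unfolding real_norm_def abs_mult by (intro mult_left_mono) auto
        qed
        also have "\<dots> \<le> h t" using Dh[OF t] by simp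
        finally show ?thesis .
      qed (simp add: h_def)
      show "(\<lambda>i. (u t - u x) * (t - x) / ((t - x)\<^sup>2 + (X i)\<^sup>2)) \<longlonglongrightarrow> D t"
      proof (cases "t = x")
        case False
        have "(\<lambda>i. (u t - u x) * (t - x) / ((t - x)\<^sup>2 + (X i)\<^sup>2)) \<longlonglongrightarrow> (u t - u x) * (t - x) / ((t - x)\<^sup>2 + 0\<^sup>2)"
          by (intro tendsto_intros X) (use False in auto)
        then show ?thesis using False by (simp add: D_def power2_eq_square)
      qed (simp add: D_def)
    qed
    then show "((\<lambda>\<epsilon>. integral {-1..1} (\<lambda>t. (u t - u x) * (t - x) / ((t - x)\<^sup>2 + \<epsilon>\<^sup>2))) \<circ> X) \<longlonglongrightarrow> integral {-1..1} D"
      by (simp add: o_def)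
  qed
  define l where "l = ln (1 - x) - ln (1 + x)"
  \<comment> \<open>Splitting off the value \<open>u x\<close> leaves an integrand dominated near
    \<open>x\<close>; the split part has an explicit logarithm as its integral.\<close>
  have Cform: "Re (cauchy_integral u (Complex x \<epsilon>)) =
      integral {-1..1} (\<lambda>t. (u t - u x) * (t - x) / ((t - x)\<^sup>2 + \<epsilon>\<^sup>2))
      + u x * ((1/2) * ln ((1 - x)\<^sup>2 + \<epsilon>\<^sup>2) - (1/2) * ln ((1 + x)\<^sup>2 + \<epsilon>\<^sup>2))" if \<epsilon>: "0 < \<epsilon>" for \<epsilon>
  proof -
    have pos: "0 < (t - x)\<^sup>2 + \<epsilon>\<^sup>2" for t using \<epsilon> by (simp add: add_nonneg_pos)
    have ne: "complex_of_real t - Complex x \<epsilon> \<noteq> 0" for t using \<epsilon> by (simp add: complex_eq_iff)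
    have "((\<lambda>t. complex_of_real (u t) / (complex_of_real t - Complex x \<epsilon>)) has_integral cauchy_integral u (Complex x \<epsilon>)) {-1..1}"
      unfolding cauchy_integral_def
      by (intro integrable_integral integrable_continuous_real continuous_intros uc) (use ne in auto)
    from has_integral_Re[OF this] have "((\<lambda>t. Re (complex_of_real (u t) / (complex_of_real t - Complex x \<epsilon>))) has_integral Re (cauchy_integral u (Complex x \<epsilon>))) {-1..1}" .
    moreover have "Re (complex_of_real (u t) / (complex_of_real t - Complex x \<epsilon>)) =
       (u t - u x) * (t - x) / ((t - x)\<^sup>2 + \<epsilon>\<^sup>2) + u x * ((t - x) / ((t - x)\<^sup>2 + \<epsilon>\<^sup>2))" for t
      by (simp add: Re_divide add_divide_distrib[symmetric] algebra_simps)
    ultimately have 1: "((\<lambda>t. (u t - u x) * (t - x) / ((t - x)\<^sup>2 + \<epsilon>\<^sup>2) + u x * ((t - x) / ((t - x)\<^sup>2 + \<epsilon>\<^sup>2))) has_integral Re (cauchy_integral u (Complex x \<epsilon>))) {-1..1}"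
      by simp
    have 2: "((\<lambda>t. (t - x) / ((t - x)\<^sup>2 + \<epsilon>\<^sup>2)) has_integral
        ((1/2) * ln ((1 - x)\<^sup>2 + \<epsilon>\<^sup>2) - (1/2) * ln ((-1 - x)\<^sup>2 + \<epsilon>\<^sup>2))) {-1..1}"
    proof (rule fundamental_theorem_of_calculus)
      fix t :: real
      have half: "(1/2) * (1 / b * (2 * a)) = a / b" for a b :: real by simp
      have "((\<lambda>t. (t - x)\<^sup>2 + \<epsilon>\<^sup>2) has_real_derivative 2 * (t - x)) (at t within {-1..1})"
        by (auto intro!: derivative_eq_intros)
      from DERIV_cmult[OF DERIV_chain2[OF DERIV_ln_divide[OF pos] this], of "1/2"]
      show "((\<lambda>t. (1/2) * ln ((t - x)\<^sup>2 + \<epsilon>\<^sup>2)) has_vector_derivative (t - x) / ((t - x)\<^sup>2 + \<epsilon>\<^sup>2)) (at t within {-1..1})"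
        unfolding half has_real_derivative_iff_has_vector_derivative .
    qed simp
    have 3: "((\<lambda>t. (u t - u x) * (t - x) / ((t - x)\<^sup>2 + \<epsilon>\<^sup>2)) has_integral
          integral {-1..1} (\<lambda>t. (u t - u x) * (t - x) / ((t - x)\<^sup>2 + \<epsilon>\<^sup>2))) {-1..1}"
      by (intro integrable_integral integrable_continuous_real continuous_intros uc)
         (use \<epsilon> in auto)
    have "(-1 - x)\<^sup>2 = (1 + x)\<^sup>2" by (simp add: power2_eq_square algebra_simps)
    then show ?thesis
      using has_integral_unique[OF 1 has_integral_add[OF 3 has_integral_mult_right[OF 2, of "u x"]]] by simp
  qed
  have lnsq: "(1/2) * ln (y\<^sup>2) = ln y" if "0 < y" for y :: real
    using that by (simp add: ln_realpow)
  have "((\<lambda>\<epsilon>. (1/2) * ln ((1 - x)\<^sup>2 + \<epsilon>\<^sup>2) - (1/2) * ln ((1 + x)\<^sup>2 + \<epsilon>\<^sup>2)) \<longlongrightarrow>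
      (1/2) * ln ((1 - x)\<^sup>2 + 0\<^sup>2) - (1/2) * ln ((1 + x)\<^sup>2 + 0\<^sup>2)) (at_right 0)"
    using x by (intro tendsto_intros) auto
  also have "(1/2) * ln ((1 - x)\<^sup>2 + 0\<^sup>2) - (1/2) * ln ((1 + x)\<^sup>2 + 0\<^sup>2) = l"
    using lnsq[of "1 - x"] lnsq[of "1 + x"] x by (simp add: l_def)
  finally have E: "((\<lambda>\<epsilon>. (1/2) * ln ((1 - x)\<^sup>2 + \<epsilon>\<^sup>2) - (1/2) * ln ((1 + x)\<^sup>2 + \<epsilon>\<^sup>2)) \<longlongrightarrow> l) (at_right 0)" .
  have "((\<lambda>\<epsilon>. Re (cauchy_integral u (Complex x \<epsilon>))) \<longlongrightarrow> integral {-1..1} D + u x * l) (at_right 0)"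
    using tendsto_add[OF B tendsto_mult[OF tendsto_const[of "u x"] E]]
    by (rule Lim_transform_eventually) (auto simp: Cform eventually_at_filter)
  then have Leq: "L = integral {-1..1} D + u x * l"
    using L tendsto_unique[OF trivial_limit_at_right_real] by blast
  have fc: "continuous_on ({-1..1} - {x}) (\<lambda>t. u t / (t - x))"
    by (intro continuous_intros continuous_on_subset[OF uc]) auto
  \<comment> \<open>The truncation is symmetric, so the two terms \<open>ln \<epsilon>\<close> from
    the left and right pieces cancel and only \<open>l\<close> remains.\<close>
  have F: "integral ({-1..1} - {x-\<epsilon><..<x+\<epsilon>}) (\<lambda>t. u t / (t - x)) =
     integral ({-1..1} - {x-\<epsilon><..<x+\<epsilon>}) D + u x * l" if \<epsilon>: "0 < \<epsilon>" "\<epsilon> < min (1 - x) (1 + x)" for \<epsilon>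
  proof -
    let ?E = "{-1..1} - {x-\<epsilon><..<x+\<epsilon>}"
    have E: "?E = {-1..x-\<epsilon>} \<union> {x+\<epsilon>..1}" using \<epsilon> by auto
    have i1: "((\<lambda>t. 1 / (t - x)) has_integral (ln (x - (x - \<epsilon>)) - ln (x - (-1)))) {-1..x-\<epsilon>}"
      by (rule fundamental_theorem_of_calculus)
         (use \<epsilon> in \<open>auto intro!: derivative_eq_intros simp: has_real_derivative_iff_has_vector_derivative[symmetric] divide_simps\<close>)
    have i2: "((\<lambda>t. 1 / (t - x)) has_integral (ln (1 - x) - ln (x + \<epsilon> - x))) {x+\<epsilon>..1}"
      by (rule fundamental_theorem_of_calculus)
         (use \<epsilon> in \<open>auto intro!: derivative_eq_intros simp: has_real_derivative_iff_has_vector_derivative[symmetric] divide_simps\<close>)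
    have disj: "{-1..x-\<epsilon>} \<inter> {x+\<epsilon>..1} = {}" using \<epsilon> by auto
    have "((\<lambda>t. 1 / (t - x)) has_integral l) ?E"
      using has_integral_Un[OF i1 i2] unfolding E disj by (simp add: l_def add.commute)
    from has_integral_mult_right[OF this, of "u x"]
    have 1: "((\<lambda>t. u x * (1 / (t - x))) has_integral u x * l) ?E" .
    have 2: "(D has_integral integral ?E D) ?E"
      by (rule integrable_integral[OF integrable_punctured[OF \<epsilon>(1) Dc]])
    have "((\<lambda>t. D t + u x * (1 / (t - x))) has_integral (integral ?E D + u x * l)) ?E"
      by (rule has_integral_add[OF 2 1])
    moreover have "D t + u x * (1 / (t - x)) = u t / (t - x)" for t
      by (simp add: D_def add_divide_distrib[symmetric])
    ultimately show ?thesis by (simp add: integral_unique)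
  qed
  show ?thesis
    unfolding has_pv_integral_def
  proof (intro conjI allI impI)
    show "(\<lambda>t. u t / (t - x)) integrable_on {-1..1} - {x - \<epsilon><..<x + \<epsilon>}" if "0 < \<epsilon>" for \<epsilon>
      by (rule integrable_punctured[OF that fc])
    have ev: "\<forall>\<^sub>F \<epsilon> in at_right 0. integral ({-1..1} - {x-\<epsilon><..<x+\<epsilon>}) D + u x * l = integral ({-1..1} - {x-\<epsilon><..<x+\<epsilon>}) (\<lambda>t. u t / (t - x))"
      using eventually_at_right_real[of 0 "min (1 - x) (1 + x)"] x
      by (auto elim!: eventually_mono simp: F)
    show "((\<lambda>\<epsilon>. integral ({-1..1} - {x - \<epsilon><..<x + \<epsilon>}) (\<lambda>t. u t / (t - x))) \<longlongrightarrow> L) (at_right 0)"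
      unfolding Leq by (rule Lim_transform_eventually[OF tendsto_add[OF A tendsto_const] ev])
  qed
qed

section \<open>The Cauchy integral of a sine series\<close>

text \<open>The roots \<open>s\<close> and \<open>w\<close> of
  \<open>s\<^sup>2 - 2 * z * s + 1\<close> have product 1, so it suffices that \<open>s\<close> is
  the smaller one. The difference of squared moduli is
  \<open>4 * (Im z * Re q - Re z * Im q)\<close>; the principal root has \<open>Re q > 0\<close>,
  and \<open>Re q * Im q = - (Re z * Im z)\<close> then gives the sign in the upper half
  plane.\<close>

lemma joukowski_inverse:
  assumes z: "0 < Im z"
  defines "s \<equiv> z - \<i> * csqrt (1 - z\<^sup>2)"
  shows "norm s < 1" "s \<noteq> 0" "(s + 1 / s) / 2 = z"
proof -
  define q where "q = csqrt (1 - z\<^sup>2)"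
  have q2: "q\<^sup>2 = 1 - z\<^sup>2" by (simp add: q_def)
  define w where "w = z + \<i> * q"
  have s: "s = z - \<i> * q" by (simp add: s_def q_def)
  have "s * w = z\<^sup>2 - (\<i> * \<i>) * q\<^sup>2" unfolding s w_def by (simp only: algebra_simps power2_eq_square)
  then have sw: "s * w = 1" unfolding q2 by simp
  then show s0: "s \<noteq> 0" by auto
  have w: "w = 1 / s" using sw s0 by (simp add: field_simps)
  show "(s + 1 / s) / 2 = z" unfolding w[symmetric] by (simp add: s w_def)
  have a: "0 \<le> Re q" unfolding q_def by (rule Re_csqrt)
  have im: "Re q * Im q = - (Re z * Im z)"
    using arg_cong[OF q2, of Im] by (simp add: power2_eq_square mult.commute)
  have re: "(Re q)\<^sup>2 - (Im q)\<^sup>2 = 1 - (Re z)\<^sup>2 + (Im z)\<^sup>2"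
    using arg_cong[OF q2, of Re] by (simp add: power2_eq_square)
  have aq: "0 < Re q"
  proof (rule ccontr)
    assume "\<not> 0 < Re q"
    then have r0: "Re q = 0" using a by simp
    then have "Re z = 0" using im z by simp
    then have "- (Im q)\<^sup>2 = 1 + (Im z)\<^sup>2" using re r0 by simp
    then show False by (smt (verit) zero_le_power2)
  qed
  have "0 < Im z * Re q - Re z * Im q"
  proof -
    have "Re q * (Im z * Re q - Re z * Im q) = Im z * (Re q)\<^sup>2 - Re z * (Re q * Im q)"
      by (simp add: algebra_simps power2_eq_square)
    also have "\<dots> = Im z * ((Re q)\<^sup>2 + (Re z)\<^sup>2)" unfolding im by (simp add: algebra_simps power2_eq_square)
    also have "\<dots> > 0" using z aq by (intro mult_pos_pos) (auto intro: add_pos_nonneg)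
    finally show ?thesis using aq by (simp add: zero_less_mult_iff)
  qed
  moreover have "(norm w)\<^sup>2 - (norm s)\<^sup>2 = 4 * (Im z * Re q - Re z * Im q)"
  proof -
    have sw': "Re s = Re z + Im q" "Im s = Im z - Re q" "Re w = Re z - Im q" "Im w = Im z + Re q"
      unfolding s by (simp_all add: w_def)
    show ?thesis unfolding cmod_power2 sw' by (simp add: power2_eq_square algebra_simps)
  qed
  ultimately have "(norm s)\<^sup>2 < (norm w)\<^sup>2" by simp
  then have lt: "norm s < norm w" by (rule power2_less_imp_less) simp
  have "norm s * norm w = 1" using sw by (metis norm_mult norm_one)
  moreover have "norm s * norm s < norm s * norm w" using lt s0 by (intro mult_strict_left_mono) auto
  ultimately have "(norm s)\<^sup>2 < 1" by (simp add: power2_eq_square)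
  then show "norm s < 1" by (simp add: abs_square_less_1)
qed

text \<open>The coordinate 0 of the disc corresponds to infinity outside the slit, where a Cauchy
  integral vanishes; this is why the constant coefficient has to be 0.\<close>

locale sine_series =
  fixes c :: "nat \<Rightarrow> real" and C :: real
  assumes c0: "c 0 = 0" and cb: "\<And>n. \<bar>c (Suc n)\<bar> \<le> C / (real (Suc n))\<^sup>2"
begin

definition P :: "complex \<Rightarrow> complex" where "P z = (\<Sum>n. of_real (c n) * z ^ n)"

definition W :: "real \<Rightarrow> complex" where "W x = Complex x (sqrt (1 - x\<^sup>2))"

text \<open>For \<open>x = cos \<theta>\<close> this is
  \<open>- (1 / pi) * (\<Sum> c n * sin (n * \<theta>))\<close>. By the Plemelj formula it is the
  density whose Cauchy integral has the jump \<open>P (cnj (W x)) - P (W x)\<close> across the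
  slit.\<close>

definition u :: "real \<Rightarrow> real" where "u x = - Im (P (W x)) / pi"

lemma csum: "summable (\<lambda>n. \<bar>c n\<bar>)"
  by (rule summable_over_squares[OF cb])

lemma Pnorm: "norm z \<le> 1 \<Longrightarrow> norm (complex_of_real (c n) * z ^ n) \<le> \<bar>c n\<bar>"
  by (simp add: norm_mult norm_power mult_left_le power_le_one)

lemma Psum: "norm z \<le> 1 \<Longrightarrow> summable (\<lambda>n. complex_of_real (c n) * z ^ n)"
  by (rule summable_comparison_test'[OF csum, of 0]) (use Pnorm in auto)

lemma Psums: "norm z \<le> 1 \<Longrightarrow> (\<lambda>n. of_real (c n) * z ^ n) sums P z"
  using Psum[THEN summable_sums] by (simp add: P_def)

lemma P_uniform: "uniform_limit (cball 0 1) (\<lambda>N z. \<Sum>n<N. of_real (c n) * z ^ n) P sequentially"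
  unfolding P_def[abs_def] by (rule Weierstrass_m_test[OF Pnorm csum]) auto

lemma P_continuous: "continuous_on (cball 0 1) P"
  by (rule uniform_limit_theorem[OF _ P_uniform]) (auto intro!: always_eventually continuous_intros)

lemma P_cnj: "norm z \<le> 1 \<Longrightarrow> P (cnj z) = cnj (P z)"
proof -
  assume z: "norm z \<le> 1"
  have "(\<lambda>n. cnj (of_real (c n) * z ^ n)) sums cnj (P z)"
    using Psums[OF z] by (simp only: sums_cnj)
  then show ?thesis using sums_unique[of "\<lambda>n. of_real (c n) * cnj z ^ n"] by (simp add: P_def)
qed

lemma P_real: "\<bar>r\<bar> < 1 \<Longrightarrow> P (of_real r) = of_real (\<Sum>n. c n * r ^ n)"
proof -
  assume r: "\<bar>r\<bar> < 1"
  have "summable (\<lambda>n. c n * r ^ n)"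
    by (rule summable_comparison_test'[OF csum, of 0])
       (use r in \<open>simp add: abs_mult power_abs mult_left_le power_le_one\<close>)
  then have "(\<lambda>n. complex_of_real (c n * r ^ n)) sums of_real (\<Sum>n. c n * r ^ n)"
    by (intro sums_of_real summable_sums)
  moreover have "(\<lambda>n. complex_of_real (c n * r ^ n)) sums P (of_real r)" using Psums[of "of_real r"] r by simp
  ultimately show ?thesis using sums_unique2 by blast
qed

text \<open>The geometric mean of the bounds 2 and \<open>n * norm (z - w)\<close> for the
  difference of \<open>n\<close>-th powers. The Lipschitz bound alone would need
  \<open>n * \<bar>c n\<bar>\<close> to be summable, which quadratic decay does not give; with the
  square root the terms decay like \<open>n powr (-3/2)\<close>.\<close>

lemma P_hoelder:
  obtains B where "0 \<le> B" "\<And>z w. \<lbrakk>norm z \<le> 1; norm w \<le> 1\<rbrakk> \<Longrightarrow> norm (P z - P w) \<le> B * sqrt (norm (z - w))"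
proof -
  have s32: "summable (\<lambda>n. \<bar>c n\<bar> * sqrt (2 * real n))"
  proof -
    have "summable (\<lambda>n. (C * sqrt 2) * (real (Suc n) powr (-3/2)))"
      using summable_real_powr_iff[of "-3/2"] summable_Suc_iff[of "\<lambda>n. real n powr (-3/2)"]
      by (intro summable_mult) simp
    then have "summable (\<lambda>n. \<bar>c (Suc n)\<bar> * sqrt (2 * real (Suc n)))"
    proof (rule summable_comparison_test'[where N = 0])
      fix n
      have "\<bar>c (Suc n)\<bar> * sqrt (2 * real (Suc n)) \<le> C / (real (Suc n))\<^sup>2 * sqrt (2 * real (Suc n))"
        by (intro mult_right_mono cb) auto
      also have "\<dots> = (C * sqrt 2) * (sqrt (real (Suc n)) / (real (Suc n))\<^sup>2)"
        by (simp add: real_sqrt_mult del: of_nat_Suc)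
      also have "sqrt (real (Suc n)) / (real (Suc n))\<^sup>2 = real (Suc n) powr (-3/2)"
      proof -
        have "sqrt (real (Suc n)) / (real (Suc n))\<^sup>2 = real (Suc n) powr (1/2) / real (Suc n) powr 2"
          by (simp add: powr_half_sqrt powr_numeral del: of_nat_Suc)
        also have "\<dots> = real (Suc n) powr (1/2 - 2)" by (rule powr_diff[symmetric])
        finally show ?thesis by simp
      qed
      finally show "norm (\<bar>c (Suc n)\<bar> * sqrt (2 * real (Suc n))) \<le> (C * sqrt 2) * (real (Suc n) powr (-3/2))"
        by simp
    qed
    then show ?thesis by (rule summable_Suc_iff[THEN iffD1])
  qed
  show ?thesis
  proof (rule that[of "\<Sum>n. \<bar>c n\<bar> * sqrt (2 * real n)"])
    show "0 \<le> (\<Sum>n. \<bar>c n\<bar> * sqrt (2 * real n))" by (intro suminf_nonneg s32) auto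
    fix z w :: complex assume z: "norm z \<le> 1" and w: "norm w \<le> 1"
    have tm: "norm (of_real (c n) * z ^ n - of_real (c n) * w ^ n) \<le> \<bar>c n\<bar> * sqrt (2 * real n) * sqrt (norm (z - w))" for n
    proof -
      have a: "norm (z ^ n - w ^ n) \<le> real n * norm (z - w)" by (rule norm_power_diff[OF z w])
      have b: "norm (z ^ n - w ^ n) \<le> 2"
        using norm_triangle_ineq4[of "z ^ n" "w ^ n"] power_le_one[OF _ z, of n] power_le_one[OF _ w, of n]
        by (simp add: norm_power)
      have "(norm (z ^ n - w ^ n))\<^sup>2 \<le> 2 * (real n * norm (z - w))"
        unfolding power2_eq_square using a b by (intro mult_mono) auto
      then have "norm (z ^ n - w ^ n) \<le> sqrt (2 * (real n * norm (z - w)))" by (rule real_le_rsqrt)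
      also have "\<dots> = sqrt (2 * real n) * sqrt (norm (z - w))" by (simp add: real_sqrt_mult[symmetric])
      finally have "\<bar>c n\<bar> * norm (z ^ n - w ^ n) \<le> \<bar>c n\<bar> * (sqrt (2 * real n) * sqrt (norm (z - w)))"
        by (intro mult_left_mono) auto
      then show ?thesis by (simp add: right_diff_distrib[symmetric] norm_mult)
    qed
    have sm: "summable (\<lambda>n. \<bar>c n\<bar> * sqrt (2 * real n) * sqrt (norm (z - w)))"
      by (rule summable_mult2[OF s32])
    have "P z - P w = (\<Sum>n. of_real (c n) * z ^ n - of_real (c n) * w ^ n)"
      unfolding P_def by (rule suminf_diff[OF Psum[OF z] Psum[OF w]])
    also have "norm \<dots> \<le> (\<Sum>n. \<bar>c n\<bar> * sqrt (2 * real n) * sqrt (norm (z - w)))"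
      by (rule norm_suminf_le[OF tm sm])
    also have "\<dots> = (\<Sum>n. \<bar>c n\<bar> * sqrt (2 * real n)) * sqrt (norm (z - w))"
      by (rule suminf_mult2[OF s32, symmetric])
    finally show "norm (P z - P w) \<le> (\<Sum>n. \<bar>c n\<bar> * sqrt (2 * real n)) * sqrt (norm (z - w))" .
  qed
qed

lemma square_le_one: "x \<in> {-1..1::real} \<Longrightarrow> x\<^sup>2 \<le> 1"
  by (simp add: abs_square_le_1 abs_le_iff)

lemma W_norm: "x \<in> {-1..1} \<Longrightarrow> norm (W x) = 1"
  using square_le_one[of x] by (simp add: W_def cmod_def)

text \<open>The upper half circle has vertical tangents at its ends, so its height is only Hoelder
  of exponent 1/2; the estimate compares \<open>(a - b)\<^sup>2\<close> with the difference of the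
  squares.\<close>

lemma W_hoelder:
  assumes x: "x \<in> {-1..1}" and y: "y \<in> {-1..1}"
  shows "norm (W x - W y) \<le> 2 * sqrt \<bar>x - y\<bar>"
proof -
  define a b where "a = sqrt (1 - x\<^sup>2)" and "b = sqrt (1 - y\<^sup>2)"
  have ab: "0 \<le> a" "0 \<le> b" "a\<^sup>2 = 1 - x\<^sup>2" "b\<^sup>2 = 1 - y\<^sup>2"
    using square_le_one[OF x] square_le_one[OF y] by (auto simp: a_def b_def)
  have "\<bar>a - b\<bar> \<le> a + b" using ab by simp
  then have "(a - b)\<^sup>2 \<le> \<bar>a - b\<bar> * (a + b)"
    unfolding power2_eq_square by (metis abs_ge_zero abs_mult_self_eq mult_left_mono)
  also have "\<dots> = \<bar>a\<^sup>2 - b\<^sup>2\<bar>" using ab(1,2) by (simp add: power2_eq_square square_diff_square_factored abs_mult)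
  also have "\<dots> = \<bar>x - y\<bar> * \<bar>x + y\<bar>" 
  proof -
    have "a\<^sup>2 - b\<^sup>2 = - ((x - y) * (x + y))" unfolding ab by (simp add: power2_eq_square algebra_simps)
    then show ?thesis by (simp add: abs_mult)
  qed
  also have "\<dots> \<le> \<bar>x - y\<bar> * 2" using x y by (intro mult_left_mono) auto
  finally have 1: "(a - b)\<^sup>2 \<le> 2 * \<bar>x - y\<bar>" by simp
  have "\<bar>x - y\<bar> * \<bar>x - y\<bar> \<le> \<bar>x - y\<bar> * 2" using x y by (intro mult_left_mono) auto
  then have 2: "(x - y)\<^sup>2 \<le> 2 * \<bar>x - y\<bar>" by (simp add: power2_eq_square)
  have "(norm (W x - W y))\<^sup>2 = (x - y)\<^sup>2 + (a - b)\<^sup>2" by (simp add: W_def cmod_power2 a_def b_def)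
  also have "\<dots> \<le> (2 * sqrt \<bar>x - y\<bar>)\<^sup>2" using 1 2 by (simp add: power_mult_distrib)
  finally show ?thesis by (rule power2_le_imp_le) simp
qed

lemma PW_hoelder: "hoelder_on {-1..1} (\<lambda>x. P (W x))"
proof -
  obtain B where B: "0 \<le> B" "\<And>z w. \<lbrakk>norm z \<le> 1; norm w \<le> 1\<rbrakk> \<Longrightarrow> norm (P z - P w) \<le> B * sqrt (norm (z - w))"
    using P_hoelder by blast
  show ?thesis unfolding hoelder_on_def
  \<comment> \<open>The exponent is the product of 1/2 from the power series and 1/2 from the
    circle.\<close>
  proof (rule exI[of _ "1/4"], rule exI[of _ "B * sqrt 2"], intro conjI ballI)
    fix x y :: real assume x: "x \<in> {-1..1}" and y: "y \<in> {-1..1}"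
    have "norm (P (W x) - P (W y)) \<le> B * sqrt (norm (W x - W y))"
      by (rule B(2)) (use W_norm x y in auto)
    also have "\<dots> \<le> B * sqrt (2 * sqrt \<bar>x - y\<bar>)"
      using W_hoelder[OF x y] B(1) by (intro mult_left_mono real_sqrt_le_mono) auto
    also have "\<dots> = B * sqrt 2 * sqrt (sqrt \<bar>x - y\<bar>)" by (simp add: real_sqrt_mult)
    also have "sqrt (sqrt \<bar>x - y\<bar>) = \<bar>x - y\<bar> powr (1/4)"
      by (simp add: powr_half_sqrt[symmetric] powr_powr)
    finally show "norm (P (W x) - P (W y)) \<le> B * sqrt 2 * \<bar>x - y\<bar> powr (1/4)" .
  qed auto
qed

lemma u_hoelder: "hoelder_on {-1..1} u"
proof -
  obtain \<alpha> B where \<alpha>: "0 < \<alpha>" "\<alpha> \<le> 1" and B: "\<And>x y. \<lbrakk>x \<in> {-1..1}; y \<in> {-1..1}\<rbrakk> \<Longrightarrow> norm (P (W x) - P (W y)) \<le> B * \<bar>x - y\<bar> powr \<alpha>"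
    using PW_hoelder unfolding hoelder_on_def by blast
  show ?thesis unfolding hoelder_on_def
  proof (rule exI[of _ \<alpha>], rule exI[of _ "B / pi"], intro conjI ballI \<alpha>)
    fix x y :: real assume xy: "x \<in> {-1..1}" "y \<in> {-1..1}"
    have "norm (u x - u y) = \<bar>Im (P (W x) - P (W y))\<bar> / pi"
      by (simp add: u_def diff_divide_distrib[symmetric] abs_minus_commute)
    also have "\<dots> \<le> norm (P (W x) - P (W y)) / pi" by (intro divide_right_mono abs_Im_le_cmod) simp
    also have "\<dots> \<le> B * \<bar>x - y\<bar> powr \<alpha> / pi" using B[OF xy] by (intro divide_right_mono) auto
    finally show "norm (u x - u y) \<le> B / pi * \<bar>x - y\<bar> powr \<alpha>" by simp
  qed
qed

lemma u_continuous: "continuous_on {-1..1} u"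
  by (rule hoelder_on_imp_continuous_on[OF u_hoelder])

lemma W_cos: "\<phi> \<in> {0..pi} \<Longrightarrow> W (cos \<phi>) = cis \<phi>"
  by (simp add: W_def complex_eq_iff sin_squared_eq[symmetric] sin_ge_zero)

lemma u_cos_continuous: "continuous_on {0..pi} (\<lambda>\<phi>. u (cos \<phi>))"
  by (rule continuous_on_compose2[OF u_continuous]) (auto intro!: continuous_intros)

text \<open>Orthogonality of sines, applied term by term under the majorant
  \<open>\<bar>c n\<bar>\<close>. The case \<open>m = 0\<close> agrees because
  \<open>c 0 = 0\<close>.\<close>

lemma u_coefficient: "integral {0..pi} (\<lambda>\<phi>. u (cos \<phi>) * sin (real m * \<phi>)) = - c m / 2"
proof -
  have bnd: "norm (c n * (sin (real n * \<phi>) * sin (real m * \<phi>))) \<le> \<bar>c n\<bar>" for n \<phi>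
  proof -
    have "\<bar>sin (real n * \<phi>)\<bar> * \<bar>sin (real m * \<phi>)\<bar> \<le> 1 * 1" by (intro mult_mono abs_sin_le_one) auto
    then show ?thesis by (simp add: abs_mult mult_left_le)
  qed
  have S: "(\<lambda>n. c n * sin (real n * \<phi>)) sums (- pi * u (cos \<phi>))" if "\<phi> \<in> {0..pi}" for \<phi>
  proof -
    have "(\<lambda>n. of_real (c n) * cis \<phi> ^ n) sums P (cis \<phi>)" by (rule Psums) simp
    then have "(\<lambda>n. Im (of_real (c n) * cis \<phi> ^ n)) sums Im (P (cis \<phi>))" by (rule sums_Im)
    then show ?thesis using W_cos[OF that] by (simp add: u_def Complex.DeMoivre)
  qed
  have "uniform_limit {0..pi} (\<lambda>N \<phi>. \<Sum>n<N. c n * (sin (real n * \<phi>) * sin (real m * \<phi>)))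
      (\<lambda>\<phi>. \<Sum>n. c n * (sin (real n * \<phi>) * sin (real m * \<phi>))) sequentially"
    by (rule Weierstrass_m_test[OF bnd csum])
  then obtain I J where IJ: "\<And>N. ((\<lambda>\<phi>. \<Sum>n<N. c n * (sin (real n * \<phi>) * sin (real m * \<phi>))) has_integral I N) {0..pi}"
      "((\<lambda>\<phi>. \<Sum>n. c n * (sin (real n * \<phi>) * sin (real m * \<phi>))) has_integral J) {0..pi}" "I \<longlonglongrightarrow> J"
    by (rule uniform_limit_integral) (auto intro!: continuous_intros)
  have "I N = (pi / 2) * c m" if N: "N > m" for N
  proof -
    have "I N = integral {0..pi} (\<lambda>\<phi>. \<Sum>n<N. c n * (sin (real n * \<phi>) * sin (real m * \<phi>)))"
      using integral_unique[OF IJ(1)[of N]] by simp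
    also have "\<dots> = (\<Sum>n<N. c n * (if n = m \<and> n \<noteq> 0 then pi / 2 else 0))"
      by (subst integral_sum) (auto intro!: integrable_continuous_real continuous_intros simp: integral_sin_sin)
    also have "\<dots> = (\<Sum>n<N. if n = m then c m * (pi / 2) else 0)"
      by (intro sum.cong) (auto simp: c0)
    also have "\<dots> = (pi / 2) * c m" using N by simp
    finally show ?thesis .
  qed
  then have "I \<longlonglongrightarrow> (pi / 2) * c m"
    by (intro tendsto_eventually eventually_sequentiallyI[of "Suc m"]) auto
  then have J: "J = (pi / 2) * c m" using IJ(3) LIMSEQ_unique by blast
  have "(\<Sum>n. c n * (sin (real n * \<phi>) * sin (real m * \<phi>))) = (- pi) * (u (cos \<phi>) * sin (real m * \<phi>))" if "\<phi> \<in> {0..pi}" for \<phi>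
    using sums_unique[OF sums_mult2[OF S[OF that], of "sin (real m * \<phi>)"]] by (simp add: mult.assoc)
  then have "((\<lambda>\<phi>. (- pi) * (u (cos \<phi>) * sin (real m * \<phi>))) has_integral J) {0..pi}"
    using IJ(2) by (rule has_integral_eq)
  then have "(- pi) * integral {0..pi} (\<lambda>\<phi>. u (cos \<phi>) * sin (real m * \<phi>)) = (pi / 2) * c m"
    unfolding J by (simp only: integral_mult_right[symmetric] integral_unique)
  then have "pi * (2 * integral {0..pi} (\<lambda>\<phi>. u (cos \<phi>) * sin (real m * \<phi>)) + c m) = 0"
    by (simp add: algebra_simps)
  then show ?thesis by simp
qed

lemma u_nonzero: "c n \<noteq> 0 \<Longrightarrow> \<exists>x\<in>{-1..1}. u x \<noteq> 0"
proof (rule ccontr)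
  assume n: "c n \<noteq> 0" and "\<not> (\<exists>x\<in>{-1..1}. u x \<noteq> 0)"
  then have "u (cos \<phi>) = 0" for \<phi> by auto
  then show False using u_coefficient[of n] n by simp
qed

section \<open>The Cauchy integral off the slit and on its two sides\<close>

text \<open>At the point with Joukowski coordinate \<open>s\<close>, the denominator
  \<open>cos \<phi> - z\<close> is \<open>- 1 / (2 * s)\<close> times that of the sine kernel. Each
  term of the expansion then contributes \<open>(-2 * s) * s ^ n * (- c (Suc n) / 2)\<close>, which
  is the term of \<open>P\<close> of index \<open>n + 1\<close>.\<close>

lemma cauchy_integral_u:
  assumes s: "norm s < 1" "s \<noteq> 0"
  shows "cauchy_integral u ((s + 1 / s) / 2) = P s"
proof -
  define z where "z = (s + 1 / s) / 2"
  have tz: "complex_of_real (cos \<phi>) - z = - (1 - 2 * s * of_real (cos \<phi>) + s\<^sup>2) / (2 * s)" for \<phi>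
  proof -
    have "z * (2 * s) = s\<^sup>2 + s * (1 / s)" unfolding z_def by (simp only: power2_eq_square) (simp add: algebra_simps)
    then have zs: "z * (2 * s) = s\<^sup>2 + 1" using s by simp
    have "(of_real (cos \<phi>) - z) * (2 * s) = - (1 - 2 * s * of_real (cos \<phi>) + s\<^sup>2)"
      unfolding left_diff_distrib zs by (simp add: algebra_simps)
    moreover have "2 * s \<noteq> 0" using s by simp
    ultimately show ?thesis by (simp add: nonzero_eq_divide_eq)
  qed
  have ne: "complex_of_real t - z \<noteq> 0" if "t \<in> {-1..1}" for t
  proof -
    have t: "cos (arccos t) = t" using that by simp
    have "- (1 - 2 * s * of_real (cos (arccos t)) + s\<^sup>2) / (2 * s) \<noteq> 0"
      unfolding divide_eq_0_iff neg_equal_0_iff_equal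
      using sine_kernel_denominator_nonzero[OF s(1), of "arccos t"] s(2) by simp
    then show ?thesis using tz[of "arccos t"] unfolding t by (simp only: not_False_eq_True)
  qed
  have "cauchy_integral u z = integral {0..pi} (\<lambda>\<phi>. sin \<phi> *\<^sub>R (of_real (u (cos \<phi>)) / (of_real (cos \<phi>) - z)))"
    unfolding cauchy_integral_def
    by (rule integral_cos_substitution) (intro continuous_intros u_continuous; use ne in auto)
  also have "\<dots> = integral {0..pi} (\<lambda>\<phi>. (-2 * s) * (of_real (u (cos \<phi>)) * (of_real (sin \<phi>) / (1 - 2 * s * of_real (cos \<phi>) + s\<^sup>2))))"
  proof (rule integral_cong)
    fix \<phi> :: real
    have inv: "a / (- d / (2 * s)) = (-2 * s) * (a / d)" for a d :: complex using s(2) by simp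
    show "sin \<phi> *\<^sub>R (of_real (u (cos \<phi>)) / (of_real (cos \<phi>) - z))
        = (-2 * s) * (of_real (u (cos \<phi>)) * (of_real (sin \<phi>) / (1 - 2 * s * of_real (cos \<phi>) + s\<^sup>2)))"
      unfolding tz inv scaleR_conv_of_real by simp
  qed
  also have "\<dots> = (-2 * s) * integral {0..pi} (\<lambda>\<phi>. of_real (u (cos \<phi>)) * (of_real (sin \<phi>) / (1 - 2 * s * of_real (cos \<phi>) + s\<^sup>2)))"
    by (rule integral_mult_right)
  finally have ci: "cauchy_integral u z = (-2 * s) * integral {0..pi} (\<lambda>\<phi>. of_real (u (cos \<phi>)) * (of_real (sin \<phi>) / (1 - 2 * s * of_real (cos \<phi>) + s\<^sup>2)))" .
  have "(\<lambda>n. (-2 * s) * (s ^ n * of_real (integral {0..pi} (\<lambda>\<phi>. u (cos \<phi>) * sin (real (Suc n) * \<phi>))))) sums cauchy_integral u z"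
    unfolding ci by (rule sums_mult[OF sine_series_integral[OF s(1) u_cos_continuous]])
  then have "(\<lambda>n. of_real (c (Suc n)) * s ^ Suc n) sums cauchy_integral u z"
    unfolding u_coefficient by (simp add: mult_ac)
  then have "(\<lambda>n. of_real (c n) * s ^ n) sums cauchy_integral u z"
    by (subst (asm) sums_Suc_iff) (simp add: c0)
  moreover have "(\<lambda>n. of_real (c n) * s ^ n) sums P s" using s by (intro Psums) auto
  ultimately show ?thesis unfolding z_def using sums_unique2 by blast
qed

lemma joukowski_boundary:
  assumes x: "x \<in> {-1..1}"
  shows "((\<lambda>z. z - \<i> * csqrt (1 - z\<^sup>2)) \<longlongrightarrow> cnj (W x)) (at (of_real x) within S)"
proof -
  have lim: "((\<lambda>z::complex. 1 - z\<^sup>2) \<longlongrightarrow> 1 - (of_real x)\<^sup>2) (at (of_real x) within S)"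
    by (intro tendsto_intros)
  have q: "((\<lambda>z. csqrt (1 - z\<^sup>2)) \<longlongrightarrow> csqrt (1 - (of_real x)\<^sup>2)) (at (of_real x) within S)"
  \<comment> \<open>At the ends of the slit the argument of the root tends to 0, which lies on the
    branch cut; there the norm of the root is used instead of continuity of the principal
    branch.\<close>
  proof (cases "x\<^sup>2 = 1")
    case True
    then have e: "(complex_of_real x)\<^sup>2 = 1" by (metis of_real_1 of_real_power)
    have "((\<lambda>z::complex. norm (csqrt (1 - z\<^sup>2))) \<longlongrightarrow> 0) (at (of_real x) within S)"
      unfolding norm_csqrt using tendsto_real_sqrt[OF tendsto_norm[OF lim]] e by simp
    then show ?thesis using e by (simp add: tendsto_norm_zero_cancel)
  next
    case False
    have "1 - (complex_of_real x)\<^sup>2 = of_real (1 - x\<^sup>2)" by simp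
    moreover have "0 < 1 - x\<^sup>2" using square_le_one[OF x] False by simp
    ultimately have "1 - (complex_of_real x)\<^sup>2 \<notin> \<real>\<^sub>\<le>\<^sub>0" by (simp only: nonpos_Reals_of_real_iff)
    then show ?thesis by (intro isCont_tendsto_compose[OF _ lim] continuous_at_csqrt)
  qed
  have "csqrt (1 - (of_real x)\<^sup>2) = of_real (sqrt (1 - x\<^sup>2))"
    using square_le_one[OF x] csqrt_of_real[of "1 - x\<^sup>2"] by simp
  moreover have "((\<lambda>z. z - \<i> * csqrt (1 - z\<^sup>2)) \<longlongrightarrow> of_real x - \<i> * csqrt (1 - (of_real x)\<^sup>2)) (at (of_real x) within S)"
    by (intro tendsto_intros q)
  moreover have "of_real x - \<i> * of_real (sqrt (1 - x\<^sup>2)) = cnj (W x)" by (simp add: W_def complex_eq_iff)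
  ultimately show ?thesis by simp
qed

lemma boundary_value_upper:
  assumes x: "x \<in> {-1..1}"
  shows "(cauchy_integral u \<longlongrightarrow> P (cnj (W x))) (at (of_real x) within {z. Im z > 0})"
proof -
  have "((\<lambda>z. P (z - \<i> * csqrt (1 - z\<^sup>2))) \<longlongrightarrow> P (cnj (W x))) (at (of_real x) within {z. Im z > 0})"
  proof (rule continuous_on_tendsto_compose[OF P_continuous joukowski_boundary[OF x]])
    show "cnj (W x) \<in> cball 0 1" using W_norm[OF x] by simp
    show "\<forall>\<^sub>F z in at (of_real x) within {z. Im z > 0}. z - \<i> * csqrt (1 - z\<^sup>2) \<in> cball 0 1"
      using joukowski_inverse(1) by (auto simp: eventually_at_filter less_imp_le)
  qed
  moreover have "\<forall>\<^sub>F z in at (of_real x) within {z. Im z > 0}. P (z - \<i> * csqrt (1 - z\<^sup>2)) = cauchy_integral u z"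
    unfolding eventually_at_filter
  proof (intro always_eventually allI impI)
    fix z :: complex assume "z \<in> {z. Im z > 0}"
    then have z: "0 < Im z" by simp
    show "P (z - \<i> * csqrt (1 - z\<^sup>2)) = cauchy_integral u z"
      using cauchy_integral_u[OF joukowski_inverse(1,2)[OF z]] joukowski_inverse(3)[OF z] by simp
  qed
  ultimately show ?thesis by (rule Lim_transform_eventually)
qed

text \<open>Reflection in the real axis: \<open>u\<close> is real and \<open>P\<close> has real
  coefficients, so conjugation turns the upper boundary value into the lower one.\<close>

lemma boundary_value_lower:
  assumes x: "x \<in> {-1..1}"
  shows "(cauchy_integral u \<longlongrightarrow> P (W x)) (at (of_real x) within {z. Im z < 0})"
proof -
  have ev: "\<forall>\<^sub>F z in at (of_real x) within {z. Im z < 0}. Im z < 0"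
    by (auto simp: eventually_at_filter)
  have "filterlim cnj (at (of_real x) within {z. Im z > 0}) (at (of_real x) within {z. Im z < 0})"
    unfolding filterlim_at
  proof
    show "(cnj \<longlongrightarrow> of_real x) (at (of_real x) within {z. Im z < 0})"
      using tendsto_cnj[OF tendsto_ident_at, of "of_real x" "{z. Im z < 0}"] by simp
    show "\<forall>\<^sub>F z in at (of_real x) within {z. Im z < 0}. cnj z \<in> {z. 0 < Im z} \<and> cnj z \<noteq> of_real x"
      using ev by eventually_elim (auto simp: complex_eq_iff)
  qed
  from tendsto_cnj[OF filterlim_compose[OF boundary_value_upper[OF x] this]]
  have "((\<lambda>z. cnj (cauchy_integral u (cnj z))) \<longlongrightarrow> cnj (P (cnj (W x)))) (at (of_real x) within {z. Im z < 0})" .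
  moreover have "cnj (P (cnj (W x))) = P (W x)" using P_cnj[of "cnj (W x)"] W_norm[OF x] by simp
  moreover have "\<forall>\<^sub>F z in at (of_real x) within {z. Im z < 0}. cnj (cauchy_integral u (cnj z)) = cauchy_integral u z"
    using ev
  proof eventually_elim
    case (elim z)
    then have z: "0 < Im (cnj z)" by simp
    define s where "s = cnj z - \<i> * csqrt (1 - (cnj z)\<^sup>2)"
    note s = joukowski_inverse[OF z, folded s_def]
    have "cnj (cauchy_integral u (cnj z)) = cnj (P s)" using cauchy_integral_u[OF s(1,2)] s(3) by simp
    also have "\<dots> = P (cnj s)" using P_cnj[of s] s(1) by simp
    also have "\<dots> = cauchy_integral u ((cnj s + 1 / cnj s) / 2)"
      by (rule cauchy_integral_u[symmetric]) (use s in auto)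
    also have "(cnj s + 1 / cnj s) / 2 = cnj ((s + 1 / s) / 2)" by simp
    also have "\<dots> = z" using s(3) by simp
    finally show ?case .
  qed
  ultimately show ?thesis by (auto intro: Lim_transform_eventually)
qed

lemma hoelder_boundary_values_u: "hoelder_boundary_values (cauchy_integral u)"
  unfolding hoelder_boundary_values_def
proof (rule exI[of _ "\<lambda>x. P (cnj (W x))"], rule exI[of _ "\<lambda>x. P (W x)"], intro conjI ballI PW_hoelder)
  obtain \<alpha> B where \<alpha>: "0 < \<alpha>" "\<alpha> \<le> 1" and B: "\<And>x y. \<lbrakk>x \<in> {-1..1}; y \<in> {-1..1}\<rbrakk> \<Longrightarrow> norm (P (W x) - P (W y)) \<le> B * \<bar>x - y\<bar> powr \<alpha>"
    using PW_hoelder unfolding hoelder_on_def by blast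
  show "hoelder_on {-1..1} (\<lambda>x. P (cnj (W x)))"
    unfolding hoelder_on_def
  proof (rule exI[of _ \<alpha>], rule exI[of _ B], intro conjI ballI \<alpha>)
    fix x y :: real assume xy: "x \<in> {-1..1}" "y \<in> {-1..1}"
    have "P (cnj (W x)) - P (cnj (W y)) = cnj (P (W x) - P (W y))"
      using P_cnj W_norm xy by simp
    then show "norm (P (cnj (W x)) - P (cnj (W y))) \<le> B * \<bar>x - y\<bar> powr \<alpha>"
      using B[OF xy] by (metis complex_mod_cnj)
  qed
qed (use boundary_value_upper boundary_value_lower in auto)

text \<open>The principal value is the mean of the two boundary values, and these are conjugate; so
  it is the real part of \<open>P\<close> at \<open>cis (- arccos x)\<close>.\<close>

lemma pv_u:
  assumes x: "x \<in> {-1<..<1}"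
  shows "has_pv_integral (\<lambda>t. u t / (t - x)) (-1) 1 x (\<Sum>n. c n * cos (real n * arccos x))"
proof -
  have xI: "x \<in> {-1..1}" using x by auto
  have "filterlim (\<lambda>\<epsilon>. Complex x \<epsilon>) (at (of_real x) within {z. Im z > 0}) (at_right 0)"
    unfolding filterlim_at
  proof
    have "((\<lambda>\<epsilon>. of_real x + \<i> * of_real \<epsilon>) \<longlongrightarrow> of_real x + \<i> * of_real 0) (at_right 0)"
      by (intro tendsto_intros)
    moreover have "of_real x + \<i> * of_real \<epsilon> = Complex x \<epsilon>" for \<epsilon> by (simp add: complex_eq_iff)
    ultimately show "(Complex x \<longlongrightarrow> of_real x) (at_right 0)" by simp
    show "\<forall>\<^sub>F \<epsilon> in at_right 0. Complex x \<epsilon> \<in> {z. 0 < Im z} \<and> Complex x \<epsilon> \<noteq> of_real x"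
      using eventually_at_right_less[of "0::real"] by eventually_elim (auto simp: complex_eq_iff)
  qed
  from tendsto_Re[OF filterlim_compose[OF boundary_value_upper[OF xI] this]]
  have L: "((\<lambda>\<epsilon>. Re (cauchy_integral u (Complex x \<epsilon>))) \<longlongrightarrow> Re (P (cnj (W x)))) (at_right 0)" .
  have "W x = cis (arccos x)" using W_cos[of "arccos x"] x by (simp add: arccos_lbound arccos_ubound)
  then have "cnj (W x) = cis (- arccos x)" by (simp add: cis_cnj)
  moreover have "(\<lambda>n. of_real (c n) * cis (- arccos x) ^ n) sums P (cis (- arccos x))" by (rule Psums) simp
  then have "(\<lambda>n. Re (of_real (c n) * cis (- arccos x) ^ n)) sums Re (P (cis (- arccos x)))" by (rule sums_Re)
  then have "(\<lambda>n. c n * cos (real n * arccos x)) sums Re (P (cis (- arccos x)))"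
    by (simp add: Complex.DeMoivre)
  ultimately have "Re (P (cnj (W x))) = (\<Sum>n. c n * cos (real n * arccos x))" by (simp add: sums_iff)
  then show ?thesis using has_pv_integral_hoelder[OF u_hoelder _ _ L] x by simp
qed

end

section \<open>A two-parameter family of odd cubic rational functions\<close>

lemma DERIV_compose_scale:
  fixes g :: "real \<Rightarrow> real"
  assumes "(g has_real_derivative D) (at (e * x))"
  shows "((\<lambda>x. g (e * x)) has_real_derivative D * e) (at x)"
proof -
  have "((\<lambda>x. e * x) has_real_derivative e) (at x)" by (auto intro!: derivative_eq_intros)
  from DERIV_chain[OF assms this] show ?thesis by (simp add: o_def)
qed

text \<open>The representative in lowest terms is pinned down by a monic denominator, which is why
  the fractions below are written with one.\<close>

lemma numer_denom_Fract:
  assumes "coprime p q" "lead_coeff q = 1"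
  shows "numer (Fract p q) = p" "denom (Fract p q) = q"
proof -
  have "quot_of_fract (Fract p q) = (p, q)"
    using quot_of_fract_quot_to_fract'[of "(p, q)"] assms
    by (simp add: normalized_fracts_def quot_to_fract_def unit_factor_poly_def)
  then show "numer (Fract p q) = p" "denom (Fract p q) = q" by (simp_all add: numer_def denom_def)
qed

text \<open>With \<open>r x = x (x\<^sup>2 - \<kappa>) / (x\<^sup>2 - 1)\<close> the relation between \<open>b\<close> and \<open>B\<close> makes \<open>\<plusminus>b\<close>, \<open>\<plusminus>B\<close> the critical
  points, with critical values \<open>\<plusminus>\<alpha>\<close>, \<open>\<plusminus>\<beta>\<close>; the simple points over \<open>r b\<close> and \<open>r B\<close> are \<open>- c\<close> and \<open>- C\<close>.\<close>

locale cubic =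
  fixes b B :: real
  assumes b: "0 < b" "b < 1" and B: "1 < B" and bB: "(1 + b\<^sup>2) * (1 + B\<^sup>2) = 4"
begin

definition \<kappa> :: real where "\<kappa> = b\<^sup>2 * B\<^sup>2"
definition c :: real where "c = b * (1 + B\<^sup>2) / 2"
definition C :: real where "C = B * (1 + b\<^sup>2) / 2"
definition \<alpha> :: real where "\<alpha> = b ^ 3 * (1 + B\<^sup>2) / 2"
definition \<beta> :: real where "\<beta> = B ^ 3 * (1 + b\<^sup>2) / 2"
definition r :: "real \<Rightarrow> real" where "r x = x * (x\<^sup>2 - \<kappa>) / (x\<^sup>2 - 1)"

text \<open>The numerator of the derivative of \<open>r\<close> is
  \<open>x ^ 4 - (3 - \<kappa>) * x\<^sup>2 + \<kappa>\<close>. Its roots in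
  \<open>x\<^sup>2\<close> have product \<kappa> and sum 3 - \<kappa>; eliminating \<kappa> gives
  the relation \<open>bB\<close>.\<close>

lemma sum_squares: "b\<^sup>2 + B\<^sup>2 = 3 - \<kappa>"
  using bB by (simp add: \<kappa>_def algebra_simps)

lemma b2: "0 < b\<^sup>2" "b\<^sup>2 < 1" using b by (auto simp: power_less_one_iff abs_square_less_1)

lemma B2: "1 < B\<^sup>2" using B by (simp add: one_less_power)

lemma \<kappa>: "0 < \<kappa>" "\<kappa> < 1" "b\<^sup>2 < \<kappa>"
proof -
  show "0 < \<kappa>" using b B by (simp add: \<kappa>_def)
  have "0 < (1 - b\<^sup>2) * (B\<^sup>2 - 1)" using b2 B2 by simp
  then show "\<kappa> < 1" using sum_squares unfolding \<kappa>_def by (simp add: algebra_simps)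
  show "b\<^sup>2 < \<kappa>" unfolding \<kappa>_def using b2 B2 by simp
qed

text \<open>Together with \<open>1 < B\<close> this fixes the order
  \<open>0 < b < c < C < 1 < B\<close>, from which all later sign decisions are read off.\<close>

lemma order_points: "b < c" "c < C" "C < 1" "0 < c"
proof -
  have "b * 2 < b * (1 + B\<^sup>2)" using b B2 by (intro mult_strict_left_mono) auto
  then show bc: "b < c" by (simp add: c_def)
  then show "0 < c" using b by simp
  have C0: "0 < C" using B b2 by (simp add: C_def add_pos_pos)
  have "C * (1 + B\<^sup>2) = B / 2 * ((1 + b\<^sup>2) * (1 + B\<^sup>2))" by (simp add: C_def algebra_simps)
  then have "C * (1 + B\<^sup>2) = 2 * B" unfolding bB by simp
  also have "\<dots> < 1 * (1 + B\<^sup>2)"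
  proof -
    have "0 < (B - 1)\<^sup>2" using B by simp
    then show ?thesis by (simp add: power2_eq_square algebra_simps)
  qed
  finally show "C < 1" by (rule mult_right_less_imp_less) (use B2 in simp)
  have bB1: "b * B < 1"
  proof -
    have "(b * B)\<^sup>2 < 1" using \<kappa>(2) by (simp add: \<kappa>_def power_mult_distrib)
    then show ?thesis using b B by (simp add: abs_square_less_1)
  qed
  have "C - c = (B - b) * (1 - b * B) / 2" by (simp add: C_def c_def algebra_simps power2_eq_square diff_divide_distrib add_divide_distrib)
  also have "\<dots> > 0" using b B bB1 by (intro divide_pos_pos mult_pos_pos) auto
  finally show "c < C" by simp
qed

lemma \<alpha>_eq: "\<alpha> = b\<^sup>2 * c" and \<beta>_eq: "\<beta> = B\<^sup>2 * C"
  by (simp_all add: \<alpha>_def \<beta>_def c_def C_def power2_eq_square power3_eq_cube)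

lemma \<alpha>\<beta>: "0 < \<alpha>" "\<alpha> < \<beta>" "B < \<beta>"
proof -
  show "0 < \<alpha>" unfolding \<alpha>_eq using b2 order_points by simp
  have "b\<^sup>2 * c < 1 * 1" using b2 order_points by (intro mult_strict_mono) auto
  then have 1: "\<alpha> < 1" by (simp add: \<alpha>_eq)
  have "B * (1 + B\<^sup>2) < B * (2 * B\<^sup>2)" using B B2 by (intro mult_strict_left_mono) auto
  also have "B * (2 * B\<^sup>2) = \<beta> * (1 + B\<^sup>2)"
  proof -
    have "\<beta> * (1 + B\<^sup>2) = B ^ 3 / 2 * ((1 + b\<^sup>2) * (1 + B\<^sup>2))" by (simp add: \<beta>_def algebra_simps)
    then show ?thesis unfolding bB by (simp add: power2_eq_square power3_eq_cube)
  qed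
  finally show "B < \<beta>" by (rule mult_right_less_imp_less) (use B2 in simp)
  then show "\<alpha> < \<beta>" using 1 B by simp
qed

text \<open>Vieta for a double root \<open>x\<close> and a simple root \<open>- y\<close>:
  \<open>2 * x - y = a\<close>, \<open>2 * x * y - x\<^sup>2 = \<kappa>\<close> and
  \<open>x\<^sup>2 * y = a\<close>. Over an arbitrary real field it serves both the real values of
  \<open>r\<close> and the complex fibres.\<close>

lemma critical_factor:
  fixes W :: "'a :: real_field"
  assumes "(x, a, y) \<in> {(b, \<alpha>, c), (B, \<beta>, C)}"
  shows "W * (W\<^sup>2 - of_real \<kappa>) - of_real a * (W\<^sup>2 - 1) = (W - of_real x)\<^sup>2 * (W + of_real y)"
proof -
  have h: "2 * x - y = a" "2 * x * y - x\<^sup>2 = \<kappa>" "x\<^sup>2 * y = a"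
  proof -
    have b4: "b\<^sup>2 + B\<^sup>2 + b\<^sup>2 * B\<^sup>2 = 3" using bB by (simp add: algebra_simps)
    have "b * (b\<^sup>2 + B\<^sup>2 + b\<^sup>2 * B\<^sup>2) = b * 3" "B * (b\<^sup>2 + B\<^sup>2 + b\<^sup>2 * B\<^sup>2) = B * 3" unfolding b4 by simp_all
    then have "2 * b - c = \<alpha>" "2 * B - C = \<beta>"
      unfolding \<alpha>_def \<beta>_def c_def C_def by (simp_all add: field_simps power2_eq_square power3_eq_cube)
    moreover have "2 * b * c - b\<^sup>2 = \<kappa>" "2 * B * C - B\<^sup>2 = \<kappa>"
      unfolding c_def C_def \<kappa>_def by (simp_all add: field_simps power2_eq_square)
    ultimately have "2 * b - c = \<alpha>" "2 * b * c - b\<^sup>2 = \<kappa>" "b\<^sup>2 * c = \<alpha>"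
      "2 * B - C = \<beta>" "2 * B * C - B\<^sup>2 = \<kappa>" "B\<^sup>2 * C = \<beta>"
      using \<alpha>_eq \<beta>_eq by simp_all
    then show "2 * x - y = a" "2 * x * y - x\<^sup>2 = \<kappa>" "x\<^sup>2 * y = a" using assms by auto
  qed
  have "W * (W\<^sup>2 - of_real \<kappa>) - of_real a * (W\<^sup>2 - 1) =
     W ^ 3 - of_real (2 * x - y) * W\<^sup>2 - of_real (2 * x * y - x\<^sup>2) * W + of_real (x\<^sup>2 * y)"
    unfolding h by (simp add: algebra_simps power2_eq_square power3_eq_cube)
  also have "\<dots> = (W - of_real x)\<^sup>2 * (W + of_real y)"
    by (simp add: algebra_simps power2_eq_square power3_eq_cube)
  finally show ?thesis .
qed

lemma critical_factor_neg:
  fixes W :: "'a :: real_field"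
  assumes "(x, a, y) \<in> {(b, \<alpha>, c), (B, \<beta>, C)}"
  shows "W * (W\<^sup>2 - of_real \<kappa>) + of_real a * (W\<^sup>2 - 1) = (W + of_real x)\<^sup>2 * (W - of_real y)"
  using critical_factor[OF assms, of "- W"] by (simp add: algebra_simps power2_eq_square)

lemma r_values: "r b = \<alpha>" "r B = \<beta>" "r c = - \<alpha>" "r C = - \<beta>"
proof -
  have n: "b\<^sup>2 - 1 \<noteq> 0" "B\<^sup>2 - 1 \<noteq> 0" "c\<^sup>2 - 1 \<noteq> 0" "C\<^sup>2 - 1 \<noteq> 0"
    using b2 B2 order_points by (auto simp: power2_eq_1_iff)
  show "r b = \<alpha>" using critical_factor[of b \<alpha> c b] n by (simp add: r_def field_simps)
  show "r B = \<beta>" using critical_factor[of B \<beta> C B] n by (simp add: r_def field_simps)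
  show "r c = - \<alpha>" using critical_factor_neg[of b \<alpha> c c] n by (simp add: r_def field_simps)
  show "r C = - \<beta>" using critical_factor_neg[of B \<beta> C C] n by (simp add: r_def field_simps)
qed

lemma r_minus: "r (- x) = - r x" by (simp add: r_def)

lemma r_continuous: "\<forall>x\<in>S. x\<^sup>2 \<noteq> 1 \<Longrightarrow> continuous_on S r"
  unfolding r_def by (intro continuous_intros) auto

lemma r_derivative:
  assumes "x\<^sup>2 \<noteq> 1"
  shows "(r has_real_derivative (x\<^sup>2 - b\<^sup>2) * (x\<^sup>2 - B\<^sup>2) / (x\<^sup>2 - 1)\<^sup>2) (at x)"
proof -
  have n: "x\<^sup>2 - 1 \<noteq> 0" using assms by simp
  have "(r has_real_derivative ((1 * (x\<^sup>2 - \<kappa>) + (2 * x) * x) * (x\<^sup>2 - 1) - x * (x\<^sup>2 - \<kappa>) * (2 * x)) / ((x\<^sup>2 - 1) * (x\<^sup>2 - 1))) (at x)"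
    unfolding r_def
    by (rule derivative_eq_intros refl n | simp)+
  moreover have "(1 * (x\<^sup>2 - \<kappa>) + (2 * x) * x) * (x\<^sup>2 - 1) - x * (x\<^sup>2 - \<kappa>) * (2 * x) = (x\<^sup>2 - b\<^sup>2) * (x\<^sup>2 - B\<^sup>2)"
  proof -
    have "(x\<^sup>2 - b\<^sup>2) * (x\<^sup>2 - B\<^sup>2) = x ^ 4 - (b\<^sup>2 + B\<^sup>2) * x\<^sup>2 + \<kappa>"
      by (simp add: \<kappa>_def algebra_simps power2_eq_square power4_eq_xxxx)
    then show ?thesis unfolding sum_squares by (simp add: algebra_simps power2_eq_square power4_eq_xxxx)
  qed
  ultimately show ?thesis by (simp add: power2_eq_square)
qed

lemma r_derivative_pos:
  assumes "\<bar>x\<bar> < b"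
  shows "0 < (x\<^sup>2 - b\<^sup>2) * (x\<^sup>2 - B\<^sup>2) / (x\<^sup>2 - 1)\<^sup>2"
proof -
  have "x\<^sup>2 < b\<^sup>2" using assms by (metis abs_ge_zero power2_abs power_strict_mono zero_less_numeral)
  then have "x\<^sup>2 < b\<^sup>2" "x\<^sup>2 < B\<^sup>2" "x\<^sup>2 \<noteq> 1" using b2 B2 by auto
  then show ?thesis by (intro divide_pos_pos mult_neg_neg) auto
qed

lemma r_strict_mono:
  assumes "-b < x" "x < y" "y < b"
  shows "r x < r y"
proof (rule DERIV_pos_imp_increasing[OF assms(2)])
  fix z assume z: "x \<le> z" "z \<le> y"
  then have zb: "\<bar>z\<bar> < b" using assms by auto
  then have "z\<^sup>2 < 1" using b by (simp add: abs_square_less_1)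
  then show "\<exists>D. (r has_real_derivative D) (at z) \<and> 0 < D"
    using r_derivative[of z] r_derivative_pos[OF zb] by auto
qed

lemma r_pos: "0 < e \<Longrightarrow> e < b \<Longrightarrow> 0 < r e"
  using r_strict_mono[of 0 e] b by (simp add: r_def)

lemma r_less_\<alpha>: assumes "0 < e" "e < b" shows "r e < \<alpha>"
proof -
  have "r e < r ((e + b) / 2)" using assms b by (intro r_strict_mono) auto
  also have "r ((e + b) / 2) \<le> r b"
  proof (rule DERIV_nonneg_imp_increasing_open[of "(e + b) / 2" b r])
    show "(e + b) / 2 \<le> b" using assms by simp
    show "continuous_on {(e + b) / 2..b} r"
    proof (rule r_continuous, rule ballI)
      fix x assume "x \<in> {(e + b) / 2..b}"
      then have "\<bar>x\<bar> < 1" using assms b by auto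
      then show "x\<^sup>2 \<noteq> 1" using abs_square_less_1[of x] by auto
    qed
    fix x assume "(e + b) / 2 < x" "x < b"
    then have x: "\<bar>x\<bar> < b" "\<bar>x\<bar> < 1" using assms b by auto
    then have "x\<^sup>2 \<noteq> 1" using abs_square_less_1[of x] by auto
    then show "\<exists>y. DERIV r x :> y \<and> 0 \<le> y" using r_derivative r_derivative_pos[OF x(1)] by (meson less_imp_le)
  qed
  finally show ?thesis by (simp add: r_values)
qed

subsection \<open>The fibres\<close>

text \<open>The complex fibre of \<open>r\<close> over \<open>Y\<close> with the denominator
  cleared. No spurious points arise: at \<open>W\<^sup>2 = 1\<close> the left side is
  \<open>W * (1 - \<kappa>)\<close>, which is not 0, while the right side is 0.\<close>

definition Z :: "real \<Rightarrow> complex set" where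
  "Z Y = {W. W * (W\<^sup>2 - of_real \<kappa>) = of_real Y * (W\<^sup>2 - 1)}"

text \<open>The discriminant of \<open>(1 - x\<^sup>2) * W\<^sup>2 + (1 - \<kappa>) * x * W -
  (\<kappa> - x\<^sup>2)\<close>, the quadratic that remains for the other two points over
  \<open>r x\<close> once the root \<open>x\<close> is divided out.\<close>

definition disc :: "real \<Rightarrow> real" where
  "disc x = (1 - \<kappa>)\<^sup>2 * x\<^sup>2 + 4 * (1 - x\<^sup>2) * (\<kappa> - x\<^sup>2)"

text \<open>The two remaining preimages coalesce exactly when \<open>x\<close> is the simple point
  over a critical value, so the zeros of the discriminant must be \<plusminus>c and
  \<plusminus>C.\<close>

lemma disc_factor: "disc x = 4 * (x\<^sup>2 - c\<^sup>2) * (x\<^sup>2 - C\<^sup>2)"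
proof -
  have b4: "b\<^sup>2 + B\<^sup>2 + b\<^sup>2 * B\<^sup>2 = 3" using bB by (simp add: algebra_simps)
  have d: "2 * c = b * (1 + B\<^sup>2)" "2 * C = B * (1 + b\<^sup>2)" by (simp_all add: c_def C_def)
  have 1: "c\<^sup>2 * C\<^sup>2 = \<kappa>"
  proof -
    have "c\<^sup>2 * C\<^sup>2 = b\<^sup>2 * B\<^sup>2 * ((1 + b\<^sup>2) * (1 + B\<^sup>2))\<^sup>2 / 16"
      by (simp add: c_def C_def power_mult_distrib power_divide)
    then show ?thesis unfolding bB by (simp add: \<kappa>_def)
  qed
  have "(2 * c)\<^sup>2 + (2 * C)\<^sup>2 = 4 * (1 + \<kappa>) - (1 - \<kappa>)\<^sup>2"
  proof -
    have "(b * (1 + B\<^sup>2))\<^sup>2 + (B * (1 + b\<^sup>2))\<^sup>2 = (b\<^sup>2 + B\<^sup>2) + 4 * \<kappa> + \<kappa> * (b\<^sup>2 + B\<^sup>2)"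
      by (simp add: \<kappa>_def algebra_simps power2_eq_square)
    then show ?thesis unfolding d sum_squares by (simp add: algebra_simps power2_eq_square)
  qed
  then have 2: "4 * (c\<^sup>2 + C\<^sup>2) = 4 * (1 + \<kappa>) - (1 - \<kappa>)\<^sup>2" by (simp add: power_mult_distrib)
  have "4 * (x\<^sup>2 - c\<^sup>2) * (x\<^sup>2 - C\<^sup>2) = 4 * x ^ 4 - 4 * (c\<^sup>2 + C\<^sup>2) * x\<^sup>2 + 4 * (c\<^sup>2 * C\<^sup>2)"
    by (simp add: algebra_simps power2_eq_square power4_eq_xxxx)
  then show ?thesis unfolding 1 2 disc_def by (simp add: algebra_simps power2_eq_square power4_eq_xxxx)
qed

lemma fibre_factor:
  fixes W :: complex
  assumes "x\<^sup>2 \<noteq> 1"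
  shows "W \<in> Z (r x) \<longleftrightarrow> W = of_real x \<or>
     (2 * (1 - (of_real x)\<^sup>2) * W + (1 - of_real \<kappa>) * of_real x)\<^sup>2 = of_real (disc x)"
proof -
  define X k where "X = complex_of_real x" and "k = complex_of_real \<kappa>"
  have n: "X\<^sup>2 - 1 \<noteq> 0" using assms unfolding X_def by (metis eq_iff_diff_eq_0 of_real_1 of_real_eq_iff of_real_power)
  have Y: "of_real (r x) * (X\<^sup>2 - 1) = X * (X\<^sup>2 - k)"
  proof -
    have "r x * (x\<^sup>2 - 1) = x * (x\<^sup>2 - \<kappa>)" using assms by (simp add: r_def)
    then have "complex_of_real (r x * (x\<^sup>2 - 1)) = of_real (x * (x\<^sup>2 - \<kappa>))" by (rule arg_cong)
    then show ?thesis by (simp add: X_def k_def)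
  qed
  have "W \<in> Z (r x) \<longleftrightarrow> (W * (W\<^sup>2 - k)) * (X\<^sup>2 - 1) = of_real (r x) * (W\<^sup>2 - 1) * (X\<^sup>2 - 1)"
    using n by (simp add: Z_def k_def)
  also have "\<dots> \<longleftrightarrow> (W * (W\<^sup>2 - k)) * (X\<^sup>2 - 1) - (of_real (r x) * (X\<^sup>2 - 1)) * (W\<^sup>2 - 1) = 0"
    by (simp add: mult_ac)
  also have "\<dots> \<longleftrightarrow> 4 * (1 - X\<^sup>2) * ((W * (W\<^sup>2 - k)) * (X\<^sup>2 - 1) - (X * (X\<^sup>2 - k)) * (W\<^sup>2 - 1)) = 0"
    unfolding Y using n by auto
  also have "4 * (1 - X\<^sup>2) * ((W * (W\<^sup>2 - k)) * (X\<^sup>2 - 1) - (X * (X\<^sup>2 - k)) * (W\<^sup>2 - 1)) =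
    (X - W) * ((2 * (1 - X\<^sup>2) * W + (1 - k) * X)\<^sup>2 - ((1 - k)\<^sup>2 * X\<^sup>2 + 4 * (1 - X\<^sup>2) * (k - X\<^sup>2)))"
    by algebra
  also have "(1 - k)\<^sup>2 * X\<^sup>2 + 4 * (1 - X\<^sup>2) * (k - X\<^sup>2) = of_real (disc x)" by (simp add: disc_def X_def k_def)
  finally show ?thesis by (auto simp: X_def k_def)
qed

lemma fibre_three:
  assumes x1: "x\<^sup>2 \<noteq> 1" and D: "0 < disc x" and xb: "x\<^sup>2 \<noteq> b\<^sup>2" "x\<^sup>2 \<noteq> B\<^sup>2"
  shows "\<exists>X. card X = 3 \<and> Z (r x) = complex_of_real ` X"
proof -
  define m where "m = 2 * (1 - x\<^sup>2)"
  have m: "m \<noteq> 0" using x1 by (simp add: m_def)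
  define t1 t2 where "t1 = (sqrt (disc x) - (1 - \<kappa>) * x) / m" and "t2 = (- sqrt (disc x) - (1 - \<kappa>) * x) / m"
  have t: "m * t1 + (1 - \<kappa>) * x = sqrt (disc x)" "m * t2 + (1 - \<kappa>) * x = - sqrt (disc x)"
    using m by (auto simp: t1_def t2_def)
  have "W \<in> Z (r x) \<longleftrightarrow> W = of_real x \<or> W = of_real t1 \<or> W = of_real t2" for W
  proof -
    have "(2 * (1 - (of_real x)\<^sup>2) * W + (1 - of_real \<kappa>) * of_real x)\<^sup>2 = of_real (disc x) \<longleftrightarrow>
       (of_real m * W + of_real ((1 - \<kappa>) * x))\<^sup>2 = (of_real (sqrt (disc x)))\<^sup>2"
      using D by (simp add: m_def of_real_power[symmetric] del: of_real_power)
    also have "\<dots> \<longleftrightarrow> of_real m * W + of_real ((1 - \<kappa>) * x) = of_real (sqrt (disc x)) \<or>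
        of_real m * W + of_real ((1 - \<kappa>) * x) = - of_real (sqrt (disc x))" by (rule power2_eq_iff)
    also have "of_real m * W + of_real ((1 - \<kappa>) * x) = of_real (sqrt (disc x)) \<longleftrightarrow> W = of_real t1"
      using m unfolding t(1)[symmetric] by simp
    also have "of_real m * W + of_real ((1 - \<kappa>) * x) = - of_real (sqrt (disc x)) \<longleftrightarrow> W = of_real t2"
    proof -
      have "- complex_of_real (sqrt (disc x)) = of_real (m * t2 + (1 - \<kappa>) * x)" unfolding t(2) by simp
      then show ?thesis using m by simp
    qed
    finally show ?thesis using fibre_factor[OF x1, of W] by simp
  qed
  then have Zeq: "Z (r x) = of_real ` {x, t1, t2}" by auto
  have "t1 \<noteq> t2" using t D by auto
  \<comment> \<open>If \<open>x\<close> were also a root of the quadratic it would be a double point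
    of the fibre, so its square would be that of \<open>b\<close> or \<open>B\<close>.\<close>
  moreover have "x \<noteq> t1 \<and> x \<noteq> t2"
  proof (rule ccontr)
    assume "\<not> ?thesis"
    then have "(m * x + (1 - \<kappa>) * x)\<^sup>2 = disc x" using t D by auto
    then have "4 * (1 - x\<^sup>2) * ((x\<^sup>2 - b\<^sup>2) * (x\<^sup>2 - B\<^sup>2)) = 0"
      using sum_squares unfolding m_def disc_def \<kappa>_def by algebra
    then show False using x1 xb by auto
  qed
  ultimately have "card {x, t1, t2} = 3" by auto
  then show ?thesis using Zeq by blast
qed

lemma fibre_one:
  assumes x1: "x\<^sup>2 \<noteq> 1" and D: "disc x < 0"
  shows "\<exists>w. Im w \<noteq> 0 \<and> Z (r x) = {complex_of_real x, w, cnj w}"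
proof -
  define m where "m = 2 * (1 - x\<^sup>2)"
  have m: "m \<noteq> 0" using x1 by (simp add: m_def)
  define w where "w = Complex (- (1 - \<kappa>) * x / m) (sqrt (- disc x) / m)"
  have t: "of_real m * w + of_real ((1 - \<kappa>) * x) = \<i> * of_real (sqrt (- disc x))"
     "of_real m * cnj w + of_real ((1 - \<kappa>) * x) = - (\<i> * of_real (sqrt (- disc x)))"
    using m by (auto simp: w_def complex_eq_iff algebra_simps)
  have "W \<in> Z (r x) \<longleftrightarrow> W = of_real x \<or> W = w \<or> W = cnj w" for W
  proof -
    have "(\<i> * complex_of_real (sqrt (- disc x)))\<^sup>2 = - of_real ((sqrt (- disc x))\<^sup>2)" by (simp add: power_mult_distrib)
    also have "\<dots> = of_real (disc x)" using D by simp
    finally have "(2 * (1 - (of_real x)\<^sup>2) * W + (1 - of_real \<kappa>) * of_real x)\<^sup>2 = of_real (disc x) \<longleftrightarrow>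
       (of_real m * W + of_real ((1 - \<kappa>) * x))\<^sup>2 = (\<i> * of_real (sqrt (- disc x)))\<^sup>2"
      by (simp add: m_def)
    also have "\<dots> \<longleftrightarrow> of_real m * W + of_real ((1 - \<kappa>) * x) = \<i> * of_real (sqrt (- disc x)) \<or>
        of_real m * W + of_real ((1 - \<kappa>) * x) = - (\<i> * of_real (sqrt (- disc x)))" by (rule power2_eq_iff)
    also have "of_real m * W + of_real ((1 - \<kappa>) * x) = \<i> * of_real (sqrt (- disc x)) \<longleftrightarrow> W = w"
      unfolding t(1)[symmetric] using m by simp
    also have "of_real m * W + of_real ((1 - \<kappa>) * x) = - (\<i> * of_real (sqrt (- disc x))) \<longleftrightarrow> W = cnj w"
      unfolding t(2)[symmetric] using m by simp
    finally show ?thesis using fibre_factor[OF x1, of W] by simp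
  qed
  then have "Z (r x) = {of_real x, w, cnj w}" by auto
  moreover have "Im w \<noteq> 0" using D m by (simp add: w_def)
  ultimately show ?thesis by blast
qed

lemma Z_minus: "W \<in> Z (- Y) \<longleftrightarrow> - W \<in> Z Y"
  by (simp add: Z_def) (metis minus_minus)

text \<open>For each range of \<open>\<bar>Y\<bar>\<close> a real preimage is sought in an interval
  where the sign of \<open>disc\<close> is known. Here it is the interval between \<open>- b\<close>
  and \<open>b\<close>, where both factors of \<open>disc\<close> are negative.\<close>

lemma fibre_inner:
  assumes "\<bar>Y\<bar> < \<alpha>"
  shows "\<exists>X. card X = 3 \<and> Z Y = complex_of_real ` X"
proof -
  have "\<exists>x\<ge>-b. x \<le> b \<and> r x = Y"
  proof (rule IVT')
    show "r (- b) \<le> Y" "Y \<le> r b" using assms by (auto simp: r_minus r_values)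
    show "continuous_on {- b..b} r"
    proof (rule r_continuous, rule ballI)
      fix x assume "x \<in> {- b..b}"
      then have "\<bar>x\<bar> < 1" using b by auto
      then show "x\<^sup>2 \<noteq> 1" using abs_square_less_1[of x] by auto
    qed
  qed (use b in simp)
  then obtain x where x: "-b \<le> x" "x \<le> b" "r x = Y" by blast
  have "x \<noteq> b" "x \<noteq> -b" using x(3) assms r_values(1) r_minus[of b] by auto
  then have xb: "\<bar>x\<bar> < b" using x by auto
  then have x2: "x\<^sup>2 < b\<^sup>2" by (metis abs_ge_zero power2_abs power_strict_mono zero_less_numeral)
  have "b\<^sup>2 < c\<^sup>2" "c\<^sup>2 < C\<^sup>2" using order_points b by (auto intro!: power_strict_mono)
  then have "0 < disc x" unfolding disc_factor using x2 by (intro mult_neg_neg mult_pos_neg) auto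
  then show ?thesis using fibre_three[of x] x2 b2 B2 x(3) by auto
qed

text \<open>On the interval from \<open>c\<close> to \<open>C\<close> the values of \<open>r\<close>
  run from \<open>- \<alpha>\<close> to \<open>- \<beta>\<close>, and \<open>disc\<close> is
  negative inside it. Oddness of \<open>r\<close> supplies the other sign of
  \<open>Y\<close>.\<close>

lemma fibre_middle:
  assumes "\<alpha> < \<bar>Y\<bar>" "\<bar>Y\<bar> < \<beta>"
  shows "\<exists>x w. Im w \<noteq> 0 \<and> Z Y = {complex_of_real x, w, cnj w}"
proof -
  have "\<exists>x\<ge>c. x \<le> C \<and> r x = - \<bar>Y\<bar>"
  proof (rule IVT2')
    show "r C \<le> - \<bar>Y\<bar>" "- \<bar>Y\<bar> \<le> r c" using assms by (auto simp: r_values)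
    show "continuous_on {c..C} r"
    proof (rule r_continuous, rule ballI)
      fix x assume "x \<in> {c..C}"
      then have "\<bar>x\<bar> < 1" using order_points by auto
      then show "x\<^sup>2 \<noteq> 1" using abs_square_less_1[of x] by auto
    qed
  qed (use order_points in simp)
  then obtain x where x: "c \<le> x" "x \<le> C" "r x = - \<bar>Y\<bar>" by blast
  have "x \<noteq> c" "x \<noteq> C" using x(3) assms r_values(3,4) by auto
  then have "c < x" "x < C" using x by auto
  then have x2: "c\<^sup>2 < x\<^sup>2" "x\<^sup>2 < C\<^sup>2" using order_points by (auto intro!: power_strict_mono)
  have "\<bar>x\<bar> < 1" using x order_points by auto
  then have x1: "x\<^sup>2 \<noteq> 1" using abs_square_less_1[of x] by auto
  have D: "disc x < 0" unfolding disc_factor using x2 by (intro mult_pos_neg) auto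
  define y where "y = (if Y < 0 then x else - x)"
  have "r y = Y" "disc y < 0" "y\<^sup>2 \<noteq> 1" using x(3) D x1 by (auto simp: y_def r_minus disc_def)
  then show ?thesis using fibre_one[of y] by auto
qed

lemma fibre_outer:
  assumes "\<beta> < \<bar>Y\<bar>"
  shows "\<exists>X. card X = 3 \<and> Z Y = complex_of_real ` X"
proof -
  have YB: "B < \<bar>Y\<bar>" using assms \<alpha>\<beta> by simp
  have big: "1 < x\<^sup>2" if "B \<le> x" for x using that B by (simp add: one_less_power)
  have "\<exists>x\<ge>B. x \<le> \<bar>Y\<bar> \<and> r x = \<bar>Y\<bar>"
  proof (rule IVT')
    show "r B \<le> \<bar>Y\<bar>" using assms by (simp add: r_values)
    \<comment> \<open>Since \<kappa> < 1, the function satisfies \<open>y \<le> r y\<close> for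
      \<open>y > 1\<close>; so \<open>\<bar>Y\<bar>\<close> itself is the right end of the interval
      for the intermediate value theorem.\<close>
    have "\<bar>Y\<bar> * (\<bar>Y\<bar>\<^sup>2 - 1) \<le> \<bar>Y\<bar> * (\<bar>Y\<bar>\<^sup>2 - \<kappa>)" using \<kappa> by (intro mult_left_mono) auto
    then show "\<bar>Y\<bar> \<le> r \<bar>Y\<bar>" using big[of "\<bar>Y\<bar>"] YB unfolding r_def by (simp add: le_divide_eq)
    show "continuous_on {B..\<bar>Y\<bar>} r" using big by (intro r_continuous) force
  qed (use YB in simp)
  then obtain x where x: "B \<le> x" "x \<le> \<bar>Y\<bar>" "r x = \<bar>Y\<bar>" by blast
  have "x \<noteq> B" using x(3) assms r_values(2) by auto
  then have xB: "B < x" using x by auto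
  have x2: "B\<^sup>2 < x\<^sup>2" using xB B by (intro power_strict_mono) auto
  have "c\<^sup>2 < 1" "C\<^sup>2 < 1" using order_points by (auto simp: abs_square_less_1)
  then have D: "0 < disc x" unfolding disc_factor using x2 B2 by (intro mult_pos_pos) auto
  define y where "y = (if Y < 0 then - x else x)"
  have "r y = Y" "0 < disc y" "B\<^sup>2 < y\<^sup>2" using x(3) D x2 by (auto simp: y_def r_minus disc_def)
  then show ?thesis using fibre_three[of y] b2 B2 by auto
qed

lemma fibre_critical:
  assumes "(x, a, y) \<in> {(b, \<alpha>, c), (B, \<beta>, C)}"
  shows "Z a = {of_real x, - of_real y}" "Z (- a) = {- of_real x, of_real y}"
proof -
  show *: "Z a = {of_real x, - of_real y}"
  proof -
    have "W \<in> Z a \<longleftrightarrow> (W - of_real x)\<^sup>2 * (W + of_real y) = 0" for W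
      unfolding critical_factor[OF assms, symmetric] by (simp add: Z_def)
    then have "W \<in> Z a \<longleftrightarrow> W = of_real x \<or> W = - of_real y" for W
      by (simp add: eq_neg_iff_add_eq_0)
    then show ?thesis by blast
  qed
  show "Z (- a) = {- of_real x, of_real y}"
  proof -
    have "W \<in> Z (- a) \<longleftrightarrow> W = - of_real x \<or> W = of_real y" for W
      unfolding Z_minus * by (simp add: minus_equation_iff[of W] eq_commute[of W])
    then show ?thesis by blast
  qed
qed

end

section \<open>The normalised rational function: fibres, critical points, admissibility\<close>

lemma order_ge_2_iff:
  fixes p :: "complex poly"
  assumes "p \<noteq> 0" "poly p w = 0" "pderiv p \<noteq> 0"
  shows "order w p \<ge> 2 \<longleftrightarrow> poly (pderiv p) w = 0"
  using order_pderiv[OF assms(1,2)] order_root[of "pderiv p" w] assms(3) by auto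

locale scaled_cubic = cubic +
  fixes e :: real
  assumes e: "0 < e" "e < b"
begin

text \<open>Extracting \<open>e\<^sup>2\<close> from numerator and denominator of
  \<open>r (e * x) / r e\<close> makes the denominator \<open>x\<^sup>2 - 1 / e\<^sup>2\<close>
  monic and leaves the leading coefficient \<open>e / r e\<close> above it.\<close>

definition k0 :: real where "k0 = e / r e"
definition N :: "real poly" where "N = [:0, - k0 * \<kappa> / e\<^sup>2, 0, k0:]"
definition D :: "real poly" where "D = [:- 1 / e\<^sup>2, 0, 1:]"
definition R :: ratfun where "R = Fract N D"

lemma re: "0 < r e" by (rule r_pos[OF e])

lemma k0: "k0 > 0" using e re by (simp add: k0_def)

lemma coprime_ND: "coprime N D"
proof (rule coprimeI)
  fix q assume q: "q dvd N" "q dvd D"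
  define g where "g = k0 * (1 - \<kappa>) / e\<^sup>2"
  have g: "g \<noteq> 0" using k0 \<kappa> e by (simp add: g_def)
  \<comment> \<open>Euclid's algorithm: subtracting \<open>k0 * x\<close> times \<open>D\<close>
    from \<open>N\<close> leaves \<open>g * x\<close>, and \<open>x\<^sup>2 - D\<close> is a nonzero
    constant. The coefficient \<open>g\<close> is not 0 because \<kappa> differs from 1.\<close>
  have "q dvd [:0, 1 / g:] * (N - [:0, k0:] * D) - D" using q by (intro dvd_diff dvd_mult) auto
  also have "N - [:0, k0:] * D = [:0, g:]"
    by (simp add: N_def D_def g_def algebra_simps diff_divide_distrib)
  also have "[:0, 1 / g:] * [:0, g:] - D = [:1 / e\<^sup>2:]" using g by (simp add: D_def)
  finally have "q dvd [:1 / e\<^sup>2:]" .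
  moreover have "[:1 / e\<^sup>2:] dvd 1" using e by (simp add: is_unit_const_poly_iff dvd_field_iff)
  ultimately show "is_unit q" by (rule dvd_trans)
qed

lemma numer_R: "numer R = N" and denom_R: "denom R = D"
  unfolding R_def using numer_denom_Fract[OF coprime_ND] by (simp_all add: D_def)

lemma degrees: "degree N = 3" "degree D = 2"
  using k0 by (simp_all add: N_def D_def)

lemma rat_degree_R: "rat_degree R = 3"
  by (simp add: rat_degree_def numer_R denom_R degrees)

lemma rat_fun_R: "rat_fun R x = r (e * x) / r e"
proof -
  have e2: "e\<^sup>2 \<noteq> 0" using e by simp
  have n: "poly N x = (k0 / e ^ 3) * ((e * x) * ((e * x)\<^sup>2 - \<kappa>))"
    using e by (simp add: N_def field_simps power2_eq_square power3_eq_cube)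
  have d: "poly D x = (1 / e\<^sup>2) * ((e * x)\<^sup>2 - 1)"
    using e by (simp add: D_def field_simps power2_eq_square)
  have "(k0 / e ^ 3) / (1 / e\<^sup>2) = 1 / r e"
    using e by (simp add: k0_def power2_eq_square power3_eq_cube)
  then show ?thesis
    unfolding rat_fun_def numer_R denom_R n d r_def[of "e * x"] times_divide_times_eq[symmetric] by simp
qed

lemma cpoly_N: "poly (cpoly N) w = of_real (k0 / e ^ 3) * ((of_real e * w) * ((of_real e * w)\<^sup>2 - of_real \<kappa>))"
  and cpoly_D: "poly (cpoly D) w = of_real (1 / e\<^sup>2) * ((of_real e * w)\<^sup>2 - 1)"
  using e by (simp_all add: N_def D_def map_poly_pCons field_simps power2_eq_square power3_eq_cube)

lemma k0_ratio: "k0 / e ^ 3 = (1 / e\<^sup>2) / r e"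
  using e by (simp add: k0_def power2_eq_square power3_eq_cube)

lemma rat_map_None: "rat_map R None = None"
  by (simp add: rat_map_def numer_R denom_R degrees)

lemma rat_map_eq_Some_iff:
  "rat_map R (Some w) = Some y \<longleftrightarrow>
     (of_real e * w) * ((of_real e * w)\<^sup>2 - of_real \<kappa>) = (y * of_real (r e)) * ((of_real e * w)\<^sup>2 - 1)"
proof (cases "(of_real e * w)\<^sup>2 = 1")
  case True
  have "of_real e * w \<noteq> 0" using True by auto
  moreover have "1 - complex_of_real \<kappa> \<noteq> 0" using \<kappa> by (metis less_irrefl of_real_1 of_real_eq_iff right_minus_eq)
  moreover have "poly (cpoly D) w = 0" unfolding cpoly_D using True by simp
  \<comment> \<open>At a pole both sides are false: the map takes the value infinity, and the
    cleared equation would force \<open>\<kappa> = 1\<close>.\<close>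
  ultimately show ?thesis by (simp add: rat_map_def denom_R True)
next
  case False
  have e2: "complex_of_real (1 / e\<^sup>2) \<noteq> 0" "complex_of_real (r e) \<noteq> 0" using e re by auto
  have D0: "poly (cpoly D) w \<noteq> 0" unfolding cpoly_D using False e2 by simp
  have "rat_map R (Some w) = Some y \<longleftrightarrow> poly (cpoly N) w = y * poly (cpoly D) w"
    using D0 by (simp add: rat_map_def denom_R numer_R divide_eq_eq)
  also have "\<dots> \<longleftrightarrow> (of_real e * w) * ((of_real e * w)\<^sup>2 - of_real \<kappa>) / of_real (r e) = y * ((of_real e * w)\<^sup>2 - 1)"
  proof -
    have s1: "complex_of_real ((1 / e\<^sup>2) / r e) * A = of_real (1 / e\<^sup>2) * (A / of_real (r e))" for A by simp
    have s2: "y * (complex_of_real (1 / e\<^sup>2) * A) = of_real (1 / e\<^sup>2) * (y * A)" for A by (rule mult.left_commute)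
    show ?thesis unfolding cpoly_D cpoly_N k0_ratio s1 s2 mult_cancel_left using e2(1) by blast
  qed
  also have "\<dots> \<longleftrightarrow> (of_real e * w) * ((of_real e * w)\<^sup>2 - of_real \<kappa>) = (y * of_real (r e)) * ((of_real e * w)\<^sup>2 - 1)"
    using e2 by (simp add: divide_eq_eq mult_ac)
  finally show ?thesis .
qed

lemma fibre_Some: "fibre R (Some (of_real y)) = (\<lambda>W. Some (W / of_real e)) ` Z (y * r e)"
proof (intro set_eqI)
  fix z
  have "Some w \<in> fibre R (Some (of_real y)) \<longleftrightarrow> of_real e * w \<in> Z (y * r e)" for w
    by (simp add: fibre_def rat_map_eq_Some_iff Z_def)
  have "None \<notin> fibre R (Some (of_real y))" by (simp add: fibre_def rat_map_None)
  show "z \<in> fibre R (Some (of_real y)) \<longleftrightarrow> z \<in> (\<lambda>W. Some (W / of_real e)) ` Z (y * r e)"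
  proof (cases z)
    case (Some w)
    have "Some w \<in> (\<lambda>W. Some (W / of_real e)) ` S \<longleftrightarrow> of_real e * w \<in> S" for S
    proof
      assume "Some w \<in> (\<lambda>W. Some (W / of_real e)) ` S"
      then obtain W where "W \<in> S" "w = W / of_real e" by auto
      then show "of_real e * w \<in> S" using e by simp
    next
      assume "of_real e * w \<in> S"
      then show "Some w \<in> (\<lambda>W. Some (W / of_real e)) ` S"
        by (rule rev_image_eqI) (use e in simp)
    qed
    then show ?thesis using \<open>\<And>w. Some w \<in> fibre R (Some (of_real y)) \<longleftrightarrow> of_real e * w \<in> Z (y * r e)\<close> Some by simp
  next
    case None
    then show ?thesis using \<open>None \<notin> fibre R (Some (of_real y))\<close> by auto
  qed
qed

lemma fibre_None: "fibre R None = cpoint ` {None, Some (1 / e), Some (- 1 / e)}"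
proof -
  have "Some w \<in> fibre R None \<longleftrightarrow> w = of_real (1 / e) \<or> w = of_real (- 1 / e)" for w
  proof -
    have "complex_of_real (1 / e\<^sup>2) \<noteq> 0" using e by simp
    then have "Some w \<in> fibre R None \<longleftrightarrow> (of_real e * w)\<^sup>2 = 1"
      unfolding fibre_def rat_map_def denom_R cpoly_D by simp
    also have "\<dots> \<longleftrightarrow> of_real e * w = 1 \<or> of_real e * w = - 1" by (rule power2_eq_1_iff)
    also have "\<dots> \<longleftrightarrow> w = of_real (1 / e) \<or> w = of_real (- 1 / e)"
      using e by (auto simp: field_simps)
    finally show ?thesis .
  qed
  moreover have "None \<in> fibre R None" by (simp add: fibre_def rat_map_None)
  ultimately show ?thesis
    by (intro set_eqI) (case_tac x; auto)
qed

lemma fibre_three_real: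
  assumes "\<exists>X. card X = 3 \<and> Z (y * r e) = complex_of_real ` X"
  shows "\<exists>X :: real option set. card X = 3 \<and> fibre R (Some (of_real y)) = cpoint ` X"
proof -
  obtain X where X: "card X = 3" "Z (y * r e) = complex_of_real ` X" using assms by blast
  have "card ((\<lambda>x. Some (x / e)) ` X) = card X" using e by (intro card_image) (auto simp: inj_on_def)
  moreover have "fibre R (Some (of_real y)) = cpoint ` (\<lambda>x. Some (x / e)) ` X"
    unfolding fibre_Some X image_image by simp
  ultimately show ?thesis using X by metis
qed

lemma fibre_poly_Some:
  "fibre_poly R (Some y) = [:y / of_real e ^ 2, - of_real (k0 * \<kappa> / e\<^sup>2), - y, of_real k0:]"
  by (simp add: fibre_poly_def numer_R denom_R N_def D_def map_poly_pCons)

text \<open>A point has local degree at least 2 when the derivative of its fibre polynomial vanishes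
  there. The fibre equation eliminates the value \<open>y\<close> from this condition and leaves the
  quartic with roots \<plusminus>b and \<plusminus>B.\<close>

lemma local_degree_critical:
  assumes "rat_map R (Some w) = Some y"
  shows "2 \<le> local_degree R (Some w) \<longleftrightarrow> of_real e * w \<in> of_real ` {b, - b, B, - B}"
proof -
  define W where "W = of_real e * w"
  define h where "h = fibre_poly R (Some y)"
  have k: "complex_of_real k0 \<noteq> 0" using k0 by simp
  have e0: "complex_of_real e \<noteq> 0" using e by simp
  have re0: "complex_of_real (r e) \<noteq> 0" using re by simp
  have eq: "W * (W\<^sup>2 - of_real \<kappa>) = (y * of_real (r e)) * (W\<^sup>2 - 1)"
    using assms unfolding rat_map_eq_Some_iff W_def .
  have W1: "W\<^sup>2 - 1 \<noteq> 0"
  proof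
    assume W1: "W\<^sup>2 - 1 = 0"
    then have "W \<noteq> 0" by auto
    moreover have "W * (1 - of_real \<kappa>) = 0" using eq W1 by simp
    ultimately show False using \<kappa> by (metis less_irrefl mult_eq_0_iff of_real_1 of_real_eq_iff right_minus_eq)
  qed
  have h0: "h \<noteq> 0" "pderiv h \<noteq> 0" using k by (simp_all add: h_def fibre_poly_Some pderiv_pCons)
  have kk: "complex_of_real k0 = of_real e / of_real (r e)" by (simp add: k0_def)
  have w: "w = W / of_real e" using e0 by (simp add: W_def)
  have hw: "poly h w = (W * (W\<^sup>2 - of_real \<kappa>) - (y * of_real (r e)) * (W\<^sup>2 - 1)) / (of_real (r e) * (of_real e)\<^sup>2)"
    unfolding h_def fibre_poly_Some w using e0 re0
    by (simp add: kk field_simps power2_eq_square power3_eq_cube)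
  then have hw0: "poly h w = 0" using eq by simp
  have dw: "poly (pderiv h) w = (3 * W\<^sup>2 - 2 * (y * of_real (r e)) * W - of_real \<kappa>) / (of_real (r e) * of_real e)"
    unfolding h_def fibre_poly_Some w using e0 re0
    by (simp add: kk pderiv_pCons field_simps power2_eq_square power3_eq_cube)
  have "local_degree R (Some w) = order w h" by (simp add: local_degree_def assms h_def)
  then have "2 \<le> local_degree R (Some w) \<longleftrightarrow> poly (pderiv h) w = 0"
    using order_ge_2_iff[OF h0(1) hw0 h0(2)] by simp
  \<comment> \<open>The extra factor \<open>W\<^sup>2 - 1\<close>, nonzero off the poles, makes the
    combination on the right of the fibre equation appear, so that \<open>y\<close> can be
    replaced.\<close>
  also have "\<dots> \<longleftrightarrow> (3 * W\<^sup>2 - 2 * (y * of_real (r e)) * W - of_real \<kappa>) * (W\<^sup>2 - 1) = 0"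
    unfolding dw using e0 re0 W1 by simp
  also have "(3 * W\<^sup>2 - 2 * (y * of_real (r e)) * W - of_real \<kappa>) * (W\<^sup>2 - 1)
     = (3 * W\<^sup>2 - of_real \<kappa>) * (W\<^sup>2 - 1) - 2 * W * ((y * of_real (r e)) * (W\<^sup>2 - 1))"
    by (simp add: algebra_simps)
  also have "\<dots> = W ^ 4 - (3 - of_real \<kappa>) * W\<^sup>2 + of_real \<kappa>"
    unfolding eq[symmetric] by (simp add: algebra_simps power2_eq_square power4_eq_xxxx)
  also have "3 - of_real \<kappa> = (of_real b)\<^sup>2 + (of_real B :: complex)\<^sup>2"
    using arg_cong[OF sum_squares, of complex_of_real] by simp
  also have "W ^ 4 - ((of_real b)\<^sup>2 + (of_real B)\<^sup>2) * W\<^sup>2 + of_real \<kappa> =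
      (W - of_real b) * (W + of_real b) * (W - of_real B) * (W + of_real B)"
    by (simp add: \<kappa>_def algebra_simps power2_eq_square power4_eq_xxxx)
  finally show ?thesis by (simp add: W_def[symmetric] eq_neg_iff_add_eq_0 disj_assoc)
qed

lemma critical_points_R: "critical_points R = cpoint ` (\<lambda>x. Some (x / e)) ` {b, - b, B, - B}"
proof -
  \<comment> \<open>The point at infinity is a pole whose order is the drop from the degree 3 of the
    map to the degree 2 of the denominator.\<close>
  have None: "local_degree R None = 1"
  proof -
    have "degree (cpoly D) = 2" by (simp add: D_def map_poly_pCons)
    then show ?thesis by (simp add: local_degree_def rat_map_None fibre_poly_def denom_R rat_degree_R)
  qed
  have Some: "2 \<le> local_degree R (Some w) \<longleftrightarrow> of_real e * w \<in> of_real ` {b, - b, B, - B}" for w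
  proof (cases "rat_map R (Some w)")
    case None
    have e0: "complex_of_real e \<noteq> 0" using e by simp
    have pole: "poly (cpoly D) w = 0"
      using None by (auto simp: rat_map_def denom_R split: if_splits)
    then have W: "(of_real e * w)\<^sup>2 = 1" unfolding cpoly_D using e by simp
    have "cpoly D \<noteq> 0" "pderiv (cpoly D) \<noteq> 0" by (simp_all add: D_def map_poly_pCons pderiv_pCons)
    from order_ge_2_iff[OF this(1) pole this(2)]
    have "2 \<le> local_degree R (Some w) \<longleftrightarrow> poly (pderiv (cpoly D)) w = 0"
      by (simp add: local_degree_def None fibre_poly_def denom_R)
    also have "\<dots> \<longleftrightarrow> w = 0" by (simp add: D_def map_poly_pCons pderiv_pCons)
    finally have "\<not> 2 \<le> local_degree R (Some w)" using W by auto
    moreover have "of_real e * w \<notin> of_real ` {b, - b, B, - B}"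
    proof
      assume "of_real e * w \<in> of_real ` {b, - b, B, - B}"
      then obtain x where x: "x \<in> {b, - b, B, - B}" "of_real e * w = of_real x" by blast
      then have "x\<^sup>2 = 1" using W by (metis of_real_1 of_real_eq_iff of_real_power)
      then show False using x(1) b2 B2 by auto
    qed
    ultimately show ?thesis by blast
  next
    case (Some y)
    then show ?thesis by (rule local_degree_critical)
  qed
  have e0: "complex_of_real e \<noteq> 0" using e by simp
  have "of_real e * w = of_real x \<longleftrightarrow> w = of_real (x / e)" for x and w :: complex
    using e0 by (auto simp: field_simps)
  then have S: "of_real e * w \<in> of_real ` X \<longleftrightarrow> w \<in> (\<lambda>x. of_real (x / e)) ` X" for X and w :: complex
    by (simp add: image_iff)
  show ?thesis
  proof (intro set_eqI)
    fix z
    show "z \<in> critical_points R \<longleftrightarrow> z \<in> cpoint ` (\<lambda>x. Some (x / e)) ` {b, - b, B, - B}"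
    proof (cases z)
      case None
      then show ?thesis using \<open>local_degree R None = 1\<close> by (simp add: critical_points_def)
    next
      case (Some w)
      have "z \<in> critical_points R \<longleftrightarrow> w \<in> (\<lambda>x. of_real (x / e)) ` {b, - b, B, - B}"
        unfolding Some critical_points_def mem_Collect_eq \<open>\<And>w. 2 \<le> local_degree R (Some w) \<longleftrightarrow> of_real e * w \<in> of_real ` {b, - b, B, - B}\<close> S ..
      also have "\<dots> \<longleftrightarrow> z \<in> cpoint ` (\<lambda>x. Some (x / e)) ` {b, - b, B, - B}"
        unfolding Some image_image by auto
      finally show ?thesis .
    qed
  qed
qed

lemma rat_map_real:
  assumes "(e * x)\<^sup>2 \<noteq> 1"
  shows "rat_map R (Some (of_real x)) = Some (of_real (r (e * x) / r e))"
proof -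
  have d: "(e * x)\<^sup>2 - 1 \<noteq> 0" "r e \<noteq> 0" using assms re by auto
  have "(e * x) * ((e * x)\<^sup>2 - \<kappa>) = (r (e * x) / r e * r e) * ((e * x)\<^sup>2 - 1)"
    using d by (simp add: r_def)
  from arg_cong[OF this, of complex_of_real] show ?thesis
    unfolding rat_map_eq_Some_iff by simp
qed

lemma critical_values_R: "critical_values R = cpoint ` (\<lambda>a. Some (a / r e)) ` {- \<beta>, - \<alpha>, \<alpha>, \<beta>}"
proof -
  have n: "b\<^sup>2 \<noteq> 1" "B\<^sup>2 \<noteq> 1" using b2 B2 by auto
  have *: "rat_map R (Some (of_real (x / e))) = Some (of_real (r x / r e))" if "x\<^sup>2 \<noteq> 1" for x
    using rat_map_real[of "x / e"] e that by simp
  show ?thesis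
    unfolding critical_values_def critical_points_R image_image
    using *[of b] *[of B] *[of "- b"] *[of "- B"] n by (auto simp: r_minus r_values)
qed

lemma order_linear_sq:
  fixes x y :: complex
  assumes "x \<noteq> y" "k \<noteq> 0"
  shows "order x (smult k ([:- x, 1:] ^ 2 * [:- y, 1:])) = 2"
    "order y (smult k ([:- x, 1:] ^ 2 * [:- y, 1:])) = 1"
proof -
  have nz: "[:- x, 1:] ^ 2 * [:- y, 1:] \<noteq> 0" by (simp only: mult_eq_0_iff power_eq_0_iff) simp
  have 1: "order x ([:- x, 1:] ^ 2) = 2" by (rule order_power_n_n)
  have 2: "order x [:- y, 1:] = 0" using assms by (intro order_0I) simp
  have 3: "order y [:- y, 1:] = 1" using order_power_n_n[of y 1] by simp
  have 4: "order y ([:- x, 1:] ^ 2) = 0" using assms by (intro order_0I) simp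
  show "order x (smult k ([:- x, 1:] ^ 2 * [:- y, 1:])) = 2"
    unfolding order_smult[OF assms(2)] order_mult[OF nz] 1 2 by simp
  show "order y (smult k ([:- x, 1:] ^ 2 * [:- y, 1:])) = 1"
    unfolding order_smult[OF assms(2)] order_mult[OF nz] 3 4 by simp
qed

text \<open>With \<open>W = e * w\<close> the fibre polynomial is \<open>k0\<close> times the given
  factorisation, from which the multiplicities 2 and 1 are read off.\<close>

lemma critical_fibre:
  assumes F: "\<And>W::complex. W * (W\<^sup>2 - of_real \<kappa>) - of_real a * (W\<^sup>2 - 1) = (W - of_real x)\<^sup>2 * (W - of_real y)"
    and xy: "x \<noteq> y"
  shows "fibre R (Some (of_real (a / r e))) = {Some (of_real (x / e)), Some (of_real (y / e))}"
    "local_degree R (Some (of_real (x / e))) = 2" "local_degree R (Some (of_real (y / e))) = 1"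
proof -
  have re0: "r e \<noteq> 0" "complex_of_real (r e) \<noteq> 0" "complex_of_real e \<noteq> 0" using re e by auto
  have "Z a = {of_real x, of_real y}"
  proof -
    have "W \<in> Z a \<longleftrightarrow> (W - of_real x)\<^sup>2 * (W - of_real y) = 0" for W
      unfolding F[symmetric] by (simp add: Z_def)
    then have "W \<in> Z a \<longleftrightarrow> W = of_real x \<or> W = of_real y" for W by simp
    then show ?thesis by blast
  qed
  then show fib: "fibre R (Some (of_real (a / r e))) = {Some (of_real (x / e)), Some (of_real (y / e))}"
    unfolding fibre_Some using re0 by simp
  define h where "h = fibre_poly R (Some (of_real (a / r e)))"
  have "h = smult (of_real k0) ([:- of_real (x / e), 1:] ^ 2 * [:- of_real (y / e), 1:])"
  proof (rule poly_ext)
    fix w :: complex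
    define W where "W = of_real e * w"
    have w: "w = W / of_real e" using re0 by (simp add: W_def)
    have kk: "complex_of_real k0 = of_real e / of_real (r e)" by (simp add: k0_def)
    have "poly h w = (W * (W\<^sup>2 - of_real \<kappa>) - of_real a * (W\<^sup>2 - 1)) / (of_real (r e) * (of_real e)\<^sup>2)"
      unfolding h_def fibre_poly_Some w using re0
      by (simp add: kk field_simps power2_eq_square power3_eq_cube)
    also have "\<dots> = poly (smult (of_real k0) ([:- of_real (x / e), 1:] ^ 2 * [:- of_real (y / e), 1:])) w"
      unfolding F w using re0 by (simp add: kk power2_eq_square) (simp add: field_simps)
    finally show "poly h w = poly (smult (of_real k0) ([:- of_real (x / e), 1:] ^ 2 * [:- of_real (y / e), 1:])) w" .
  qed
  moreover have "complex_of_real (x / e) \<noteq> of_real (y / e)" using xy e by simp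
  moreover have "complex_of_real k0 \<noteq> 0" using k0 by simp
  ultimately have "order (of_real (x / e)) h = 2" "order (of_real (y / e)) h = 1"
    using order_linear_sq by simp_all
  moreover have "rat_map R (Some (of_real (x / e))) = Some (of_real (a / r e))"
    "rat_map R (Some (of_real (y / e))) = Some (of_real (a / r e))"
    using fib by (auto simp: fibre_def)
  ultimately show "local_degree R (Some (of_real (x / e))) = 2" "local_degree R (Some (of_real (y / e))) = 1"
    by (simp_all add: local_degree_def h_def)
qed

lemma eY2: "t \<in> {-1..1} \<Longrightarrow> \<bar>e * t\<bar> < b \<and> (e * t)\<^sup>2 \<noteq> 1"
proof -
  assume t: "t \<in> {-1..1}"
  have "\<bar>e * t\<bar> \<le> e * 1" unfolding abs_mult using e t by (intro mult_mono) auto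
  then have 1: "\<bar>e * t\<bar> < b" using e by simp
  then have "\<bar>e * t\<bar> < 1" using b by simp
  then have "(e * t)\<^sup>2 < 1" by (simp add: abs_square_less_1)
  with 1 show ?thesis by simp
qed

lemma segment_image: "rat_map R ` cpoint ` unit_segment = cpoint ` unit_segment"
proof -
  have im: "(\<lambda>t. r (e * t) / r e) ` {-1..1} = {-1..1}"
  proof (intro equalityI subsetI)
    fix y assume "y \<in> (\<lambda>t. r (e * t) / r e) ` {-1..1}"
    then obtain t where t: "t \<in> {-1..1}" "y = r (e * t) / r e" by blast
    have "r (e * t) \<le> r e"
    proof (cases "t = 1")
      case False
      then have "e * t < e" using t e by simp
      moreover have "- b < e * t" using eY2[OF t(1)] by auto
      ultimately show ?thesis using r_strict_mono[of "e * t" e] e by simp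
    qed simp
    moreover have "r (- e) \<le> r (e * t)"
    proof (cases "t = - 1")
      case False
      then have "- 1 < t" using t by simp
      then have "e * (- 1) < e * t" using e by (intro mult_strict_left_mono) auto
      then have "- e < e * t" by simp
      moreover have "e * t < b" using eY2[OF t(1)] by auto
      ultimately show ?thesis using r_strict_mono[of "- e" "e * t"] e by simp
    qed simp
    ultimately show "y \<in> {-1..1}" unfolding t(2) r_minus using re by (simp add: le_divide_eq)
  next
    fix y :: real assume y: "y \<in> {-1..1}"
    have "\<exists>x\<ge>-e. x \<le> e \<and> r x = y * r e"
    proof (rule IVT')
      show "r (- e) \<le> y * r e" "y * r e \<le> r e" using y re mult_right_mono[of "-1" y "r e"] by (auto simp: r_minus)
      show "continuous_on {- e..e} r"
      proof (rule r_continuous, rule ballI)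
        fix x assume "x \<in> {- e..e}"
        then have "\<bar>x\<bar> < 1" using b e by auto
        then show "x\<^sup>2 \<noteq> 1" using abs_square_less_1[of x] by auto
      qed
    qed (use e in simp)
    then obtain x where x: "- e \<le> x" "x \<le> e" "r x = y * r e" by blast
    show "y \<in> (\<lambda>t. r (e * t) / r e) ` {-1..1}"
    proof (rule image_eqI[of _ _ "x / e"])
      show "y = r (e * (x / e)) / r e" using x e re by simp
      show "x / e \<in> {-1..1}" using x e by (simp add: le_divide_eq divide_le_eq)
    qed
  qed
  have "rat_map R ` cpoint ` unit_segment = (\<lambda>t. Some (of_real (r (e * t) / r e))) ` {-1..1}"
    unfolding unit_segment_def image_image using eY2 by (intro image_cong) (auto simp: rat_map_real)
  also have "\<dots> = (\<lambda>y. Some (of_real y)) ` (\<lambda>t. r (e * t) / r e) ` {-1..1}" by (simp add: image_image)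
  also have "\<dots> = cpoint ` unit_segment" unfolding im unit_segment_def by (simp add: image_image)
  finally show ?thesis .
qed

lemma rat_fun_derivative:
  assumes "t \<in> {-1..1}"
  defines "d \<equiv> ((e * t)\<^sup>2 - b\<^sup>2) * ((e * t)\<^sup>2 - B\<^sup>2) / ((e * t)\<^sup>2 - 1)\<^sup>2 * e / r e"
  shows "(rat_fun R has_real_derivative d) (at t)" "0 < d"
proof -
  have "((\<lambda>x. r (e * x)) has_real_derivative ((e * t)\<^sup>2 - b\<^sup>2) * ((e * t)\<^sup>2 - B\<^sup>2) / ((e * t)\<^sup>2 - 1)\<^sup>2 * e) (at t)"
    by (rule DERIV_compose_scale, rule r_derivative) (use eY2[OF assms(1)] in blast)
  then have "((\<lambda>x. r (e * x) / r e) has_real_derivative d) (at t)" unfolding d_def by (rule DERIV_cdivide)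
  moreover have "rat_fun R = (\<lambda>x. r (e * x) / r e)" using rat_fun_R by blast
  ultimately show "(rat_fun R has_real_derivative d) (at t)" by simp
  have "0 < ((e * t)\<^sup>2 - b\<^sup>2) * ((e * t)\<^sup>2 - B\<^sup>2) / ((e * t)\<^sup>2 - 1)\<^sup>2"
    using eY2[OF assms(1)] r_derivative_pos by blast
  then show "0 < d" unfolding d_def by (rule divide_pos_pos[OF mult_pos_pos[OF _ e(1)] re])
qed

lemma open_arc_Some: "x < z \<Longrightarrow> open_arc (Some x) (Some z) = Some ` {x<..<z}"
  unfolding open_arc_def cyclic_def by (auto simp: image_iff) (case_tac xa; auto)

lemma admissible_R: "admissible R"
proof -
  define P where "P = r e"
  have P: "0 < P" unfolding P_def by (rule re)
  have P\<alpha>: "P < \<alpha>" unfolding P_def by (rule r_less_\<alpha>[OF e])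
  have A: "1 < \<alpha> / P" "\<alpha> / P < \<beta> / P" using P P\<alpha> \<alpha>\<beta> by (auto simp: less_divide_eq divide_strict_right_mono)
  \<comment> \<open>The critical values in increasing order. Each critical point has the sign of its
    value and the simple point over it the opposite sign; this fixes the order of \<open>bb\<close>
    and \<open>cc\<close>.\<close>
  define a :: "nat \<Rightarrow> real option" where
    "a s = Some ((if s = 1 then - \<beta> else if s = 2 then - \<alpha> else if s = 3 then \<alpha> else \<beta>) / P)" for s
  define bb :: "nat \<Rightarrow> real option" where
    "bb s = Some ((if s = 1 then - B else if s = 2 then - b else if s = 3 then b else B) / e)" for s
  define cc :: "nat \<Rightarrow> real option" where
    "cc s = Some ((if s = 1 then C else if s = 2 then c else if s = 3 then - c else - C) / e)" for s
  have set4: "{1..4::nat} = {1, 2, 3, 4}" by auto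
  have as: "a 1 = Some (- \<beta> / P)" "a 2 = Some (- \<alpha> / P)" "a 3 = Some (\<alpha> / P)" "a 4 = Some (\<beta> / P)" "a (Suc 0) = Some (- \<beta> / P)"
    by (simp_all add: a_def)
  have arcs: "open_arc (a 1) (a 2) = Some ` {- \<beta> / P<..<- \<alpha> / P}" "open_arc (a 3) (a 4) = Some ` {\<alpha> / P<..<\<beta> / P}"
    unfolding as using A by (auto intro!: open_arc_Some)
  \<comment> \<open>After scaling by \<open>P\<close> the two arcs together are the set where the
    modulus lies between \<alpha> and \<beta>, which is the range with complex preimages.\<close>
  have arcs_iff: "Some y \<in> open_arc (a 1) (a 2) \<union> open_arc (a 3) (a 4) \<longleftrightarrow> \<alpha> < \<bar>y * P\<bar> \<and> \<bar>y * P\<bar> < \<beta>" for y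
  proof -
    have "Some y \<in> open_arc (a 1) (a 2) \<union> open_arc (a 3) (a 4) \<longleftrightarrow>
       (- \<beta> < y * P \<and> y * P < - \<alpha>) \<or> (\<alpha> < y * P \<and> y * P < \<beta>)"
    proof -
      have "Some y \<in> open_arc (a 1) (a 2) \<union> open_arc (a 3) (a 4) \<longleftrightarrow>
         (- \<beta> / P < y \<and> y < - \<alpha> / P) \<or> (\<alpha> / P < y \<and> y < \<beta> / P)"
        unfolding arcs by auto
      then show ?thesis by (simp only: pos_divide_less_eq[OF P] pos_less_divide_eq[OF P])
    qed
    also have "\<dots> \<longleftrightarrow> \<alpha> < \<bar>y * P\<bar> \<and> \<bar>y * P\<bar> < \<beta>" using \<alpha>\<beta> by (auto simp: abs_if)
    finally show ?thesis .
  qed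
  have crit1: "W * (W\<^sup>2 - of_real \<kappa>) - of_real \<alpha> * (W\<^sup>2 - 1) = (W - of_real b)\<^sup>2 * (W - of_real (- c))"
   and crit2: "W * (W\<^sup>2 - of_real \<kappa>) - of_real \<beta> * (W\<^sup>2 - 1) = (W - of_real B)\<^sup>2 * (W - of_real (- C))"
   and crit3: "W * (W\<^sup>2 - of_real \<kappa>) - of_real (- \<alpha>) * (W\<^sup>2 - 1) = (W - of_real (- b))\<^sup>2 * (W - of_real c)"
   and crit4: "W * (W\<^sup>2 - of_real \<kappa>) - of_real (- \<beta>) * (W\<^sup>2 - 1) = (W - of_real (- B))\<^sup>2 * (W - of_real C)"
   for W :: complex
    using critical_factor[of b \<alpha> c W] critical_factor[of B \<beta> C W] critical_factor_neg[of b \<alpha> c W] critical_factor_neg[of B \<beta> C W]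
    by simp_all
  have nn: "b \<noteq> - c" "B \<noteq> - C" "- b \<noteq> c" "- B \<noteq> C" using order_points b B by auto
  note cf = critical_fibre[OF crit1 nn(1), folded P_def] critical_fibre[OF crit2 nn(2), folded P_def]
    critical_fibre[OF crit3 nn(3), folded P_def] critical_fibre[OF crit4 nn(4), folded P_def]
  show ?thesis
    unfolding admissible_def
  proof (intro conjI)
    show "\<forall>t\<in>{-1..1}. deriv (rat_fun R) t \<noteq> 0"
      using DERIV_imp_deriv[OF rat_fun_derivative(1)] rat_fun_derivative(2) by (metis less_irrefl)
    show "\<exists>a b c :: nat \<Rightarrow> real option.
        inj_on a {1..4} \<and>
        critical_values R = cpoint ` a ` {1..4} \<and>
        (\<forall>s\<in>{1..4}.
           a s \<noteq> Some 1 \<and> a s \<noteq> Some (-1) \<and>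
           fibre R (cpoint (a s)) = {cpoint (b s), cpoint (c s)} \<and>
           local_degree R (cpoint (b s)) = 2 \<and>
           local_degree R (cpoint (c s)) = 1) \<and>
        cyclic (a 1) (a 2) (a 3) \<and> cyclic (a 1) (a 3) (a 4) \<and>
        (\<forall>y \<in> open_arc (a 1) (a 2) \<union> open_arc (a 3) (a 4).
           \<exists>x w. Im w \<noteq> 0 \<and> fibre R (cpoint y) = {cpoint x, Some w, Some (cnj w)}) \<and>
        (\<forall>y. y \<notin> open_arc (a 1) (a 2) \<union> open_arc (a 3) (a 4) \<and> y \<notin> a ` {1..4} \<longrightarrow>
           (\<exists>X :: real option set. card X = 3 \<and> fibre R (cpoint y) = cpoint ` X)) \<and>
        (\<exists>I \<in> {open_arc (b 2) (b 3), open_arc (b 3) (b 2)}.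
           cpoint ` I \<inter> critical_points R = {} \<and> unit_segment \<subseteq> I)"
    proof (rule exI[of _ a], rule exI[of _ bb], rule exI[of _ cc], intro conjI)
      have dist: "- \<beta> / P < - \<alpha> / P" "- \<alpha> / P < \<alpha> / P" "\<alpha> / P < \<beta> / P"
        using A by auto
      show "inj_on a {1..4}" unfolding set4 inj_on_def using dist by (auto simp: as)
      show "critical_values R = cpoint ` a ` {1..4}"
        unfolding critical_values_R set4 P_def[symmetric] by (simp add: as)
      show "\<forall>s\<in>{1..4}. a s \<noteq> Some 1 \<and> a s \<noteq> Some (-1) \<and>
           fibre R (cpoint (a s)) = {cpoint (bb s), cpoint (cc s)} \<and>
           local_degree R (cpoint (bb s)) = 2 \<and> local_degree R (cpoint (cc s)) = 1"
        unfolding set4 using A cf by (auto simp: a_def bb_def cc_def)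
      show "cyclic (a 1) (a 2) (a 3)" "cyclic (a 1) (a 3) (a 4)"
        using dist by (auto simp: cyclic_def as)
      show "\<forall>y \<in> open_arc (a 1) (a 2) \<union> open_arc (a 3) (a 4).
           \<exists>x w. Im w \<noteq> 0 \<and> fibre R (cpoint y) = {cpoint x, Some w, Some (cnj w)}"
      proof
        fix y assume y: "y \<in> open_arc (a 1) (a 2) \<union> open_arc (a 3) (a 4)"
        then obtain y' where y': "y = Some y'" unfolding arcs by auto
        obtain x w where xw: "Im w \<noteq> 0" "Z (y' * r e) = {complex_of_real x, w, cnj w}"
          using fibre_middle[of "y' * P"] y arcs_iff[of y'] unfolding y' P_def by auto
        show "\<exists>x w. Im w \<noteq> 0 \<and> fibre R (cpoint y) = {cpoint x, Some w, Some (cnj w)}"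
          using xw e by (intro exI[of _ "Some (x / e)"] exI[of _ "w / of_real e"]) (simp add: y' fibre_Some)
      qed
      show "\<forall>y. y \<notin> open_arc (a 1) (a 2) \<union> open_arc (a 3) (a 4) \<and> y \<notin> a ` {1..4} \<longrightarrow>
           (\<exists>X :: real option set. card X = 3 \<and> fibre R (cpoint y) = cpoint ` X)"
      proof (intro allI impI)
        fix y assume y: "y \<notin> open_arc (a 1) (a 2) \<union> open_arc (a 3) (a 4) \<and> y \<notin> a ` {1..4}"
        show "\<exists>X :: real option set. card X = 3 \<and> fibre R (cpoint y) = cpoint ` X"
        proof (cases y)
          case None
          \<comment> \<open>The value infinity belongs to the complementary arc and has the three
            real preimages infinity and \<plusminus>1/e.\<close>
          have "card {None, Some (1 / e), Some (- 1 / e)} = 3" using e by auto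
          then show ?thesis using None fibre_None by (intro exI[of _ "{None, Some (1 / e), Some (- 1 / e)}"]) simp
        next
          case (Some y')
          have n1: "\<not> (\<alpha> < \<bar>y' * P\<bar> \<and> \<bar>y' * P\<bar> < \<beta>)" using y arcs_iff[of y'] unfolding Some by blast
          have n2: "\<bar>y' * P\<bar> \<noteq> \<alpha>" "\<bar>y' * P\<bar> \<noteq> \<beta>"
            using y P unfolding Some set4 by (auto simp: as abs_if field_simps split: if_splits)
          have "\<bar>y' * P\<bar> < \<alpha> \<or> \<beta> < \<bar>y' * P\<bar>" using n1 n2 by linarith
          then have "\<exists>X. card X = 3 \<and> Z (y' * r e) = complex_of_real ` X"
            using fibre_inner[of "y' * P"] fibre_outer[of "y' * P"] unfolding P_def by blast
          then show ?thesis using fibre_three_real[of y'] unfolding Some by simp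
        qed
      qed
      show "\<exists>I \<in> {open_arc (bb 2) (bb 3), open_arc (bb 3) (bb 2)}.
           cpoint ` I \<inter> critical_points R = {} \<and> unit_segment \<subseteq> I"
      proof (rule bexI[of _ "open_arc (bb 2) (bb 3)"], intro conjI)
        \<comment> \<open>The arc between the inner critical points through 0; it contains the
          segment because \<open>e < b\<close>.\<close>
        have I: "open_arc (bb 2) (bb 3) = Some ` {- b / e<..<b / e}"
          unfolding bb_def using b e by (auto intro!: open_arc_Some simp: divide_strict_right_mono)
        have "\<not> (- b / e < x / e \<and> x / e < b / e)" if "x \<in> {b, - b, B, - B}" for x
          using that b B e by (auto simp: divide_less_cancel)
        then show "cpoint ` open_arc (bb 2) (bb 3) \<inter> critical_points R = {}"
        proof -
          have "Some ` {- b / e<..<b / e} \<inter> (\<lambda>x. Some (x / e)) ` {b, - b, B, - B} = {}"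
            using \<open>\<And>x. x \<in> {b, - b, B, - B} \<Longrightarrow> \<not> (- b / e < x / e \<and> x / e < b / e)\<close>
            unfolding disjoint_iff image_iff by fastforce
          moreover have "inj cpoint" by (intro option.inj_map injI) simp
          ultimately show ?thesis unfolding I critical_points_R by (simp only: image_Int[symmetric] image_empty)
        qed
        have "1 < b / e" using e by (simp add: less_divide_eq)
        then show "unit_segment \<subseteq> open_arc (bb 2) (bb 3)"
          unfolding I unit_segment_def by auto
      qed simp
    qed
  qed (rule rat_degree_R segment_image)+
qed

end

section \<open>Gauge inequivalence\<close>

text \<open>An explicit formula in the coefficients, in place of \<open>rat_map\<close>, which
  passes through numerator and denominator in lowest terms.\<close>

definition mobius :: "real \<Rightarrow> real \<Rightarrow> real \<Rightarrow> real \<Rightarrow> complex option \<Rightarrow> complex option" where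
  "mobius a b c d z = (case z of
      None \<Rightarrow> if c = 0 then None else Some (of_real (a / c))
    | Some w \<Rightarrow> if of_real c * w + of_real d = 0 then None
        else Some ((of_real a * w + of_real b) / (of_real c * w + of_real d)))"

lemma rat_map_linear_monic:
  assumes det: "a * d - b * c \<noteq> 0" and monic: "lead_coeff [:d, c:] = 1"
  shows "rat_map (Fract [:b, a:] [:d, c:]) = mobius a b c d"
proof -
  have cop: "coprime [:b, a:] [:d, c:]"
  proof (rule coprimeI)
    fix q assume "q dvd [:b, a:]" "q dvd [:d, c:]"
    then have "q dvd [:a:] * [:d, c:] - [:c:] * [:b, a:]" by (intro dvd_diff dvd_mult)
    also have "[:a:] * [:d, c:] - [:c:] * [:b, a:] = [:a * d - b * c:]" by (simp add: mult.commute)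
    finally have "q dvd [:a * d - b * c:]" .
    moreover have "[:a * d - b * c:] dvd 1" using det by (simp add: is_unit_const_poly_iff dvd_field_iff)
    ultimately show "is_unit q" by (rule dvd_trans)
  qed
  note nd = numer_denom_Fract[OF cop monic]
  show ?thesis
  proof
    fix z
    show "rat_map (Fract [:b, a:] [:d, c:]) z = mobius a b c d z"
    proof (cases z)
      case (Some w)
      then show ?thesis
        by (simp add: rat_map_def nd mobius_def map_poly_pCons add.commute mult.commute)
    next
      case None
      show ?thesis
      proof (cases "c = 0")
        case True
        then have "a \<noteq> 0" using det by auto
        then show ?thesis unfolding None rat_map_def nd mobius_def using True by simp
      next
        case False
        then show ?thesis unfolding None rat_map_def nd mobius_def by simp
      qed
    qed
  qed
qed

lemma linear_fractional_mobius:
  assumes "linear_fractional L"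
  obtains a b c d where "a * d - b * c \<noteq> 0" "rat_map L = mobius a b c d"
proof -
  obtain a b c d where det: "a * d - b * c \<noteq> 0" and L: "L = Fract [:b, a:] [:d, c:]"
    using assms unfolding linear_fractional_def by blast
  define k where "k = lead_coeff [:d, c:]"
  have q0: "[:d, c:] \<noteq> 0" using det by auto
  then have k: "k \<noteq> 0" unfolding k_def by (metis leading_coeff_0_iff)
  have "Fract [:b, a:] [:d, c:] = Fract [:b / k, a / k:] [:d / k, c / k:]"
  proof -
    have "[:b, a:] = smult k [:b / k, a / k:]" "[:d, c:] = smult k [:d / k, c / k:]" using k by simp_all
    moreover have "[:d / k, c / k:] \<noteq> 0" using q0 k by auto
    ultimately show ?thesis using q0 by (simp add: eq_fract mult.commute)
  qed
  moreover have "(a / k) * (d / k) - (b / k) * (c / k) \<noteq> 0"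
    using det k by (simp add: diff_divide_distrib[symmetric])
  moreover have "lead_coeff [:d / k, c / k:] = 1"
    using k by (cases "c = 0") (auto simp: k_def)
  ultimately show ?thesis using that rat_map_linear_monic L by metis
qed

lemma mobius_inverse:
  assumes det: "a * d - b * c \<noteq> 0"
  shows "mobius d (- b) (- c) a (mobius a b c d z) = z"
proof -
  define A B C D where "A = complex_of_real a" and "B = complex_of_real b" and "C = complex_of_real c" and "D = complex_of_real d"
  have D0: "A * D - B * C \<noteq> 0"
    using det unfolding A_def B_def C_def D_def by (metis of_real_diff of_real_eq_0_iff of_real_mult)
  have z0: "c = 0 \<longleftrightarrow> C = 0" by (simp add: C_def)
  show ?thesis
  proof (cases z)
    case None
    show ?thesis
    proof (cases "c = 0")
      case True
      then show ?thesis using None by (simp add: mobius_def)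
    next
      case False
      then show ?thesis using None by (simp add: mobius_def)
    qed
  next
    case (Some w)
    show ?thesis
    proof (cases "C * w + D = 0")
      case True
      have "C \<noteq> 0"
      proof
        assume "C = 0"
        then have "D = 0" using True by simp
        then show False using \<open>C = 0\<close> D0 by simp
      qed
      then have "w = - D / C" using True by (simp add: field_simps eq_neg_iff_add_eq_0)
      then show ?thesis using True Some \<open>C \<noteq> 0\<close> by (simp add: mobius_def C_def D_def)
    next
      case False
      define v where "v = (A * w + B) / (C * w + D)"
      have 1: "- C * v + A = (A * D - B * C) / (C * w + D)"
        using False by (simp add: v_def field_simps)
      have 2: "D * v + - B = (A * D - B * C) * w / (C * w + D)"
        using False by (simp add: v_def field_simps)
      have "(D * v + - B) / (- C * v + A) = w" unfolding 1 2 using D0 False by simp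
      moreover have "- C * v + A \<noteq> 0" unfolding 1 using D0 False by simp
      moreover have "mobius a b c d z = Some v" using False Some by (simp add: mobius_def v_def A_def B_def C_def D_def)
      ultimately show ?thesis using Some by (simp add: mobius_def A_def B_def C_def D_def)
    qed
  qed
qed

lemma bij_mobius:
  assumes det: "a * d - b * c \<noteq> 0"
  shows "bij (mobius a b c d)"
proof (rule o_bij)
  show "mobius d (- b) (- c) a \<circ> mobius a b c d = id" using mobius_inverse[OF det] by (simp add: fun_eq_iff)
  have "d * a - (- b) * (- c) \<noteq> 0" using det by (simp add: mult.commute)
  from mobius_inverse[OF this] show "mobius a b c d \<circ> mobius d (- b) (- c) a = id" by (simp add: fun_eq_iff)
qed

lemma mobius_real: "c * x + d \<noteq> 0 \<Longrightarrow> mobius a b c d (Some (of_real x)) = Some (of_real ((a * x + b) / (c * x + d)))"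
  by (simp add: mobius_def) (metis of_real_add of_real_eq_0_iff of_real_mult)

text \<open>Without a pole on the segment the map is monotone there and so permutes the endpoints.
  The two endpoint equations then determine \<open>a\<close> and \<open>b\<close> from
  \<open>c\<close> and \<open>d\<close> up to a common sign.\<close>

lemma segment_mobius:
  assumes det: "a * d - b * c \<noteq> 0"
    and seg: "mobius a b c d ` cpoint ` unit_segment = cpoint ` unit_segment"
  obtains \<epsilon> :: real where "\<epsilon> \<in> {1, -1}" "b = \<epsilon> * c" "a = \<epsilon> * d" "\<And>x. x \<in> {-1..1} \<Longrightarrow> c * x + d \<noteq> 0"
proof -
  have nz: "c * x + d \<noteq> 0" if x: "x \<in> {-1..1}" for x
  proof
    assume "c * x + d = 0"
    then have "complex_of_real c * of_real x + of_real d = 0" by (metis of_real_0 of_real_add of_real_mult)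
    then have "mobius a b c d (Some (of_real x)) = None" by (simp add: mobius_def)
    moreover have "Some (of_real x) \<in> cpoint ` unit_segment"
      using imageI[of "Some x" unit_segment cpoint] x by (simp add: unit_segment_def)
    then have "mobius a b c d (Some (of_real x)) \<in> cpoint ` unit_segment"
      by (subst seg[symmetric]) (rule imageI)
    ultimately show False by (auto simp: unit_segment_def)
  qed
  define h where "h x = (a * x + b) / (c * x + d)" for x
  have im: "h ` {-1..1} = {-1..1}"
  proof -
    have "mobius a b c d ` cpoint ` unit_segment = (\<lambda>x. Some (complex_of_real (h x))) ` {-1..1}"
      unfolding unit_segment_def image_image using nz by (intro image_cong) (auto simp: mobius_real h_def)
    then have "(\<lambda>y. Some (complex_of_real y)) ` h ` {-1..1} = (\<lambda>y. Some (complex_of_real y)) ` {-1..1}"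
      using seg by (simp add: unit_segment_def image_image)
    moreover have "inj (\<lambda>y. Some (complex_of_real y))" by (simp add: inj_on_def)
    ultimately show ?thesis by (simp add: inj_image_eq_iff)
  qed
  \<comment> \<open>The denominator keeps its sign because
    \<open>\<bar>c\<bar> < \<bar>d\<bar>\<close>: otherwise its zero \<open>- d / c\<close> would
    lie in the segment.\<close>
  have sgn: "0 < (c * x + d) * (c * y + d)" if "x \<in> {-1..1}" "y \<in> {-1..1}" for x y
  proof -
    have d0: "d \<noteq> 0" using nz[of 0] by simp
    have cd: "\<bar>c\<bar> < \<bar>d\<bar>"
    proof (rule ccontr)
      assume "\<not> \<bar>c\<bar> < \<bar>d\<bar>"
      then have "c \<noteq> 0" "\<bar>- d / c\<bar> \<le> 1" using d0 by (auto simp: divide_le_eq)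
      then have "- d / c \<in> {-1..1}" unfolding atLeastAtMost_iff by linarith
      from nz[OF this] show False using \<open>c \<noteq> 0\<close> by simp
    qed
    have one: "0 < d * (c * x + d)" if x: "x \<in> {-1..1}" for x
    proof -
      have "\<bar>d * c * x\<bar> \<le> \<bar>d\<bar> * \<bar>c\<bar> * 1" unfolding abs_mult using x by (intro mult_left_mono) auto
      also have "\<dots> < \<bar>d\<bar> * \<bar>d\<bar>"
        unfolding mult_1_right using cd d0 by (intro mult_strict_left_mono) auto
      also have "\<dots> = d * d" by simp
      finally have "0 < d * d + d * c * x" by linarith
      then show ?thesis by (simp add: algebra_simps)
    qed
    have "0 < (d * (c * x + d)) * (d * (c * y + d))" by (rule mult_pos_pos[OF one[OF that(1)] one[OF that(2)]])
    then have "0 < (d * d) * ((c * x + d) * (c * y + d))" by (simp only: mult_ac)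
    moreover have "0 < d * d" unfolding zero_less_mult_iff using d0 by linarith
    ultimately show ?thesis by (rule zero_less_mult_pos)
  qed
  have diff: "h x - h y = (a * d - b * c) * (x - y) / ((c * x + d) * (c * y + d))" if "x \<in> {-1..1}" "y \<in> {-1..1}" for x y
    using nz[OF that(1)] nz[OF that(2)] by (simp add: h_def field_simps)
  have "1 \<in> h ` {-1..1}" "-1 \<in> h ` {-1..1}" unfolding im by auto
  then obtain x1 x2 where x12: "x1 \<in> {-1..1}" "h x1 = 1" "x2 \<in> {-1..1}" "h x2 = -1" by (metis imageE)
  have hI: "h 1 \<in> {-1..1}" "h (-1) \<in> {-1..1}" using im by auto
  have "\<exists>\<epsilon>\<in>{1, -1}. h 1 = \<epsilon> \<and> h (-1) = - \<epsilon>"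
  proof (cases "0 < a * d - b * c")
    case True
    have "0 \<le> h 1 - h x1" using diff[of 1 x1] sgn[of 1 x1] x12 True by auto
    moreover have "0 \<le> h x2 - h (-1)" using diff[of x2 "-1"] sgn[of x2 "-1"] x12 True by auto
    ultimately show ?thesis using x12 hI by auto
  next
    case False
    then have neg: "a * d - b * c < 0" using det by simp
    have "0 \<le> h (-1) - h x1" using diff[of "-1" x1] sgn[of "-1" x1] x12 neg
      by (simp add: mult_nonpos_nonpos)
    moreover have "0 \<le> h x2 - h 1" using diff[of x2 1] sgn[of x2 1] x12 neg
      by (simp add: mult_nonpos_nonpos)
    ultimately show ?thesis using x12 hI by (intro bexI[of _ "-1"]) auto
  qed
  then obtain \<epsilon> where \<epsilon>: "\<epsilon> \<in> {1, -1}" "h 1 = \<epsilon>" "h (-1) = - \<epsilon>" by blast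
  have 1: "a + b = \<epsilon> * (c + d)" using \<epsilon>(2) nz[of 1] by (simp add: h_def field_simps)
  have 2: "b - a = - \<epsilon> * (d - c)" using \<epsilon>(3) nz[of "-1"] by (simp add: h_def field_simps)
  have "b = \<epsilon> * c" "a = \<epsilon> * d" using 1 2 by (auto simp: algebra_simps)
  then show ?thesis using that \<epsilon>(1) nz by blast
qed

text \<open>In the coordinate \<open>m y = (y - 1) / (y + 1)\<close> the maps fixing \<open>1\<close> and \<open>-1\<close> are
  multiplications, and \<open>m (- y) = 1 / m y\<close>; so the product of \<open>m\<close> over a symmetric set is 1,
  which forces the multiplier to be a root of unity.\<close>

lemma symmetric_quadruple_rigid:
  fixes p q p' q' c d :: real
  assumes pq: "1 < p" "p < q" and pq': "1 < p'" "p' < q'"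
    and det: "d\<^sup>2 \<noteq> c\<^sup>2" "d \<noteq> 0"
    and im: "(\<lambda>y. (d * y + c) / (c * y + d)) ` {p, - p, q, - q} = {p', - p', q', - q'}"
    and fin: "\<And>y. y \<in> {p, - p, q, - q} \<Longrightarrow> c * y + d \<noteq> 0"
  shows "p = p' \<and> q = q'"
proof -
  define m where "m y = (y - 1) / (y + 1)" for y :: real
  define h where "h y = (d * y + c) / (c * y + d)" for y
  \<comment> \<open>The multiplier of \<open>h\<close> in the coordinate \<open>m\<close>; it is
    finite and nonzero since \<open>d\<^sup>2 \<noteq> c\<^sup>2\<close>.\<close>
  define k where "k = (d - c) / (d + c)"
  have dc: "d - c \<noteq> 0" "d + c \<noteq> 0" using det(1) by (auto simp: power2_eq_square square_eq_iff eq_neg_iff_add_eq_0)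
  have prod: "m x * m (- x) * m y * m (- y) = 1" if "1 < x" "1 < y" for x y :: real
  proof -
    have "m x * m (- x) = 1" if "1 < x" for x :: real
    proof -
      have "x - 1 \<noteq> 0" "x + 1 \<noteq> 0" "1 - x \<noteq> 0" using that by auto
      then show ?thesis by (simp add: m_def divide_simps) (simp add: algebra_simps)
    qed
    then show ?thesis using that by simp
  qed
  have mh: "m (h y) = k * m y" if y: "y \<in> {p, - p, q, - q}" for y
  proof -
    have n: "c * y + d \<noteq> 0" by (rule fin[OF y])
    have "h y - 1 = (d - c) * (y - 1) / (c * y + d)" "h y + 1 = (d + c) * (y + 1) / (c * y + d)"
      using n by (auto simp: h_def field_simps)
    then show ?thesis using n by (simp add: m_def k_def)
  qed
  have card4: "card {x, - x, y, - y} = 4" if "1 < x" "x < y" for x y :: real using that by auto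
  have inj: "inj_on h {p, - p, q, - q}"
  proof (rule eq_card_imp_inj_on)
    show "card (h ` {p, - p, q, - q}) = card {p, - p, q, - q}"
      using im card4[OF pq] card4[OF pq'] by (simp add: h_def[abs_def])
  qed simp
  have "(\<Prod>y\<in>{p', - p', q', - q'}. m y) = (\<Prod>y\<in>{p, - p, q, - q}. m (h y))"
    unfolding im[symmetric, folded h_def] by (rule prod.reindex[OF inj, unfolded o_def])
  also have "\<dots> = (\<Prod>y\<in>{p, - p, q, - q}. k * m y)" by (intro prod.cong refl mh)
  also have "\<dots> = k ^ 4 * (m p * m (- p) * m q * m (- q))"
    using pq by (simp add: power4_eq_xxxx mult_ac)
  also have "\<dots> = k ^ 4" using prod[of p q] pq by simp
  also have "(\<Prod>y\<in>{p', - p', q', - q'}. m y) = m p' * m (- p') * m q' * m (- q')"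
    using pq' by (simp add: mult_ac)
  also have "\<dots> = 1" using prod[of p' q'] pq' by simp
  finally have "k ^ 4 = 1" by simp
  then have "(k\<^sup>2)\<^sup>2 = 1" by (simp add: power2_eq_square power4_eq_xxxx mult.assoc)
  then have "k\<^sup>2 = 1 \<or> k\<^sup>2 = -1" by (simp only: power2_eq_1_iff)
  moreover have "0 \<le> k\<^sup>2" by simp
  ultimately have "k\<^sup>2 = 1" by linarith
  then have "k = 1 \<or> k = -1" by (simp add: power2_eq_1_iff)
  \<comment> \<open>The multiplier -1 would mean \<open>d = 0\<close>, so only the multiplier 1 is
    left and \<open>h\<close> is the identity.\<close>
  then have "c = 0" using dc det(2) by (auto simp: k_def divide_eq_eq)
  then have "h y = y" for y using det(2) by (simp add: h_def)
  then have "{p, - p, q, - q} = {p', - p', q', - q'}" using im unfolding h_def[symmetric] by simp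
  then have "p \<in> {p', - p', q', - q'}" "p' \<in> {p, - p, q, - q}" "q \<in> {p', - p', q', - q'}" by blast+
  then show ?thesis using pq pq' by auto
qed

text \<open>Critical values are recognised as the points with exactly two preimages, a count that
  survives composition with bijections on both sides. The condition on the fibre over infinity
  ensures that no critical value is sent there, so the rigidity lemma can be applied to four finite
  values.\<close>

lemma gauge_equivalent_critical_values:
  assumes gauge: "gauge_equivalent R R'"
    and crit: "\<And>y. card (fibre R (Some (of_real y))) = 2 \<longleftrightarrow> y \<in> {p, - p, q, - q}"
    and crit': "\<And>y. card (fibre R' (Some (of_real y))) = 2 \<longleftrightarrow> y \<in> {p', - p', q', - q'}"
    and inf: "card (fibre R' None) \<noteq> 2"
    and pq: "1 < p" "p < q" and pq': "1 < p'" "p' < q'"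
  shows "p = p' \<and> q = q'"
proof -
  obtain L1 L2 where L: "linear_fractional L1" "linear_fractional L2" "keeps_unit_segment L2"
    "rat_map R' = rat_map L2 \<circ> rat_map R \<circ> rat_map L1"
    using gauge unfolding gauge_equivalent_def by (elim exE conjE) (rule that)
  obtain a1 b1 c1 d1 where L1: "a1 * d1 - b1 * c1 \<noteq> 0" "rat_map L1 = mobius a1 b1 c1 d1"
    by (rule linear_fractional_mobius[OF L(1)])
  obtain a b c d where L2: "a * d - b * c \<noteq> 0" "rat_map L2 = mobius a b c d"
    by (rule linear_fractional_mobius[OF L(2)])
  have bij1: "bij (rat_map L1)" and bij2: "bij (rat_map L2)"
    unfolding L1(2) L2(2) by (rule bij_mobius[OF L1(1)], rule bij_mobius[OF L2(1)])
  have fib: "card (fibre R' (rat_map L2 y)) = card (fibre R y)" for y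
  proof -
    have "fibre R' (rat_map L2 y) = rat_map L1 -` fibre R y"
      unfolding fibre_def L(4) using bij_is_inj[OF bij2] by (auto simp: inj_eq)
    also have "\<dots> = inv (rat_map L1) ` fibre R y" by (rule bij_vimage_eq_inv_image[OF bij1])
    also have "card \<dots> = card (fibre R y)"
      by (rule card_image) (meson bij1 bij_betw_def bij_imp_bij_inv inj_on_subset subset_UNIV)
    finally show ?thesis .
  qed
  obtain \<epsilon> where \<epsilon>: "\<epsilon> \<in> {1, -1}" "b = \<epsilon> * c" "a = \<epsilon> * d" "\<And>x. x \<in> {-1..1} \<Longrightarrow> c * x + d \<noteq> 0"
    using segment_mobius[OF L2(1)] L(3) unfolding keeps_unit_segment_def L2(2) by blast
  have fin: "c * y + d \<noteq> 0" if y: "y \<in> {p, - p, q, - q}" for y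
  proof
    assume "c * y + d = 0"
    then have "complex_of_real c * of_real y + of_real d = 0" by (metis of_real_0 of_real_add of_real_mult)
    then have "rat_map L2 (Some (of_real y)) = None" by (simp add: L2(2) mobius_def)
    then show False using fib[of "Some (of_real y)"] crit[of y] y inf by simp
  qed
  define h where "h y = (d * y + c) / (c * y + d)" for y
  have val: "rat_map L2 (Some (of_real y)) = Some (of_real (\<epsilon> * h y))" if y: "y \<in> {p, - p, q, - q}" for y
  proof -
    have "(a * y + b) / (c * y + d) = \<epsilon> * h y" unfolding \<epsilon>(2,3) h_def by (simp add: algebra_simps)
    then show ?thesis unfolding L2(2) using mobius_real[OF fin[OF y], of a b] by simp
  qed
  have sub: "h y \<in> {p', - p', q', - q'}" if y: "y \<in> {p, - p, q, - q}" for y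
  proof -
    have "card (fibre R' (Some (of_real (\<epsilon> * h y)))) = 2"
      using fib[of "Some (of_real y)"] crit[of y] y val[OF y] by simp
    then have "\<epsilon> * h y \<in> {p', - p', q', - q'}" by (simp only: crit')
    \<comment> \<open>The sign \<epsilon> is absorbed by the symmetry of the target set.\<close>
    then show ?thesis using \<epsilon>(1) by (auto simp: minus_equation_iff)
  qed
  have d0: "d \<noteq> 0" using \<epsilon>(4)[of 0] by simp
  have dc: "d\<^sup>2 \<noteq> c\<^sup>2" using L2(1) \<epsilon>(1) unfolding \<epsilon>(2,3) by (auto simp: power2_eq_square)
  have inj: "inj_on h {p, - p, q, - q}"
  proof (rule inj_onI)
    fix x y assume xy: "x \<in> {p, - p, q, - q}" "y \<in> {p, - p, q, - q}" "h x = h y"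
    then have "rat_map L2 (Some (of_real x)) = rat_map L2 (Some (of_real y))" using val by simp
    then show "x = y" using bij_is_inj[OF bij2] by (simp add: inj_eq)
  qed
  have "h ` {p, - p, q, - q} = {p', - p', q', - q'}"
  proof (rule card_subset_eq)
    show "h ` {p, - p, q, - q} \<subseteq> {p', - p', q', - q'}" using sub by blast
    have "card (h ` {p, - p, q, - q}) = card {p, - p, q, - q}" by (rule card_image[OF inj])
    also have "\<dots> = card {p', - p', q', - q'}" using pq pq' by simp
    finally show "card (h ` {p, - p, q, - q}) = card {p', - p', q', - q'}" .
  qed simp
  then show ?thesis
    by (intro symmetric_quadruple_rigid[OF pq pq' dc d0 _ fin]) (simp_all add: h_def[abs_def])
qed

section \<open>Critical values along the family and their dependence on b\<close>

context scaled_cubic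
begin

lemma card_fibre_R:
  "card (fibre R (Some (of_real y))) = 2 \<longleftrightarrow> y \<in> {\<alpha> / r e, - (\<alpha> / r e), \<beta> / r e, - (\<beta> / r e)}"
proof -
  have P: "0 < r e" by (rule re)
  have crd: "card (fibre R (Some (of_real y))) = card (Z (y * r e))"
    unfolding fibre_Some using e by (intro card_image) (simp add: inj_on_def)
  have mem: "y \<in> {\<alpha> / r e, - (\<alpha> / r e), \<beta> / r e, - (\<beta> / r e)} \<longleftrightarrow> \<bar>y * r e\<bar> \<in> {\<alpha>, \<beta>}"
  proof -
    have "y = t / r e \<longleftrightarrow> y * r e = t" for t using P by (simp add: eq_divide_eq)
    from this[of \<alpha>] this[of "- \<alpha>"] this[of \<beta>] this[of "- \<beta>"]
    have "y \<in> {\<alpha> / r e, - (\<alpha> / r e), \<beta> / r e, - (\<beta> / r e)} \<longleftrightarrow>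
        y * r e = \<alpha> \<or> y * r e = - \<alpha> \<or> y * r e = \<beta> \<or> y * r e = - \<beta>"
      by simp
    moreover have "0 \<le> \<alpha>" "0 \<le> \<beta>" using \<alpha>\<beta> by linarith+
    then have "\<bar>y * r e\<bar> \<in> {\<alpha>, \<beta>} \<longleftrightarrow>
        y * r e = \<alpha> \<or> y * r e = - \<alpha> \<or> y * r e = \<beta> \<or> y * r e = - \<beta>"
      unfolding insert_iff empty_iff abs_eq_iff' by blast
    ultimately show ?thesis by blast
  qed
  have in_b: "(b, \<alpha>, c) \<in> {(b, \<alpha>, c), (B, \<beta>, C)}" "(B, \<beta>, C) \<in> {(b, \<alpha>, c), (B, \<beta>, C)}" by auto
  have nn: "complex_of_real b \<noteq> - of_real c" "complex_of_real B \<noteq> - of_real C"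
  proof -
    have "b \<noteq> - c" "B \<noteq> - C" using order_points b B by auto
    then show "complex_of_real b \<noteq> - of_real c" "complex_of_real B \<noteq> - of_real C"
      by (metis of_real_eq_iff of_real_minus)+
  qed
  consider "\<bar>y * r e\<bar> < \<alpha>" | "\<bar>y * r e\<bar> = \<alpha>" | "\<alpha> < \<bar>y * r e\<bar>" "\<bar>y * r e\<bar> < \<beta>" | "\<bar>y * r e\<bar> = \<beta>" | "\<beta> < \<bar>y * r e\<bar>"
    by linarith
  then show ?thesis
  proof cases
    case 1
    then obtain X where "card X = 3" "Z (y * r e) = complex_of_real ` X" using fibre_inner by blast
    then have "card (Z (y * r e)) = 3" by (simp add: card_image inj_on_def)
    then show ?thesis unfolding crd mem using 1 \<alpha>\<beta> by auto
  next
    case 2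
    then have "y * r e = \<alpha> \<or> y * r e = - \<alpha>" by linarith
    then have "card (Z (y * r e)) = 2"
      using fibre_critical[OF in_b(1)] nn(1) by (elim disjE) (simp_all add: neg_equal_iff_equal minus_equation_iff)
    then show ?thesis unfolding crd mem using 2 by auto
  next
    case 3
    then obtain x w where xw: "Im w \<noteq> 0" "Z (y * r e) = {complex_of_real x, w, cnj w}" using fibre_middle by blast
    have "complex_of_real x \<noteq> w" "complex_of_real x \<noteq> cnj w" "w \<noteq> cnj w" using xw(1) by (auto simp: complex_eq_iff)
    then have "card (Z (y * r e)) = 3" unfolding xw(2) by auto
    then show ?thesis unfolding crd mem using 3 by auto
  next
    case 4
    then have "y * r e = \<beta> \<or> y * r e = - \<beta>" by linarith
    then have "card (Z (y * r e)) = 2"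
      using fibre_critical[OF in_b(2)] nn(2) by (elim disjE) (simp_all add: neg_equal_iff_equal minus_equation_iff)
    then show ?thesis unfolding crd mem using 4 by auto
  next
    case 5
    then obtain X where "card X = 3" "Z (y * r e) = complex_of_real ` X" using fibre_outer by blast
    then have "card (Z (y * r e)) = 3" by (simp add: card_image inj_on_def)
    then show ?thesis unfolding crd mem using 5 \<alpha>\<beta> by auto
  qed
qed

lemma card_fibre_None: "card (fibre R None) = 3"
proof -
  have "inj cpoint" by (intro option.inj_map injI) simp
  then have "card (fibre R None) = card {None, Some (1 / e), Some (- 1 / e)}"
    unfolding fibre_None by (intro card_image) (auto intro: inj_on_subset)
  also have "\<dots> = 3" using e by auto
  finally show ?thesis .
qed

lemma critical_values_gt_1: "1 < \<alpha> / r e" "\<alpha> / r e < \<beta> / r e"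
  using re r_less_\<alpha>[OF e] \<alpha>\<beta> by (auto simp: less_divide_eq divide_strict_right_mono)

end

text \<open>The relation between \<open>b\<close> and \<open>B\<close> gives
  \<open>\<alpha> = 2 * b ^ 3 / (1 + b\<^sup>2)\<close> and the same expression in \<open>B\<close>
  for \<beta>. This function increases on the positive axis, while \<open>B\<close> decreases as
  \<open>b\<close> grows.\<close>

lemma cubic_critical_values_mono:
  assumes "cubic b1 B1" "cubic b2 B2" "b1 < b2"
  shows "cubic.\<alpha> b1 B1 < cubic.\<alpha> b2 B2" "cubic.\<beta> b2 B2 < cubic.\<beta> b1 B1"
proof -
  interpret c1: cubic b1 B1 by (rule assms)
  interpret c2: cubic b2 B2 by (rule assms)
  have mono: "x ^ 3 * y / 2 < x' ^ 3 * y' / 2"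
    if "0 < x" "x < x'" "(1 + x\<^sup>2) * y = 4" "(1 + x'\<^sup>2) * y' = 4" for x x' y y' :: real
  proof -
    have p: "0 < 1 + x\<^sup>2" "0 < 1 + x'\<^sup>2" by (simp_all add: add_pos_nonneg)
    have y: "y = 4 / (1 + x\<^sup>2)" "y' = 4 / (1 + x'\<^sup>2)" using that p by (auto simp: eq_divide_eq mult.commute)
    have x2: "x\<^sup>2 < x'\<^sup>2" "x ^ 3 < x' ^ 3" using that by (auto intro!: power_strict_mono)
    have "x ^ 3 * x'\<^sup>2 = x * (x\<^sup>2 * x'\<^sup>2)" "x' ^ 3 * x\<^sup>2 = x' * (x\<^sup>2 * x'\<^sup>2)"
      by (simp_all add: power2_eq_square power3_eq_cube)
    moreover have "x * (x\<^sup>2 * x'\<^sup>2) \<le> x' * (x\<^sup>2 * x'\<^sup>2)" using that by (intro mult_right_mono) auto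
    ultimately have "x ^ 3 * x'\<^sup>2 \<le> x' ^ 3 * x\<^sup>2" by (simp only:)
    then have "x ^ 3 * (1 + x'\<^sup>2) < x' ^ 3 * (1 + x\<^sup>2)"
      unfolding distrib_left mult_1_right using x2(2) by linarith
    then have "x ^ 3 / (1 + x\<^sup>2) < x' ^ 3 / (1 + x'\<^sup>2)" using p by (simp only: pos_divide_less_eq pos_less_divide_eq times_divide_eq_left)
    moreover have "z * (4 / d) / 2 = 2 * (z / d)" for z d :: real by simp
    ultimately show ?thesis unfolding y by (simp only: mult_less_cancel_left_pos zero_less_numeral)
  qed
  show "cubic.\<alpha> b1 B1 < cubic.\<alpha> b2 B2"
    unfolding c1.\<alpha>_def c2.\<alpha>_def using c1.bB c2.bB c1.b assms(3) by (intro mono) auto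
  have "B2 < B1"
  proof (rule ccontr)
    assume "\<not> B2 < B1"
    then have "B1\<^sup>2 \<le> B2\<^sup>2" using c1.B by (intro power_mono) auto
    moreover have "b1\<^sup>2 < b2\<^sup>2" using assms(3) c1.b by (intro power_strict_mono) auto
    ultimately have "(1 + b1\<^sup>2) * (1 + B1\<^sup>2) < (1 + b2\<^sup>2) * (1 + B2\<^sup>2)"
      by (intro mult_less_le_imp_less) (auto intro: add_pos_nonneg)
    then show False using c1.bB c2.bB by simp
  qed
  then show "cubic.\<beta> b2 B2 < cubic.\<beta> b1 B1"
    unfolding c1.\<beta>_def c2.\<beta>_def using c1.bB c2.bB c2.B by (intro mono) (auto simp: mult.commute)
qed

text \<open>Gauge equivalence forces both normalised critical values to agree, so \<alpha> and
  \<beta> would be multiplied by the same factor \<open>k\<close>. Their opposite monotonicity in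
  \<open>b\<close> requires \<open>k\<close> to be both above and below 1.\<close>

lemma gauge_inequivalent_family:
  assumes "scaled_cubic b1 B1 e1" "scaled_cubic b2 B2 e2" "b1 \<noteq> b2"
  shows "\<not> gauge_equivalent (scaled_cubic.R b1 B1 e1) (scaled_cubic.R b2 B2 e2)"
proof
  interpret c1: scaled_cubic b1 B1 e1 by (rule assms)
  interpret c2: scaled_cubic b2 B2 e2 by (rule assms)
  assume g: "gauge_equivalent c1.R c2.R"
  have eq: "c1.\<alpha> / c1.r e1 = c2.\<alpha> / c2.r e2 \<and> c1.\<beta> / c1.r e1 = c2.\<beta> / c2.r e2"
    by (rule gauge_equivalent_critical_values[OF g c1.card_fibre_R c2.card_fibre_R])
       (use c2.card_fibre_None c1.critical_values_gt_1 c2.critical_values_gt_1 in auto)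
  define k where "k = c2.r e2 / c1.r e1"
  have k: "0 < k" unfolding k_def using c1.re c2.re by simp
  have 1: "c2.\<alpha> = k * c1.\<alpha>" "c2.\<beta> = k * c1.\<beta>"
    using eq c1.re c2.re by (auto simp: k_def field_simps)
  have a: "0 < c1.\<alpha>" "0 < c1.\<beta>" using c1.\<alpha>\<beta> by auto
  from assms(3) consider "b1 < b2" | "b2 < b1" by linarith
  then show False
  proof cases
    case 1
    from cubic_critical_values_mono[OF c1.cubic_axioms c2.cubic_axioms 1]
    have "1 < k" "k < 1" unfolding \<open>c2.\<alpha> = k * c1.\<alpha>\<close> \<open>c2.\<beta> = k * c1.\<beta>\<close> using a by auto
    then show False by simp
  next
    case 2
    from cubic_critical_values_mono[OF c2.cubic_axioms c1.cubic_axioms 2]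
    have "k < 1" "1 < k" unfolding \<open>c2.\<alpha> = k * c1.\<alpha>\<close> \<open>c2.\<beta> = k * c1.\<beta>\<close> using a by auto
    then show False by simp
  qed
qed

section \<open>The kernel of the eigenvalue problem\<close>

context cubic
begin

text \<open>The points over \<open>r y\<close> other than \<open>y\<close> are \<open>f y\<close> and \<open>- f (- y)\<close>.\<close>

definition f :: "real \<Rightarrow> real" where "f y = (sqrt (disc y) - (1 - \<kappa>) * y) / (2 * (1 - y\<^sup>2))"

text \<open>The derivative of \<open>f\<close> as implicit differentiation of
  \<open>f_relation\<close> gives it; the square root of \<open>disc\<close> is the coefficient of
  the unknown derivative.\<close>

definition fd :: "real \<Rightarrow> real" where
  "fd y = - (2 * y * (1 - (f y)\<^sup>2) + (1 - \<kappa>) * f y) / sqrt (disc y)"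

lemma range_facts:
  assumes "\<bar>y\<bar> < c"
  shows "y\<^sup>2 < 1" "0 < disc y"
proof -
  have "y\<^sup>2 < c\<^sup>2" using assms by (metis abs_ge_zero power2_abs power_strict_mono zero_less_numeral)
  moreover have "c\<^sup>2 < C\<^sup>2" "c\<^sup>2 < 1" using order_points by (auto intro!: power_strict_mono simp: abs_square_less_1)
  ultimately show "y\<^sup>2 < 1" "0 < disc y" unfolding disc_factor by (auto intro!: mult_neg_neg mult_pos_neg)
qed

lemma f_root: "\<bar>y\<bar> < c \<Longrightarrow> 2 * (1 - y\<^sup>2) * f y + (1 - \<kappa>) * y = sqrt (disc y)"
  using range_facts[of y] by (simp add: f_def)

lemma f_relation:
  assumes "\<bar>y\<bar> < c"
  shows "y\<^sup>2 + (f y)\<^sup>2 - y\<^sup>2 * (f y)\<^sup>2 + (1 - \<kappa>) * y * f y = \<kappa>"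
proof -
  note R = range_facts[OF assms]
  have "(2 * (1 - y\<^sup>2) * f y + (1 - \<kappa>) * y)\<^sup>2 = disc y" unfolding f_root[OF assms] using R by simp
  then have "4 * (1 - y\<^sup>2) * (y\<^sup>2 + (f y)\<^sup>2 - y\<^sup>2 * (f y)\<^sup>2 + (1 - \<kappa>) * y * f y - \<kappa>) = 0"
    unfolding disc_def by (simp add: algebra_simps power2_eq_square)
  then show ?thesis using R by simp
qed

text \<open>The quadratic with roots \<open>g < f y\<close> and positive leading coefficient is
  negative at \<open>b\<close>, which places \<open>b\<close> between the roots. It is positive at
  1, and 1 lies above \<open>g\<close>, so 1 lies above \<open>f y\<close>.\<close>

lemma f_bounds:
  assumes "\<bar>y\<bar> < b"
  shows "b < f y" "f y < 1"
proof -
  have yc: "\<bar>y\<bar> < c" using assms order_points by simp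
  note R = range_facts[OF yc]
  define g where "g = (- sqrt (disc y) - (1 - \<kappa>) * y) / (2 * (1 - y\<^sup>2))"
  have gf: "g < f y" unfolding g_def f_def using R by (intro divide_strict_right_mono) auto
  have fac: "(1 - y\<^sup>2) * t\<^sup>2 + (1 - \<kappa>) * y * t - (\<kappa> - y\<^sup>2) = (1 - y\<^sup>2) * (t - f y) * (t - g)" for t
  proof -
    have n: "1 - y\<^sup>2 \<noteq> 0" using R by simp
    have gen: "m \<noteq> 0 \<Longrightarrow> m * ((- 2 * a) / (2 * m)) = - a" for m a :: real by simp
    have "f y + g = (- 2 * ((1 - \<kappa>) * y)) / (2 * (1 - y\<^sup>2))" by (simp add: f_def g_def add_divide_distrib[symmetric])
    then have s: "(1 - y\<^sup>2) * (f y + g) = - ((1 - \<kappa>) * y)" using gen[OF n, of "(1 - \<kappa>) * y"] by simp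
    have "f y * g = ((1 - \<kappa>) * y - sqrt (disc y)) * ((1 - \<kappa>) * y + sqrt (disc y)) / (4 * (1 - y\<^sup>2)\<^sup>2)"
      by (simp add: f_def g_def power2_eq_square algebra_simps)
    also have "((1 - \<kappa>) * y - sqrt (disc y)) * ((1 - \<kappa>) * y + sqrt (disc y)) = ((1 - \<kappa>) * y)\<^sup>2 - disc y"
      using R by (simp add: algebra_simps power2_eq_square)
    also have "\<dots> = - (4 * (1 - y\<^sup>2) * (\<kappa> - y\<^sup>2))" by (simp add: disc_def power_mult_distrib)
    finally have p: "(1 - y\<^sup>2) * (f y * g) = - (\<kappa> - y\<^sup>2)" using n by (simp add: power2_eq_square)
    have "(1 - y\<^sup>2) * (t - f y) * (t - g) = (1 - y\<^sup>2) * t\<^sup>2 - (1 - y\<^sup>2) * (f y + g) * t + (1 - y\<^sup>2) * (f y * g)"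
      by (simp add: algebra_simps power2_eq_square)
    then show ?thesis unfolding s p by (simp add: algebra_simps)
  qed
  have "(1 - y\<^sup>2) * b\<^sup>2 + (1 - \<kappa>) * y * b - (\<kappa> - y\<^sup>2) = (1 - b\<^sup>2) * (y - b) * (y + c)"
  proof -
    have b4: "b\<^sup>2 + B\<^sup>2 + b\<^sup>2 * B\<^sup>2 = 3" using bB by (simp add: algebra_simps)
    have "b * (b\<^sup>2 + B\<^sup>2 + b\<^sup>2 * B\<^sup>2) = b * 3" unfolding b4 by simp
    then have e1: "(1 - b\<^sup>2) * (c - b) = (1 - \<kappa>) * b"
      unfolding c_def \<kappa>_def by (simp add: field_simps power2_eq_square)
    have "2 * ((1 - b\<^sup>2) * (b * c)) = b\<^sup>2 * (1 + B\<^sup>2 - b\<^sup>2 - b\<^sup>2 * B\<^sup>2)"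
      by (simp add: c_def algebra_simps power2_eq_square)
    also have "1 + B\<^sup>2 - b\<^sup>2 - b\<^sup>2 * B\<^sup>2 = 2 * B\<^sup>2 - 2" using b4 by simp
    finally have e2: "(1 - b\<^sup>2) * (b * c) = \<kappa> - b\<^sup>2" by (simp add: \<kappa>_def algebra_simps)
    have "(1 - b\<^sup>2) * (y - b) * (y + c) = (1 - b\<^sup>2) * y\<^sup>2 + (1 - b\<^sup>2) * (c - b) * y - (1 - b\<^sup>2) * (b * c)"
      by (simp add: algebra_simps power2_eq_square)
    then show ?thesis unfolding e1 e2 by (simp add: algebra_simps)
  qed
  also have "\<dots> < 0" using b2 assms yc by (intro mult_neg_pos mult_pos_neg) (auto simp: abs_less_iff)
  finally have "(1 - y\<^sup>2) * ((b - f y) * (b - g)) < 0" unfolding fac by (simp only: mult.assoc)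
  then have "(b - f y) * (b - g) < 0" using R by (simp add: mult_less_0_iff)
  then have bf: "b < f y" "g < b" using gf by (auto simp: mult_less_0_iff)
  then show "b < f y" by simp
  have "0 < (1 - \<kappa>) * (1 + y)" using \<kappa> assms b by (intro mult_pos_pos) auto
  also have "\<dots> = (1 - y\<^sup>2) * 1\<^sup>2 + (1 - \<kappa>) * y * 1 - (\<kappa> - y\<^sup>2)" by (simp add: algebra_simps)
  finally have "0 < (1 - y\<^sup>2) * ((1 - f y) * (1 - g))" unfolding fac by (simp only: mult.assoc)
  then have "0 < (1 - f y) * (1 - g)" using R by (simp add: zero_less_mult_iff)
  then show "f y < 1" using bf(2) b by (auto simp: zero_less_mult_iff)
qed

text \<open>At a simple critical point two sheets meet, and passing to the other preimage is locally
  a reflection: it fixes \<open>b\<close> and has slope -1. The endpoint asymptotics of the kernel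
  rest on these two values.\<close>

lemma f_b: "f b = b" "fd b = - 1"
proof -
  have bc: "\<bar>b\<bar> < c" using order_points b by simp
  note R = range_facts[OF bc]
  have p: "0 < 2 * (1 - b\<^sup>2) * b + (1 - \<kappa>) * b" using b b2 \<kappa> by (intro add_pos_pos mult_pos_pos) auto
  have "disc b = (2 * (1 - b\<^sup>2) * b + (1 - \<kappa>) * b)\<^sup>2"
  proof -
    have "b\<^sup>2 * B\<^sup>2 + b\<^sup>2 * b\<^sup>2 = b\<^sup>2 * (b\<^sup>2 + B\<^sup>2)" by (simp add: algebra_simps)
    then have "b\<^sup>2 * B\<^sup>2 + b\<^sup>2 * b\<^sup>2 = b\<^sup>2 * (3 - \<kappa>)" unfolding sum_squares .
    then have k: "\<kappa> = b\<^sup>2 * (3 - \<kappa>) - b ^ 4" unfolding \<kappa>_def[symmetric] by (simp add: power2_eq_square power4_eq_xxxx)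
    have "(2 * (1 - b\<^sup>2) * b + (1 - \<kappa>) * b)\<^sup>2 - disc b = 4 * (1 - b\<^sup>2) * ((b\<^sup>2 * (3 - \<kappa>) - b ^ 4) - \<kappa>)"
      unfolding disc_def by (simp add: algebra_simps power2_eq_square power4_eq_xxxx)
    then show ?thesis using k by simp
  qed
  then have s: "sqrt (disc b) = 2 * (1 - b\<^sup>2) * b + (1 - \<kappa>) * b" using p by simp
  then show fb: "f b = b" using R b2 unfolding f_def by simp
  have "2 * b * (1 - b\<^sup>2) + (1 - \<kappa>) * b = 2 * (1 - b\<^sup>2) * b + (1 - \<kappa>) * b" by simp
  moreover have "x \<noteq> 0 \<Longrightarrow> - x / x = - 1" for x :: real by simp
  ultimately show "fd b = - 1" unfolding fd_def fb s using p by (metis less_irrefl)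
qed

lemma r_f:
  assumes "\<bar>y\<bar> < b"
  shows "r (f y) = r y"
proof -
  have yc: "\<bar>y\<bar> < c" using assms order_points by simp
  have n: "y\<^sup>2 \<noteq> 1" "(f y)\<^sup>2 \<noteq> 1" using range_facts[OF yc] f_bounds[OF assms] b abs_square_less_1[of "f y"] by auto
  have "(f y * ((f y)\<^sup>2 - \<kappa>)) * (y\<^sup>2 - 1) - (y * (y\<^sup>2 - \<kappa>)) * ((f y)\<^sup>2 - 1)
     = (f y - y) * (y\<^sup>2 * (f y)\<^sup>2 + \<kappa> - y\<^sup>2 - (f y)\<^sup>2 - (1 - \<kappa>) * y * f y)"
    by (simp add: algebra_simps power2_eq_square)
  also have "\<dots> = 0" using f_relation[OF yc] by simp
  finally show ?thesis using n by (simp add: r_def divide_eq_eq eq_divide_eq mult_ac)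
qed

lemma f_derivative:
  assumes y: "\<bar>y\<bar> < c"
  shows "(f has_real_derivative fd y) (at y)"
proof -
  note R = range_facts[OF y]
  \<comment> \<open>Differentiability comes from the explicit formula with the square root; the
    value of the derivative is then found from the polynomial relation.\<close>
  have dd: "\<exists>D. (disc has_real_derivative D) (at y)"
    unfolding disc_def[abs_def] by (rule exI) (rule derivative_eq_intros refl)+
  then obtain D where "(disc has_real_derivative D) (at y)" by blast
  from DERIV_chain2[OF DERIV_real_sqrt[OF R(2)] this]
  have ds: "((\<lambda>y. sqrt (disc y)) has_real_derivative (inverse (sqrt (disc y)) / 2 * D)) (at y)" .
  have "\<exists>d. (f has_real_derivative d) (at y)"
    unfolding f_def[abs_def] using R
    by (intro exI) (rule derivative_eq_intros ds refl | simp)+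
  then obtain d where d: "(f has_real_derivative d) (at y)" by blast
  have "((\<lambda>y. y\<^sup>2 + (f y)\<^sup>2 - y\<^sup>2 * (f y)\<^sup>2 + (1 - \<kappa>) * y * f y) has_real_derivative
     (2 * y + 2 * f y * d - (2 * y * (f y)\<^sup>2 + y\<^sup>2 * (2 * f y * d)) + ((1 - \<kappa>) * f y + (1 - \<kappa>) * y * d))) (at y)"
    by (rule derivative_eq_intros d refl | simp)+
  moreover have "((\<lambda>y. y\<^sup>2 + (f y)\<^sup>2 - y\<^sup>2 * (f y)\<^sup>2 + (1 - \<kappa>) * y * f y) has_real_derivative 0) (at y)"
  proof (rule has_field_derivative_transform_within_open)
    show "((\<lambda>_. \<kappa>) has_real_derivative 0) (at y)" by simp
    show "open {-c<..<c}" by simp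
  qed (use y f_relation in \<open>auto simp: abs_less_iff\<close>)
  ultimately have "2 * y + 2 * f y * d - (2 * y * (f y)\<^sup>2 + y\<^sup>2 * (2 * f y * d)) + ((1 - \<kappa>) * f y + (1 - \<kappa>) * y * d) = 0"
    by (rule DERIV_unique)
  then have "d * (2 * (1 - y\<^sup>2) * f y + (1 - \<kappa>) * y) = - (2 * y * (1 - (f y)\<^sup>2) + (1 - \<kappa>) * f y)"
    by (simp add: algebra_simps)
  then have "d * sqrt (disc y) = - (2 * y * (1 - (f y)\<^sup>2) + (1 - \<kappa>) * f y)" unfolding f_root[OF y] .
  then have "d = fd y" using R by (simp add: fd_def eq_divide_eq)
  then show ?thesis using d by simp
qed

text \<open>Differentiating \<open>r (f y) = r y\<close>: the derivative of \<open>r\<close> is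
  positive at \<open>y\<close> and negative at \<open>f y\<close>, which lies between
  \<open>b\<close> and 1. The positivity of the kernel comes from this sign.\<close>

lemma fd_neg:
  assumes "\<bar>y\<bar> < b"
  shows "fd y < 0"
proof -
  have yc: "\<bar>y\<bar> < c" using assms order_points by simp
  have y1: "y\<^sup>2 \<noteq> 1" using range_facts[OF yc] by simp
  note fb = f_bounds[OF assms]
  have f2: "b\<^sup>2 < (f y)\<^sup>2" "(f y)\<^sup>2 < 1" using fb b by (auto intro!: power_strict_mono simp: abs_square_less_1)
  have rf: "((f y)\<^sup>2 - b\<^sup>2) * ((f y)\<^sup>2 - B\<^sup>2) / ((f y)\<^sup>2 - 1)\<^sup>2 < 0" (is "?q < 0")
    using f2 B2 by (intro divide_neg_pos mult_pos_neg) auto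
  have "((\<lambda>y. r (f y)) has_real_derivative ?q * fd y) (at y)"
    by (rule DERIV_chain2[OF r_derivative f_derivative[OF yc]]) (use f2 in simp)
  moreover have "((\<lambda>y. r (f y)) has_real_derivative (y\<^sup>2 - b\<^sup>2) * (y\<^sup>2 - B\<^sup>2) / (y\<^sup>2 - 1)\<^sup>2) (at y)"
    by (rule has_field_derivative_transform_within_open[OF r_derivative[OF y1], of "{-b<..<b}"])
       (use assms r_f in \<open>auto simp: abs_less_iff\<close>)
  ultimately have "?q * fd y = (y\<^sup>2 - b\<^sup>2) * (y\<^sup>2 - B\<^sup>2) / (y\<^sup>2 - 1)\<^sup>2" by (rule DERIV_unique)
  then have "0 < ?q * fd y" using r_derivative_pos[OF assms] by simp
  then show ?thesis using rf unfolding zero_less_mult_iff by linarith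
qed

lemma f_continuous: "continuous_on {-c<..<c} f"
  by (intro continuous_at_imp_continuous_on ballI DERIV_isCont[OF f_derivative]) auto

lemma disc_continuous: "continuous_on S disc"
  unfolding disc_def[abs_def] by (intro continuous_intros)

lemma fd_continuous: "continuous_on {-c<..<c} fd"
proof -
  have "sqrt (disc y) \<noteq> 0" if "y \<in> {-c<..<c}" for y using range_facts(2)[of y] that by (auto simp: abs_less_iff)
  then show ?thesis unfolding fd_def[abs_def]
    by (intro continuous_intros f_continuous disc_continuous) auto
qed

text \<open>A continuous second derivative of \<open>f\<close> is what the regularity hypothesis on
  \<open>s''\<close> in the sine series lemma asks for.\<close>

lemma fd_derivative:
  obtains fdd where "continuous_on {-c<..<c} fdd" "\<And>y. \<bar>y\<bar> < c \<Longrightarrow> (fd has_real_derivative fdd y) (at y)"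
proof -
  define dd where "dd y = (1 - \<kappa>)\<^sup>2 * (2 * y) + 4 * (- (2 * y) * (\<kappa> - y\<^sup>2) + (1 - y\<^sup>2) * - (2 * y))" for y
  have ddd: "(disc has_real_derivative dd y) (at y)" for y
    unfolding disc_def[abs_def] dd_def
    by (rule derivative_eq_intros refl | simp add: algebra_simps)+
  define n where "n y = - (2 * y * (1 - (f y)\<^sup>2) + (1 - \<kappa>) * f y)" for y
  define n' where "n' y = - (2 * (1 - (f y)\<^sup>2) + 2 * y * - (2 * f y * fd y) + (1 - \<kappa>) * fd y)" for y
  define fdd where "fdd y = (n' y * sqrt (disc y) - n y * (inverse (sqrt (disc y)) / 2 * dd y)) / (sqrt (disc y) * sqrt (disc y))" for y
  have S0: "sqrt (disc y) \<noteq> 0" if "\<bar>y\<bar> < c" for y using range_facts(2)[OF that] by simp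
  show ?thesis
  proof (rule that[of fdd])
    show "(fd has_real_derivative fdd y) (at y)" if y: "\<bar>y\<bar> < c" for y
    proof -
      have "(n has_real_derivative n' y) (at y)"
        unfolding n_def[abs_def] n'_def
        by (rule derivative_eq_intros f_derivative[OF y] refl | simp)+
      moreover have "((\<lambda>y. sqrt (disc y)) has_real_derivative (inverse (sqrt (disc y)) / 2 * dd y)) (at y)"
        by (rule DERIV_chain2[OF DERIV_real_sqrt[OF range_facts(2)[OF y]] ddd])
      ultimately have "((\<lambda>y. n y / sqrt (disc y)) has_real_derivative fdd y) (at y)"
        unfolding fdd_def by (rule DERIV_divide) (rule S0[OF y])
      moreover have "fd = (\<lambda>y. n y / sqrt (disc y))" by (auto simp: fd_def n_def)
      ultimately show ?thesis by simp
    qed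
    show "continuous_on {-c<..<c} fdd"
      unfolding fdd_def n_def n'_def dd_def
      by (intro continuous_intros f_continuous fd_continuous disc_continuous) (use S0 in \<open>auto simp: abs_less_iff\<close>)
  qed
qed

subsection \<open>The kernel\<close>

text \<open>This is \<open>e * sqrt (z\<^sup>2 - 1)\<close> for \<open>z = f (e * x) / e\<close>.
  Multiplying through by \<open>e\<close> keeps the formulas for \<open>s\<close> and the kernel
  meaningful and continuous at \<open>e = 0\<close>.\<close>

definition q :: "real \<Rightarrow> real \<Rightarrow> real" where "q e x = sqrt ((f (e * x))\<^sup>2 - e\<^sup>2)"

text \<open>The Joukowski coordinate, of modulus less than 1, of the point \<open>f (e x) / e\<close>.\<close>

definition s :: "real \<Rightarrow> real \<Rightarrow> real" where "s e x = e / (f (e * x) + q e x)"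

definition s' :: "real \<Rightarrow> real \<Rightarrow> real" where "s' e x = - s e x * e * fd (e * x) / q e x"

text \<open>The derivative \<open>s'\<close> times the generating function of the Chebyshev
  polynomials of the second kind, with their weight \<open>sqrt (1 - t\<^sup>2)\<close> and its
  normalising factor \<open>2 / pi\<close>.\<close>

definition K1 :: "real \<Rightarrow> real \<Rightarrow> real \<Rightarrow> real" where
  "K1 e x t = 2 / pi * sqrt (1 - t\<^sup>2) * (s' e x / (1 - 2 * s e x * t + (s e x)\<^sup>2))"

text \<open>The second outer preimage is the mirror image \<open>- f (- y)\<close> with coordinate
  \<open>- s e (- x)\<close>; its kernel is the first one reflected in both variables.\<close>

definition K :: "real \<Rightarrow> real \<Rightarrow> real \<Rightarrow> real" where
  "K e x t = K1 e x t + K1 e (- x) (- t)"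

lemma ex_range:
  assumes "0 \<le> e" "e < b" "x \<in> {-1..1}"
  shows "\<bar>e * x\<bar> \<le> e" "\<bar>e * x\<bar> < b" "\<bar>e * x\<bar> < c"
proof -
  have "\<bar>e * x\<bar> \<le> e * 1" unfolding abs_mult using assms by (intro mult_mono) auto
  then show "\<bar>e * x\<bar> \<le> e" "\<bar>e * x\<bar> < b" "\<bar>e * x\<bar> < c" using assms order_points by auto
qed

lemma q_pos:
  assumes "0 \<le> e" "e < b" "x \<in> {-1..1}"
  shows "0 < q e x" "(q e x)\<^sup>2 = (f (e * x))\<^sup>2 - e\<^sup>2"
proof -
  have "e < f (e * x)" using f_bounds(1)[OF ex_range(2)[OF assms]] assms by simp
  then have "e\<^sup>2 < (f (e * x))\<^sup>2" using assms by (intro power_strict_mono) auto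
  then show "0 < q e x" "(q e x)\<^sup>2 = (f (e * x))\<^sup>2 - e\<^sup>2" by (auto simp: q_def)
qed

lemma s_range:
  assumes "0 \<le> e" "e < b" "x \<in> {-1..1}"
  shows "0 \<le> s e x" "s e x < 1" "0 < e \<Longrightarrow> 0 < s e x"
proof -
  have "e < f (e * x)" using f_bounds(1)[OF ex_range(2)[OF assms]] assms by simp
  then have "e < f (e * x) + q e x" using q_pos[OF assms] by simp
  then show "0 \<le> s e x" "s e x < 1" "0 < e \<Longrightarrow> 0 < s e x" using assms by (auto simp: s_def)
qed

lemma s_joukowski:
  assumes "0 < e" "e < b" "x \<in> {-1..1}"
  shows "(s e x + 1 / s e x) / 2 = f (e * x) / e"
proof -
  have a: "0 \<le> e" using assms by simp
  define F where "F = f (e * x) + q e x"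
  have "0 < f (e * x)" using f_bounds(1)[OF ex_range(2)[OF a assms(2,3)]] b by simp
  then have F: "0 < F" using q_pos[OF a assms(2,3)] by (simp add: F_def)
  have "e * e = (f (e * x) - q e x) * F"
    using q_pos(2)[OF a assms(2,3)] by (simp add: F_def algebra_simps power2_eq_square)
  then have "e / F = (f (e * x) - q e x) / e" using F assms by (simp add: field_simps)
  moreover have "1 / (e / F) = F / e" by simp
  ultimately have "e / F + 1 / (e / F) = 2 * f (e * x) / e" by (simp add: F_def add_divide_distrib[symmetric])
  then show ?thesis unfolding s_def F_def[symmetric] by simp
qed

lemma s_derivative:
  assumes "0 \<le> e" "e < b" "x \<in> {-1..1}"
  shows "(s e has_real_derivative s' e x) (at x)"
proof -
  have df: "((\<lambda>x. f (e * x)) has_real_derivative fd (e * x) * e) (at x)"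
    by (rule DERIV_compose_scale[OF f_derivative[OF ex_range(3)[OF assms]]])
  have Q: "0 < (f (e * x))\<^sup>2 - e\<^sup>2" using q_pos[OF assms] by (metis zero_less_power2 less_irrefl)
  have "((\<lambda>x. (f (e * x))\<^sup>2 - e\<^sup>2) has_real_derivative 2 * f (e * x) * (fd (e * x) * e)) (at x)"
    by (rule derivative_eq_intros df refl | simp)+
  from DERIV_chain2[OF DERIV_real_sqrt[OF Q] this]
  have dq: "(q e has_real_derivative inverse (q e x) / 2 * (2 * f (e * x) * (fd (e * x) * e))) (at x)"
    by (simp add: q_def[abs_def])
  define F where "F = f (e * x) + q e x"
  have "0 < f (e * x)" using f_bounds(1)[OF ex_range(2)[OF assms]] b by simp
  then have F: "0 < F" using q_pos[OF assms] by (simp add: F_def)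
  have "(s e has_real_derivative (0 * F - e * (fd (e * x) * e + inverse (q e x) / 2 * (2 * f (e * x) * (fd (e * x) * e)))) / (F * F)) (at x)"
    unfolding s_def[abs_def] F_def
    by (rule DERIV_divide[OF DERIV_const DERIV_add[OF df dq]]) (use F in \<open>simp add: F_def\<close>)
  moreover have "fd (e * x) * e + inverse (q e x) / 2 * (2 * f (e * x) * (fd (e * x) * e)) = fd (e * x) * e * F / q e x"
    using q_pos(1)[OF assms] by (simp add: F_def field_simps)
  ultimately have "(s e has_real_derivative (- e * (fd (e * x) * e * F / q e x)) / (F * F)) (at x)" by simp
  also have "(- e * (fd (e * x) * e * F / q e x)) / (F * F) = s' e x"
    using F by (simp add: s'_def s_def F_def[symmetric] mult_ac)
  finally show ?thesis .
qed

lemma s'_pos: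
  assumes "0 < e" "e < b" "x \<in> {-1..1}"
  shows "0 < s' e x"
proof -
  have a: "0 \<le> e" using assms by simp
  have "0 < s e x * e * (- fd (e * x)) / q e x"
    using s_range(3)[OF a assms(2,3,1)] assms fd_neg[OF ex_range(2)[OF a assms(2,3)]] q_pos[OF a assms(2,3)]
    by (intro divide_pos_pos mult_pos_pos) auto
  then show ?thesis by (simp add: s'_def)
qed

lemma s'_derivative:
  assumes "0 \<le> e" "e < b"
  obtains s'' where "continuous_on {-1..1} s''" "\<And>x. x \<in> {-1..1} \<Longrightarrow> (s' e has_real_derivative s'' x) (at x)"
proof -
  obtain fdd where fdd: "continuous_on {-c<..<c} fdd" "\<And>y. \<bar>y\<bar> < c \<Longrightarrow> (fd has_real_derivative fdd y) (at y)"
    using fd_derivative by blast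
  define q' where "q' x = inverse (q e x) / 2 * (2 * f (e * x) * (fd (e * x) * e))" for x
  define n' where "n' x = - s' e x * e * fd (e * x) + - s e x * e * (fdd (e * x) * e)" for x
  define s'' where "s'' x = (n' x * q e x - (- s e x * e * fd (e * x)) * q' x) / (q e x * q e x)" for x
  have cx: "continuous_on {-1..1} (\<lambda>x. g (e * x))" if "continuous_on {-c<..<c} g" for g :: "real \<Rightarrow> real"
  proof (rule continuous_on_compose2[OF that])
    show "continuous_on {-1..1} (\<lambda>x. e * x)" by (intro continuous_intros)
    show "(\<lambda>x. e * x) ` {-1..1} \<subseteq> {-c<..<c}"
    proof clarify
      fix x :: real assume "x \<in> {-1..1}"
      from ex_range(3)[OF assms this] show "e * x \<in> {-c<..<c}"
        unfolding greaterThanLessThan_iff abs_less_iff by linarith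
    qed
  qed
  have qc: "continuous_on {-1..1} (q e)"
    unfolding q_def[abs_def] by (intro continuous_intros cx f_continuous)
  have sc: "continuous_on {-1..1} (s e)" using s_derivative[OF assms]
    by (meson DERIV_isCont continuous_at_imp_continuous_on)
  have q0: "q e x \<noteq> 0" if "x \<in> {-1..1}" for x using q_pos(1)[OF assms that] by simp
  have s'c: "continuous_on {-1..1} (s' e)"
    unfolding s'_def[abs_def] by (intro continuous_intros sc cx fd_continuous qc) (use q0 in auto)
  show ?thesis
  proof (rule that[of s''])
    show "continuous_on {-1..1} s''"
      unfolding s''_def n'_def q'_def
      by (intro continuous_intros s'c sc cx fd_continuous fdd f_continuous qc) (use q0 in auto)
    fix x :: real assume x: "x \<in> {-1..1}"
    note ex = ex_range[OF assms x]
    have df: "((\<lambda>x. f (e * x)) has_real_derivative fd (e * x) * e) (at x)"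
      by (rule DERIV_compose_scale[OF f_derivative[OF ex(3)]])
    have dfd: "((\<lambda>x. fd (e * x)) has_real_derivative fdd (e * x) * e) (at x)"
      by (rule DERIV_compose_scale[OF fdd(2)[OF ex(3)]])
    have Q: "0 < (f (e * x))\<^sup>2 - e\<^sup>2" using q_pos[OF assms x] by (metis zero_less_power2 less_irrefl)
    have "((\<lambda>x. (f (e * x))\<^sup>2 - e\<^sup>2) has_real_derivative 2 * f (e * x) * (fd (e * x) * e)) (at x)"
      by (rule derivative_eq_intros df refl | simp)+
    from DERIV_chain2[OF DERIV_real_sqrt[OF Q] this]
    have dq: "(q e has_real_derivative q' x) (at x)"
      by (simp add: q_def[abs_def] q'_def)
    have dn: "((\<lambda>x. - s e x * e * fd (e * x)) has_real_derivative n' x) (at x)"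
      unfolding n'_def by (rule derivative_eq_intros s_derivative[OF assms x] dfd refl | simp)+
    show "(s' e has_real_derivative s'' x) (at x)"
      unfolding s'_def[abs_def] s''_def by (rule DERIV_divide[OF dn dq q0[OF x]])
  qed
qed

lemma kernel_denominator_pos:
  fixes s t :: real
  assumes "0 \<le> s" "s < 1" "t \<in> {-1..1}"
  shows "0 < 1 - 2 * s * t + s\<^sup>2"
proof -
  have "s * t \<le> s" using assms by (simp add: mult_left_le)
  then have "(1 - s)\<^sup>2 \<le> 1 - 2 * s * t + s\<^sup>2" by (simp add: power2_eq_square algebra_simps)
  moreover have "0 < (1 - s)\<^sup>2" using assms by simp
  ultimately show ?thesis by linarith
qed

lemma K1_nonneg:
  assumes "0 \<le> e" "e < b" "x \<in> {-1..1}" "t \<in> {-1..1}"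
  shows "0 \<le> K1 e x t"
proof (cases "e = 0")
  case False
  then have "0 < s' e x" using assms by (intro s'_pos) auto
  then show ?thesis
    unfolding K1_def using kernel_denominator_pos[OF s_range(1,2)[OF assms(1-3)] assms(4)] assms(4)
    by (intro mult_nonneg_nonneg divide_nonneg_nonneg) (auto simp: abs_square_le_1)
qed (simp add: K1_def s'_def)

lemma K1_pos:
  assumes "0 < e" "e < b" "x \<in> {-1..1}" "t \<in> {-1<..<1}"
  shows "0 < K1 e x t"
proof -
  have "t\<^sup>2 < 1" using assms(4) by (simp add: abs_square_less_1 abs_less_iff)
  then show ?thesis
    unfolding K1_def using kernel_denominator_pos[OF s_range(1,2)[of e x], of t] assms s'_pos[OF assms(1-3)]
    by (intro mult_pos_pos divide_pos_pos) auto
qed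

lemma K1_continuous:
  assumes "e1 < b"
  shows "continuous_on ({0..e1} \<times> {-1..1} \<times> {-1..1}) (\<lambda>p. K1 (fst p) (fst (snd p)) (snd (snd p)))"
proof -
  let ?S = "{0..e1} \<times> {-1..1::real} \<times> {-1..1::real}"
  have in_S: "0 \<le> fst p \<and> fst p < b \<and> fst (snd p) \<in> {-1..1} \<and> snd (snd p) \<in> {-1..1}" if "p \<in> ?S" for p
    using that assms by auto
  have cx: "continuous_on ?S (\<lambda>p. g (fst p * fst (snd p)))" if "continuous_on {-c<..<c} g" for g :: "real \<Rightarrow> real"
  proof (rule continuous_on_compose2[OF that])
    show "continuous_on ?S (\<lambda>p. fst p * fst (snd p))" by (intro continuous_intros)
    show "(\<lambda>p. fst p * fst (snd p)) ` ?S \<subseteq> {-c<..<c}"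
    proof (rule image_subsetI)
      fix p assume "p \<in> ?S"
      then have "\<bar>fst p * fst (snd p)\<bar> < c" using in_S[of p] by (intro ex_range(3)) auto
      then show "fst p * fst (snd p) \<in> {-c<..<c}"
        unfolding greaterThanLessThan_iff abs_less_iff by linarith
    qed
  qed
  have qc: "continuous_on ?S (\<lambda>p. q (fst p) (fst (snd p)))"
    unfolding q_def by (intro continuous_intros cx f_continuous)
  have q0: "q (fst p) (fst (snd p)) \<noteq> 0" if "p \<in> ?S" for p
    using q_pos(1)[of "fst p" "fst (snd p)"] in_S[OF that] by auto
  have sc: "continuous_on ?S (\<lambda>p. s (fst p) (fst (snd p)))"
    unfolding s_def
  proof (intro continuous_intros cx f_continuous qc ballI)
    fix p assume p: "p \<in> ?S"
    show "f (fst p * fst (snd p)) + q (fst p) (fst (snd p)) \<noteq> 0"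
      using q_pos(1)[of "fst p" "fst (snd p)"] in_S[OF p] f_bounds(1)[OF ex_range(2)[of "fst p" "fst (snd p)"]] b
      by auto
  qed
  have s'c: "continuous_on ?S (\<lambda>p. s' (fst p) (fst (snd p)))"
    unfolding s'_def by (intro continuous_intros sc cx fd_continuous qc ballI q0)
  show ?thesis unfolding K1_def
  proof (intro continuous_intros s'c sc ballI)
    fix p assume p: "p \<in> ?S"
    show "1 - 2 * s (fst p) (fst (snd p)) * snd (snd p) + (s (fst p) (fst (snd p)))\<^sup>2 \<noteq> 0"
      using kernel_denominator_pos[OF s_range(1,2)[of "fst p" "fst (snd p)"], of "snd (snd p)"] in_S[OF p] by auto
  qed
qed

lemma positive_kernel_K:
  assumes "0 < e1" "e1 < b"
  shows "positive_kernel K e1"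
proof
  show "0 < e1" by (rule assms)
  let ?S = "{0..e1} \<times> {-1..1::real} \<times> {-1..1::real}"
  have "continuous_on ?S (\<lambda>p. K1 (fst p) (- fst (snd p)) (- snd (snd p)))"
    by (rule continuous_on_via[OF K1_continuous[OF assms(2)], where f = "\<lambda>p. (fst p, - fst (snd p), - snd (snd p))"])
       (auto intro!: continuous_intros)
  from continuous_on_add[OF K1_continuous[OF assms(2)] this]
  show "continuous_on ?S (\<lambda>(e, x, t). K e x t)" by (simp add: K_def case_prod_unfold)
  show "K 0 x t = 0" for x t by (simp add: K_def K1_def s'_def)
  show "0 \<le> K e x t" if "e \<in> {0..e1}" "x \<in> {-1..1}" "t \<in> {-1..1}" for e x t
    unfolding K_def using that assms by (intro add_nonneg_nonneg K1_nonneg) auto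
  show "0 < K e x t" if "e \<in> {0<..e1}" "x \<in> {-1..1}" "t \<in> {-1<..<1}" for e x t
    unfolding K_def using that assms by (intro add_pos_pos K1_pos) auto
qed

end

subsection \<open>A subsolution when the segment nearly fills the arc between critical points\<close>

text \<open>In the logarithm of the distance to the endpoint the kernel tends to convolution with
  \<open>sech_kernel\<close>, which has mass 1; a wide tent is then almost reproduced.\<close>

definition sech_kernel :: "real \<Rightarrow> real" where
  "sech_kernel \<xi> = exp (- \<xi> / 2) / (pi * (1 + exp (- \<xi>)))"

lemma exp_half_squared: "(exp (x / 2))\<^sup>2 = exp (x :: real)"
  by (simp add: power2_eq_square mult_exp_exp)

lemma sech_kernel_pos: "0 < sech_kernel \<xi>"
  unfolding sech_kernel_def by (intro divide_pos_pos mult_pos_pos add_pos_pos) auto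

lemma sech_kernel_even: "sech_kernel (- \<xi>) = sech_kernel \<xi>"
proof -
  have "exp (\<xi> / 2) * (1 + exp (- \<xi>)) = exp (- \<xi> / 2) * (1 + exp \<xi>)"
    by (simp add: distrib_left exp_add[symmetric])
  moreover have "1 + exp \<xi> \<noteq> 0" "1 + exp (- \<xi>) \<noteq> 0"
    by (simp_all add: add_pos_pos less_imp_neq[symmetric])
  ultimately show ?thesis by (simp add: sech_kernel_def frac_eq_eq mult_ac)
qed

lemma sech_kernel_continuous: "continuous_on S sech_kernel"
proof -
  have "1 + exp (- \<xi>) \<noteq> 0" for \<xi> :: real by (simp add: add_pos_pos less_imp_neq[symmetric])
  then show ?thesis unfolding sech_kernel_def[abs_def] by (intro continuous_intros) auto
qed

text \<open>The kernel equals \<open>1 / (2 * pi * cosh (\<xi> / 2))\<close>, with antiderivative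
  \<open>2 / pi * arctan (exp (\<xi> / 2))\<close> running from 0 to 1 over the line.\<close>

lemma sech_kernel_mass:
  assumes "\<theta> < 1"
  obtains M where "0 < M" "\<theta> < integral {-M..M} sech_kernel"
proof -
  have I: "integral {-M..M} sech_kernel = 2 / pi * arctan (exp (M / 2)) - 2 / pi * arctan (exp (- M / 2))" if M: "0 < M" for M
  proof -
    have "(sech_kernel has_integral (2 / pi * arctan (exp (M / 2)) - 2 / pi * arctan (exp (- M / 2)))) {-M..M}"
    proof (rule fundamental_theorem_of_calculus)
      fix \<xi> :: real
      have "((\<lambda>\<xi>. 2 / pi * arctan (exp (\<xi> / 2))) has_real_derivative
           2 / pi * (inverse (1 + (exp (\<xi> / 2))\<^sup>2) * (exp (\<xi> / 2) * (1 / 2)))) (at \<xi> within {-M..M})"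
        by (rule derivative_eq_intros refl | simp)+
      also have "2 / pi * (inverse (1 + (exp (\<xi> / 2))\<^sup>2) * (exp (\<xi> / 2) * (1 / 2))) = sech_kernel (- \<xi>)"
      proof -
        have "2 / pi * (inverse D * (Y * (1 / 2))) = Y / (pi * D)" for D Y :: real
          by (simp add: inverse_eq_divide)
        then show ?thesis unfolding exp_half_squared sech_kernel_def by (simp only: minus_minus)
      qed
      finally show "((\<lambda>\<xi>. 2 / pi * arctan (exp (\<xi> / 2))) has_vector_derivative sech_kernel \<xi>) (at \<xi> within {-M..M})"
        by (simp add: has_real_derivative_iff_has_vector_derivative sech_kernel_even)
    qed (use M in simp)
    then show ?thesis by (rule integral_unique)
  qed
  have e1: "filterlim (\<lambda>M::real. exp (M / 2)) at_top at_top"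
  proof (rule filterlim_compose[OF exp_at_top])
    have "filterlim (\<lambda>M::real. 1 / 2 * M) at_top at_top"
      by (rule filterlim_tendsto_pos_mult_at_top[OF tendsto_const _ filterlim_ident]) simp
    then show "filterlim (\<lambda>M::real. M / 2) at_top at_top" by simp
  qed
  have e2: "((\<lambda>M::real. exp (- M / 2)) \<longlongrightarrow> 0) at_top"
    using tendsto_inverse_0_at_top[OF e1] by (simp only: exp_minus[symmetric] minus_divide_left)
  have "((\<lambda>M::real. 2 / pi * arctan (exp (M / 2)) - 2 / pi * arctan (exp (- M / 2))) \<longlongrightarrow> 2 / pi * (pi / 2) - 2 / pi * arctan 0) at_top"
    by (intro tendsto_intros filterlim_compose[OF tendsto_arctan_at_top e1] isCont_tendsto_compose[OF isCont_arctan e2])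
  then have "((\<lambda>M::real. 2 / pi * arctan (exp (M / 2)) - 2 / pi * arctan (exp (- M / 2))) \<longlongrightarrow> 1) at_top" by simp
  from order_tendstoD(1)[OF this assms] eventually_gt_at_top[of "0::real"]
  have "\<forall>\<^sub>F M in at_top. 0 < M \<and> \<theta> < 2 / pi * arctan (exp (M / 2)) - 2 / pi * arctan (exp (- M / 2))"
    by eventually_elim simp
  then obtain M :: real where "0 < M" "\<theta> < 2 / pi * arctan (exp (M / 2)) - 2 / pi * arctan (exp (- M / 2))"
    by (auto simp: eventually_at_top_linorder)
  then show ?thesis using that I by simp
qed

section \<open>Wide tents under the limiting convolution\<close>

definition tent :: "real \<Rightarrow> real \<Rightarrow> real" where "tent A \<tau> = max 0 (A - \<bar>\<tau>\<bar>)"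

lemma tent_continuous: "continuous_on S (tent A)"
  unfolding tent_def[abs_def] by (intro continuous_intros)

text \<open>If \<open>\<bar>\<tau>\<bar>\<close> is at least \<open>M\<close>, the tent dominates a
  linear function on the window, and an even kernel reproduces linear functions up to the factor
  \<open>m\<close>. Near the apex the tent falls by at most \<open>M\<close> across the window; the
  lower bound on \<open>A\<close> makes the tent so high there that the slack
  \<open>m - \<theta>\<close> pays for this loss.\<close>

lemma tent_reproduced:
  assumes M: "0 < M" and \<theta>: "0 < \<theta>" "\<theta> < m" and m: "m = integral {-M..M} sech_kernel"
    and A: "M + M * m / (m - \<theta>) \<le> A"
  shows "\<theta> * tent A \<tau> \<le> integral {-M..M} (\<lambda>\<xi>. sech_kernel \<xi> * tent A (\<tau> - \<xi>))"
proof -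
  have kc: "continuous_on {-M..M} sech_kernel" by (rule sech_kernel_continuous)
  have k1: "(sech_kernel has_integral m) {-M..M}"
    unfolding m by (intro integrable_integral integrable_continuous_real kc)
  have k2: "((\<lambda>\<xi>. sech_kernel \<xi> * \<xi>) has_integral 0) {-M..M}"
  proof -
    define i where "i = integral {-M..M} (\<lambda>\<xi>. sech_kernel \<xi> * \<xi>)"
    have i: "((\<lambda>\<xi>. sech_kernel \<xi> * \<xi>) has_integral i) {-M..M}"
      unfolding i_def by (intro integrable_integral integrable_continuous_real continuous_intros kc)
    have "integral {-M..- (- M)} (\<lambda>\<xi>. sech_kernel (- \<xi>) * (- \<xi>)) = integral {- M..M} (\<lambda>\<xi>. sech_kernel \<xi> * \<xi>)"
      using Henstock_Kurzweil_Integration.integral_reflect_real[of M "-M" "\<lambda>\<xi>. sech_kernel \<xi> * \<xi>"] by simp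
    then have "- i = i" by (simp add: sech_kernel_even i_def)
    then show ?thesis using i by simp
  qed
  have kV: "((\<lambda>\<xi>. sech_kernel \<xi> * tent A (\<tau> - \<xi>)) has_integral integral {-M..M} (\<lambda>\<xi>. sech_kernel \<xi> * tent A (\<tau> - \<xi>))) {-M..M}"
    by (intro integrable_integral integrable_continuous_real continuous_intros kc
        continuous_on_compose2[OF tent_continuous[of UNIV]]) auto
  have lower: "x \<le> integral {-M..M} (\<lambda>\<xi>. sech_kernel \<xi> * tent A (\<tau> - \<xi>))"
    if "((\<lambda>\<xi>. sech_kernel \<xi> * g \<xi>) has_integral x) {-M..M}" "\<And>\<xi>. \<xi> \<in> {-M..M} \<Longrightarrow> g \<xi> \<le> tent A (\<tau> - \<xi>)" for x g
    by (rule has_integral_le[OF that(1) kV]) (use that(2) sech_kernel_pos in \<open>auto intro!: mult_left_mono less_imp_le\<close>)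
  consider "tent A \<tau> = 0" | "M \<le> \<tau>" "tent A \<tau> = A - \<tau>" "0 < A - \<tau>" | "\<tau> \<le> - M" "tent A \<tau> = A + \<tau>" "0 < A + \<tau>" | "\<bar>\<tau>\<bar> < M"
  proof -
    have "tent A \<tau> = 0 \<or> (tent A \<tau> = A - \<bar>\<tau>\<bar> \<and> 0 < A - \<bar>\<tau>\<bar>)" by (auto simp: tent_def max_def)
    moreover have "\<bar>\<tau>\<bar> < M \<or> (M \<le> \<tau> \<and> \<bar>\<tau>\<bar> = \<tau>) \<or> (\<tau> \<le> - M \<and> \<bar>\<tau>\<bar> = - \<tau>)" using M by linarith
    ultimately show ?thesis using that by fastforce
  qed
  then show ?thesis
  proof cases
    case 1
    have "0 \<le> integral {-M..M} (\<lambda>\<xi>. sech_kernel \<xi> * tent A (\<tau> - \<xi>))"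
      by (rule lower[of "\<lambda>_. 0"]) (auto simp: tent_def)
    then show ?thesis using 1 by simp
  next
    case 2
    have "((\<lambda>\<xi>. (A - \<tau>) * sech_kernel \<xi> + sech_kernel \<xi> * \<xi>) has_integral (A - \<tau>) * m + 0) {-M..M}"
      by (intro has_integral_add has_integral_mult_right k1 k2)
    then have "((\<lambda>\<xi>. sech_kernel \<xi> * (A - \<tau> + \<xi>)) has_integral (A - \<tau>) * m) {-M..M}"
      by (simp add: algebra_simps)
    then have "(A - \<tau>) * m \<le> integral {-M..M} (\<lambda>\<xi>. sech_kernel \<xi> * tent A (\<tau> - \<xi>))"
      by (rule lower) (use 2 in \<open>auto simp: tent_def\<close>)
    moreover have "\<theta> * (A - \<tau>) \<le> m * (A - \<tau>)" using 2 \<theta> by (intro mult_right_mono) auto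
    ultimately show ?thesis unfolding 2(2) by (simp add: mult.commute)
  next
    case 3
    have "((\<lambda>\<xi>. (A + \<tau>) * sech_kernel \<xi> - sech_kernel \<xi> * \<xi>) has_integral (A + \<tau>) * m - 0) {-M..M}"
      by (intro has_integral_diff has_integral_mult_right k1 k2)
    then have "((\<lambda>\<xi>. sech_kernel \<xi> * (A + \<tau> - \<xi>)) has_integral (A + \<tau>) * m) {-M..M}"
      by (simp add: algebra_simps)
    then have "(A + \<tau>) * m \<le> integral {-M..M} (\<lambda>\<xi>. sech_kernel \<xi> * tent A (\<tau> - \<xi>))"
      by (rule lower) (use 3 in \<open>auto simp: tent_def\<close>)
    moreover have "\<theta> * (A + \<tau>) \<le> m * (A + \<tau>)" using 3 \<theta> by (intro mult_right_mono) auto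
    ultimately show ?thesis unfolding 3(2) by (simp add: mult.commute)
  next
    case 4
    have "((\<lambda>\<xi>. sech_kernel \<xi> * (tent A \<tau> - M)) has_integral m * (tent A \<tau> - M)) {-M..M}"
      by (rule has_integral_mult_left[OF k1])
    then have 1: "m * (tent A \<tau> - M) \<le> integral {-M..M} (\<lambda>\<xi>. sech_kernel \<xi> * tent A (\<tau> - \<xi>))"
      by (rule lower) (auto simp: tent_def)
    have "M * m / (m - \<theta>) \<le> tent A \<tau>" using A 4 by (auto simp: tent_def)
    then have "M * m \<le> tent A \<tau> * (m - \<theta>)" using \<theta> by (simp add: divide_le_eq)
    then have "\<theta> * tent A \<tau> \<le> m * (tent A \<tau> - M)" by (simp add: algebra_simps)
    then show ?thesis using 1 by simp
  qed
qed

section \<open>Kernel estimates near the endpoint and the subsolution\<close>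

context cubic
begin

text \<open>The Joukowski relation turns \<open>1 - 2 * s * t + s\<^sup>2\<close> into
  \<open>2 * s * (f (e * x) / e - t)\<close>, so \<open>s\<close> cancels and a form suited to
  asymptotics at the endpoint remains.\<close>

lemma K1_formula:
  assumes e: "0 < e" "e < b" and x: "x \<in> {-1..1}" and t: "t \<in> {-1..1}"
  shows "K1 e x t = e / pi * (- fd (e * x)) * sqrt ((e - e * t) * (e + e * t)) / (q e x * (f (e * x) - e * t))"
proof -
  have a: "0 \<le> e" using e by simp
  have s0: "0 < s e x" by (rule s_range(3)[OF a e(2) x e(1)])
  have f0: "e < f (e * x)" using f_bounds(1)[OF ex_range(2)[OF a e(2) x]] e by simp
  have et: "e * t \<le> e" using t e by simp
  have "(s e x)\<^sup>2 + 1 = 2 * s e x * (f (e * x) / e)"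
  proof -
    have "(s e x)\<^sup>2 + 1 = s e x * (s e x + 1 / s e x)" using s0 by (simp add: distrib_left power2_eq_square)
    moreover have "s e x + 1 / s e x = 2 * (f (e * x) / e)" using s_joukowski[OF e x] by simp
    ultimately show ?thesis by simp
  qed
  then have d: "1 - 2 * s e x * t + (s e x)\<^sup>2 = 2 * s e x * ((f (e * x) - e * t) / e)"
    using e by (simp add: field_simps)
  have "(e - e * t) * (e + e * t) = e\<^sup>2 * (1 - t\<^sup>2)" by (simp add: algebra_simps power2_eq_square)
  then have sq: "sqrt ((e - e * t) * (e + e * t)) = e * sqrt (1 - t\<^sup>2)" using e by (simp add: real_sqrt_mult)
  have gen: "2 / pi * Q * ((- S * e * D / P) / (2 * S * (G / e))) = e / pi * (- D) * (e * Q) / (P * G)"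
    if "S \<noteq> 0" "P \<noteq> 0" "G \<noteq> 0" for Q S D P G :: real
    using that e by (simp add: field_simps)
  show ?thesis
    unfolding K1_def d sq s'_def by (rule gen) (use s0 f0 et q_pos(1)[OF a e(2) x] in auto)
qed

text \<open>Here \<open>h = b - e\<close>, and \<rho>, \<sigma> are the distances of
  \<open>e * x\<close> and \<open>e * t\<close> from \<open>e\<close>. As \<open>f\<close> has slope
  -1 at its fixed point \<open>b\<close>, \<open>f - e\<close> is close to
  \<open>\<rho> + 2 * h\<close>, hence to \<rho> when \<open>h\<close> is much smaller. Then
  \<open>q\<close> behaves like \<open>sqrt (2 * e * \<rho>)\<close> and the denominator like
  \<open>\<rho> + \<sigma>\<close>; \<eta> measures the total error.\<close>

lemma K1_lower_bound:
  assumes \<eta>: "0 < \<eta>" "\<eta> < 1 / 2"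
  obtains d where "0 < d" "d \<le> \<eta> * b / 2"
    "\<And>h \<rho> \<sigma>. \<lbrakk>0 < h; 0 < \<rho>; 0 < \<sigma>; h + \<rho> < d; \<sigma> < d; 3 * h \<le> \<eta> * \<rho>\<rbrakk> \<Longrightarrow>
      (b - h) / pi * ((1 - \<eta>) / (1 + 2 * \<eta>)\<^sup>2) * (sqrt (\<sigma> / \<rho>) / (\<rho> + \<sigma>))
        \<le> K1 (b - h) (1 - \<rho> / (b - h)) (1 - \<sigma> / (b - h))"
proof -
  have bc: "b \<in> {-c<..<c}" using order_points b by simp
  have "isCont fd b" using fd_continuous bc by (simp add: continuous_on_eq_continuous_at)
  then have "\<forall>\<^sub>F y in nhds b. dist (fd y) (fd b) < \<eta>"
    using \<eta> by (intro tendstoD) (auto simp: isCont_def tendsto_at_iff_tendsto_nhds)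
  then obtain d0 where d0: "0 < d0" "\<And>y. dist y b < d0 \<Longrightarrow> dist (fd y) (- 1) < \<eta>"
    unfolding eventually_nhds_metric f_b by blast
  \<comment> \<open>The first bound keeps \<open>fd\<close> within \<eta> of -1; the second makes
    \<rho> and \<sigma> small against \<open>e\<close>, as needed for \<open>big\<close>.\<close>
  define d where "d = min d0 (\<eta> * b / 2)"
  have d: "0 < d" "d \<le> d0" "d \<le> \<eta> * b / 2" using d0 \<eta> b by (auto simp: d_def)
  have db: "d < b / 2" 
  proof -
    have "\<eta> * b < 1 / 2 * b" using \<eta> b by (intro mult_strict_right_mono) auto
    then show ?thesis using d(3) b by linarith
  qed
  show ?thesis
  proof (rule that[OF d(1,3)])
    fix h \<rho> \<sigma> :: real
    assume h: "0 < h" and \<rho>: "0 < \<rho>" and \<sigma>: "0 < \<sigma>" and hr: "h + \<rho> < d" and sd: "\<sigma> < d" and h3: "3 * h \<le> \<eta> * \<rho>"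
    define e where "e = b - h"
    define a where "a = 1 + 2 * \<eta>"
    have a: "1 < a" "a < 2" using \<eta> by (auto simp: a_def)
    have e: "0 < e" "e < b" "b / 2 < e" using h \<rho> hr db b by (auto simp: e_def)
    define x t where "x = 1 - \<rho> / e" and "t = 1 - \<sigma> / e"
    have \<rho>e: "\<rho> < e" "\<sigma> < e" using hr sd db e h by auto
    have x: "x \<in> {-1..1}" and t: "t \<in> {-1..1}" using \<rho>e \<rho> \<sigma> e by (auto simp: x_def t_def field_simps)
    have ex: "e * x = e - \<rho>" "e * t = e - \<sigma>" using e by (auto simp: x_def t_def right_diff_distrib)
    define y where "y = e - \<rho>"
    have y: "y < b" "0 < y" "b - y = h + \<rho>" using e \<rho>e \<rho> by (auto simp: y_def e_def)
    have yb: "\<bar>y\<bar> < b" using y by simp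
    have fdy: "1 - \<eta> \<le> - fd y"
      using d0(2)[of y] hr d(2) y by (auto simp: dist_real_def)
    \<comment> \<open>The mean value theorem between \<open>y\<close> and \<open>b\<close>. The
      products with \<eta> are bounded crudely, which costs \<open>3 * h\<close> in all and explains
      the hypothesis on \<open>h\<close>.\<close>
    have fy: "f y - e \<le> a * \<rho>"
    proof -
      have "\<exists>z. y < z \<and> z < b \<and> f b - f y = (b - y) * fd z"
      proof (rule MVT2[OF y(1)])
        fix z assume "y \<le> z" "z \<le> b"
        then have "\<bar>z\<bar> < c" using y order_points by auto
        then show "(f has_real_derivative fd z) (at z)" by (rule f_derivative)
      qed
      then obtain z where z: "y < z" "z < b" "f b - f y = (b - y) * fd z" by blast
      have "- fd z \<le> 1 + \<eta>" using d0(2)[of z] hr d(2) y z by (auto simp: dist_real_def)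
      then have "(b - y) * (- fd z) \<le> (b - y) * (1 + \<eta>)" using y by (intro mult_left_mono) auto
      then have "f y - b \<le> (h + \<rho>) * (1 + \<eta>)" using z(3) y(3) f_b by simp
      moreover have "h * \<eta> \<le> h * 1" using \<eta> h by (intro mult_left_mono) auto
      ultimately have "f y - e \<le> (1 + \<eta>) * \<rho> + 3 * h" by (simp add: e_def algebra_simps)
      then show ?thesis using h3 by (simp add: a_def algebra_simps)
    qed
    have g0: "0 < f y - e" using f_bounds(1)[OF yb] e by simp
    \<comment> \<open>This lets the same factor \<open>2 * e - \<sigma>\<close> be used in numerator
      and denominator, at the price of a second factor \<open>a\<close>.\<close>
    have big: "2 * e + a * \<rho> \<le> a * (2 * e - \<sigma>)"
    proof -
      have "a * (\<rho> + \<sigma>) \<le> 2 * (2 * d)" using a hr sd h \<rho> \<sigma> by (intro mult_mono) auto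
      also have "\<dots> \<le> 2 * \<eta> * b" using d(3) by simp
      also have "\<dots> \<le> 2 * \<eta> * (2 * e)" using e \<eta> by (intro mult_left_mono) auto
      finally show ?thesis by (simp add: a_def algebra_simps)
    qed
    have p: "0 < 2 * e - \<sigma>" using \<rho>e e by simp
    have q_le: "q e x \<le> a * sqrt (\<rho> * (2 * e - \<sigma>))"
    proof -
      have "(f y)\<^sup>2 - e\<^sup>2 = (f y - e) * (f y - e + 2 * e)" by (simp add: algebra_simps power2_eq_square)
      also have "\<dots> \<le> (a * \<rho>) * (a * (2 * e - \<sigma>))"
        using g0 fy big e a \<rho> by (intro mult_mono) auto
      also have "\<dots> = (a * sqrt (\<rho> * (2 * e - \<sigma>)))\<^sup>2" using \<rho> p by (simp add: power_mult_distrib) (simp add: power2_eq_square)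
      finally have "(f y)\<^sup>2 - e\<^sup>2 \<le> (a * sqrt (\<rho> * (2 * e - \<sigma>)))\<^sup>2" .
      then have "sqrt ((f y)\<^sup>2 - e\<^sup>2) \<le> a * sqrt (\<rho> * (2 * e - \<sigma>))"
        using a \<rho> p by (intro real_le_lsqrt) auto
      then show ?thesis by (simp add: q_def ex y_def)
    qed
    have q0: "0 < q e x" using e x by (intro q_pos(1)) auto
    have den: "f y - (e - \<sigma>) \<le> a * (\<rho> + \<sigma>)" "0 < f y - (e - \<sigma>)"
    proof -
      have "1 * \<sigma> \<le> a * \<sigma>" using a \<sigma> by (intro mult_right_mono) auto
      then show "f y - (e - \<sigma>) \<le> a * (\<rho> + \<sigma>)" using fy by (simp add: algebra_simps)
      show "0 < f y - (e - \<sigma>)" using g0 \<sigma> by simp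
    qed
    have "e / pi * ((1 - \<eta>) / a\<^sup>2) * (sqrt (\<sigma> / \<rho>) / (\<rho> + \<sigma>)) =
        e / pi * (1 - \<eta>) * sqrt (\<sigma> * (2 * e - \<sigma>)) / ((a * sqrt (\<rho> * (2 * e - \<sigma>))) * (a * (\<rho> + \<sigma>)))"
    proof -
      have nz: "sqrt \<rho> \<noteq> 0" "sqrt (2 * e - \<sigma>) \<noteq> 0" "\<rho> + \<sigma> \<noteq> 0" "a \<noteq> 0" using \<rho> \<sigma> p a by auto
      have "e / pi * ((1 - \<eta>) / a\<^sup>2) * ((S / P) / Q) = e / pi * (1 - \<eta>) * (S * X) / ((a * (P * X)) * (a * Q))"
        if "P \<noteq> 0" "X \<noteq> 0" "Q \<noteq> 0" for S P X Q :: real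
        using that nz(4) by (simp add: field_simps power2_eq_square)
      from this[OF nz(1-3)] show ?thesis unfolding real_sqrt_mult real_sqrt_divide .
    qed
    also have "\<dots> \<le> e / pi * (- fd y) * sqrt (\<sigma> * (2 * e - \<sigma>)) / (q e x * (f y - (e - \<sigma>)))"
    proof (rule frac_le)
      show "e / pi * (1 - \<eta>) * sqrt (\<sigma> * (2 * e - \<sigma>)) \<le> e / pi * (- fd y) * sqrt (\<sigma> * (2 * e - \<sigma>))"
        using fdy e \<sigma> p by (intro mult_right_mono mult_left_mono) auto
      show "0 \<le> e / pi * (- fd y) * sqrt (\<sigma> * (2 * e - \<sigma>))"
        using fdy \<eta> e \<sigma> p by (intro mult_nonneg_nonneg) auto
      show "0 < q e x * (f y - (e - \<sigma>))" using q0 den by simp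
      show "q e x * (f y - (e - \<sigma>)) \<le> a * sqrt (\<rho> * (2 * e - \<sigma>)) * (a * (\<rho> + \<sigma>))"
        using q_le den q0 a \<rho> p by (intro mult_mono) auto
    qed
    also have "\<dots> = K1 e x t"
      unfolding K1_formula[OF e(1,2) x t] ex y_def by simp
    finally show "(b - h) / pi * ((1 - \<eta>) / (1 + 2 * \<eta>)\<^sup>2) * (sqrt (\<sigma> / \<rho>) / (\<rho> + \<sigma>))
        \<le> K1 (b - h) (1 - \<rho> / (b - h)) (1 - \<sigma> / (b - h))"
      by (simp add: e_def a_def x_def t_def)
  qed
qed

lemma subsolution:
  assumes \<delta>: "0 < \<delta>" "\<delta> < 1"
  obtains e1 v0 where "0 < e1" "e1 < b" "positive_kernel.sub K \<delta> e1 v0"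
proof -
  \<comment> \<open>With this choice \<open>1 - 5 * \<eta> = (1 + \<delta>) / 2\<close>, a lower
    bound for \<gamma> that exceeds \<delta>. The remaining room is the ratio \<theta> < 1, left for
    the tent.\<close>
  define \<eta> where "\<eta> = (1 - \<delta>) / 10"
  have \<eta>: "0 < \<eta>" "\<eta> < 1 / 2" using \<delta> by (auto simp: \<eta>_def)
  define \<gamma> where "\<gamma> = (1 - \<eta>) / (1 + 2 * \<eta>)\<^sup>2"
  have \<gamma>: "\<delta> < \<gamma>" "0 < \<gamma>"
  proof -
    have pos: "0 < (1 + 2 * \<eta>)\<^sup>2" using \<eta> by simp
    have "(1 - 5 * \<eta>) * (1 + 2 * \<eta>)\<^sup>2 = (1 - \<eta>) - (16 * \<eta>\<^sup>2 + 20 * \<eta> ^ 3)"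
      by (simp add: algebra_simps power2_eq_square power3_eq_cube)
    also have "\<dots> \<le> 1 - \<eta>"
    proof -
      have "0 \<le> 16 * \<eta>\<^sup>2 + 20 * \<eta> ^ 3" using \<eta> by simp
      then show ?thesis by linarith
    qed
    finally have "1 - 5 * \<eta> \<le> \<gamma>" unfolding \<gamma>_def using pos by (simp add: le_divide_eq)
    then show "\<delta> < \<gamma>" using \<delta> by (simp add: \<eta>_def field_simps)
    then show "0 < \<gamma>" using \<delta> by simp
  qed
  define \<theta> where "\<theta> = \<delta> / \<gamma>"
  have \<theta>: "0 < \<theta>" "\<theta> < 1" using \<delta> \<gamma> by (auto simp: \<theta>_def)
  obtain M where M: "0 < M" "\<theta> < integral {-M..M} sech_kernel" using sech_kernel_mass[OF \<theta>(2)] by blast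
  define m where "m = integral {-M..M} sech_kernel"
  define A where "A = M + M * m / (m - \<theta>)"
  have "0 < M * m / (m - \<theta>)" using M \<theta> by (intro divide_pos_pos mult_pos_pos) (auto simp: m_def)
  then have A: "0 < A" using M by (simp add: A_def)
  note repr = tent_reproduced[OF M(1) \<theta>(1) _ m_def, of A]
  obtain d where d: "0 < d" "d \<le> \<eta> * b / 2" and
    low: "\<And>h \<rho> \<sigma>. \<lbrakk>0 < h; 0 < \<rho>; 0 < \<sigma>; h + \<rho> < d; \<sigma> < d; 3 * h \<le> \<eta> * \<rho>\<rbrakk> \<Longrightarrow>
      (b - h) / pi * \<gamma> * (sqrt (\<sigma> / \<rho>) / (\<rho> + \<sigma>)) \<le> K1 (b - h) (1 - \<rho> / (b - h)) (1 - \<sigma> / (b - h))"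
    using K1_lower_bound[OF \<eta>] unfolding \<gamma>_def by metis
  \<comment> \<open>The apex of the tent on the logarithmic scale, placed so that the support of
    half-width \<open>A\<close>, widened by the window \<open>M\<close>, stays within distance
    \<open>d / 2\<close> of the endpoint. Then \<open>h\<close> is chosen small against the smallest
    distance in the support.\<close>
  define \<rho>0 where "\<rho>0 = d / 2 * exp (- (A + M))"
  have \<rho>0: "0 < \<rho>0" "\<rho>0 * exp (A + M) = d / 2" using d by (auto simp: \<rho>0_def mult_exp_exp)
  define h where "h = min (d / 4) (\<eta> * (\<rho>0 * exp (- A)) / 3)"
  have h: "0 < h" "h \<le> d / 4" "3 * h \<le> \<eta> * (\<rho>0 * exp (- A))" using d \<eta> \<rho>0 by (auto simp: h_def)
  have "\<eta> * b \<le> 1 / 2 * b" using \<eta> b by (intro mult_right_mono) auto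
  then have db: "d \<le> b / 4" using d by simp
  define e where "e = b - h"
  have e: "0 < e" "e < b" "d < e" using h d db b by (auto simp: e_def)
  \<comment> \<open>The cut-off avoids a logarithm and a quotient at distance 0. It does not alter
    the function, because the tent vanishes below \<open>\<rho>0 * exp (- A)\<close>.\<close>
  define \<rho>' where "\<rho>' t = max (e * (1 - t)) (\<rho>0 * exp (- A))" for t
  \<comment> \<open>Division by the distance turns the measure \<open>d\<sigma>\<close> into the
    logarithmic measure, on which the limiting operator acts as a convolution.\<close>
  define v0 where "v0 t = tent A (ln (\<rho>' t / \<rho>0)) / \<rho>' t" for t
  have \<rho>'pos: "0 < \<rho>' t" for t unfolding \<rho>'_def using \<rho>0 by (simp add: less_max_iff_disj)
  have v0c: "continuous_on S v0" for S
  proof -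
    have c: "continuous_on S \<rho>'" unfolding \<rho>'_def by (intro continuous_intros)
    have "\<rho>' t \<noteq> 0" "\<rho>' t / \<rho>0 \<noteq> 0" for t using \<rho>'pos[of t] \<rho>0 by auto
    then show ?thesis unfolding v0_def[abs_def]
      by (intro continuous_intros continuous_on_compose2[OF tent_continuous[of UNIV]] c) (use \<rho>0 in auto)
  qed
  have v0nn: "0 \<le> v0 t" for t unfolding v0_def using \<rho>'pos[of t] by (simp add: tent_def)
  have v0_eq: "v0 t = tent A (ln (e * (1 - t) / \<rho>0)) / (e * (1 - t))" if t: "0 < e * (1 - t)" for t
  proof (cases "\<rho>0 * exp (- A) \<le> e * (1 - t)")
    case True
    then show ?thesis by (simp add: v0_def \<rho>'_def max_absorb1)
  next
    case False
    then have "e * (1 - t) / \<rho>0 < exp (- A)" using \<rho>0 by (simp add: divide_less_eq mult.commute)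
    then have "ln (e * (1 - t) / \<rho>0) < - A" using t \<rho>0 by (metis divide_pos_pos exp_gt_zero ln_exp ln_less_cancel_iff)
    then have "tent A (ln (e * (1 - t) / \<rho>0)) = 0" using A by (simp add: tent_def)
    moreover have "v0 t = 0" using False \<rho>0 A by (simp add: v0_def \<rho>'_def max_absorb2 tent_def)
    ultimately show ?thesis by simp
  qed
  interpret positive_kernel K e by (rule positive_kernel_K[OF e(1,2)])
  have eI: "e \<in> {0..e}" using e by simp
  have main: "\<delta> * v0 x \<le> T e v0 x" if x: "x \<in> {-1..1}" for x
  proof (cases "v0 x = 0")
    case True
    then show ?thesis using T_nonneg[OF v0c eI x v0nn] by simp
  next
    case False
    define \<rho> where "\<rho> = e * (1 - x)"
    have r1: "\<rho>0 * exp (- A) < \<rho>"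
    proof (rule ccontr)
      assume "\<not> \<rho>0 * exp (- A) < \<rho>"
      then have "v0 x = 0" using \<rho>0 A by (simp add: v0_def \<rho>'_def \<rho>_def max_absorb2 tent_def)
      then show False using False by simp
    qed
    have \<rho>: "0 < \<rho>" using r1 \<rho>0 by (meson exp_gt_zero less_trans mult_pos_pos)
    define \<tau> where "\<tau> = ln (\<rho> / \<rho>0)"
    have vx: "v0 x = tent A \<tau> / \<rho>" using v0_eq[of x] \<rho> by (simp add: \<rho>_def \<tau>_def)
    have "tent A \<tau> \<noteq> 0" using False vx by auto
    then have "\<tau> < A" by (auto simp: tent_def max_def split: if_splits)
    then have "\<rho> / \<rho>0 < exp A" using \<rho> \<rho>0 by (metis \<tau>_def divide_pos_pos exp_less_cancel_iff exp_ln)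
    then have r2: "\<rho> < \<rho>0 * exp A" using \<rho>0 by (simp add: divide_less_eq mult.commute)
    have xe: "x = 1 - \<rho> / e" using e by (simp add: \<rho>_def)
    \<comment> \<open>The substitution \<open>\<sigma> = \<rho> * exp (- \<xi>)\<close>: the
      variable of integration becomes the logarithm of the ratio of the distances.\<close>
    define g where "g \<xi> = 1 - \<rho> / e * exp (- \<xi>)" for \<xi>
    have \<sigma>d: "\<rho> * exp (- \<xi>) < d / 2" if "\<xi> \<in> {-M..M}" for \<xi>
    proof -
      have "\<rho> * exp (- \<xi>) \<le> \<rho> * exp M" using \<rho> that by (intro mult_left_mono) auto
      also have "\<dots> < (\<rho>0 * exp A) * exp M" using r2 by simp
      also have "\<dots> = d / 2" using \<rho>0(2) by (simp add: exp_add mult.assoc)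
      finally show ?thesis .
    qed
    have gI: "g \<xi> \<in> {-1..1}" if "\<xi> \<in> {-M..M}" for \<xi>
    proof -
      have "\<rho> / e * exp (- \<xi>) \<le> 1" using \<sigma>d[OF that] d e by (simp add: divide_le_eq)
      moreover have "0 < \<rho> / e * exp (- \<xi>)" using \<rho> e by simp
      ultimately show ?thesis by (simp add: g_def)
    qed
    define F where "F t = K1 e x t * v0 t" for t
    have xI': "- x \<in> {-1..1}" using x by auto
    have K1c: "continuous_on {-1..1} (\<lambda>t. K1 e x t)"
      by (rule continuous_on_via[OF K1_continuous[OF e(2)], where f = "\<lambda>t. (e, x, t)"])
         (use x e in \<open>auto intro!: continuous_intros\<close>)
    have Fc: "continuous_on {-1..1} F" unfolding F_def by (intro continuous_intros K1c v0c)
    have Fnn: "0 \<le> F t" if "t \<in> {-1..1}" for t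
      unfolding F_def using K1_nonneg[of e x t] that x e v0nn by (intro mult_nonneg_nonneg) auto
    \<comment> \<open>The reflected half of the kernel is nonnegative and is dropped; next the
      integral is restricted to the window around \<open>x\<close>.\<close>
    have "integral {-1..1} F \<le> T e v0 x"
      unfolding T_def
    proof (rule integral_le)
      show "F integrable_on {-1..1}" by (rule integrable_continuous_real[OF Fc])
      show "(\<lambda>t. K e x t * v0 t) integrable_on {-1..1}" by (rule integrable[OF eI x v0c])
      fix t :: real assume t: "t \<in> {-1..1}"
      have "0 \<le> K1 e (- x) (- t)" using K1_nonneg[of e "- x" "- t"] t x e by auto
      then show "F t \<le> K e x t * v0 t" unfolding F_def K_def using v0nn by (intro mult_right_mono) auto
    qed
    moreover have "integral {g (-M)..g M} F \<le> integral {-1..1} F"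
      using gI M Fnn
      by (intro integral_subset_le integrable_continuous_real Fc continuous_on_subset[OF Fc]) auto
    moreover have "integral {g (-M)..g M} F = integral {-M..M} (\<lambda>\<xi>. (\<rho> / e * exp (- \<xi>)) *\<^sub>R F (g \<xi>))"
    proof (rule integral_unique[symmetric], rule has_integral_substitution[where c = "-1" and d = 1])
      show "g (-M) \<le> g M" unfolding g_def using \<rho> e M by (simp add: divide_right_mono mult_left_mono)
      show "(g has_real_derivative \<rho> / e * exp (- \<xi>)) (at \<xi> within {-M..M})" for \<xi>
        unfolding g_def[abs_def] using e by (auto intro!: derivative_eq_intros)
    qed (use M gI Fc in auto)
    moreover have "integral {-M..M} (\<lambda>\<xi>. \<gamma> / \<rho> * (sech_kernel \<xi> * tent A (\<tau> - \<xi>))) \<le>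
        integral {-M..M} (\<lambda>\<xi>. (\<rho> / e * exp (- \<xi>)) *\<^sub>R F (g \<xi>))"
    proof (rule integral_le)
      show "(\<lambda>\<xi>. \<gamma> / \<rho> * (sech_kernel \<xi> * tent A (\<tau> - \<xi>))) integrable_on {-M..M}"
        by (intro integrable_continuous_real continuous_intros sech_kernel_continuous
            continuous_on_compose2[OF tent_continuous[of UNIV]]) auto
      have "continuous_on {-M..M} g" unfolding g_def by (intro continuous_intros) (use e in auto)
      then show "(\<lambda>\<xi>. (\<rho> / e * exp (- \<xi>)) *\<^sub>R F (g \<xi>)) integrable_on {-M..M}"
        using gI e by (intro integrable_continuous_real continuous_intros continuous_on_compose2[OF Fc]) auto
      fix \<xi> assume \<xi>: "\<xi> \<in> {-M..M}"
      define \<sigma> where "\<sigma> = \<rho> * exp (- \<xi>)"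
      have \<sigma>: "0 < \<sigma>" "\<sigma> < d / 2" using \<rho> \<sigma>d[OF \<xi>] by (auto simp: \<sigma>_def)
      have g\<sigma>: "g \<xi> = 1 - \<sigma> / e" by (simp add: g_def \<sigma>_def)
      have eg: "e * (1 - g \<xi>) = \<sigma>" using e by (simp add: g\<sigma>)
      have \<rho>d: "\<rho> < d / 2" using \<sigma>d[of 0] M by simp
      have K: "e / pi * \<gamma> * (sqrt (\<sigma> / \<rho>) / (\<rho> + \<sigma>)) \<le> K1 e x (g \<xi>)"
        unfolding g\<sigma> xe unfolding e_def
      proof (rule low[OF h(1) \<rho> \<sigma>(1)])
        show "h + \<rho> < d" using h \<rho>d d by simp
        show "\<sigma> < d" using \<sigma> d by simp
        have "\<eta> * (\<rho>0 * exp (- A)) \<le> \<eta> * \<rho>" using r1 \<eta> by (intro mult_left_mono) auto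
        then show "3 * h \<le> \<eta> * \<rho>" using h by simp
      qed
      have ln: "ln (\<sigma> / \<rho>0) = \<tau> - \<xi>"
      proof -
        have "\<sigma> / \<rho>0 = (\<rho> / \<rho>0) * exp (- \<xi>)" by (simp add: \<sigma>_def)
        also have "ln \<dots> = ln (\<rho> / \<rho>0) + ln (exp (- \<xi>))"
          by (rule ln_mult_pos) (use \<rho> \<rho>0 in auto)
        finally show ?thesis by (simp add: \<tau>_def)
      qed
      have v: "v0 (g \<xi>) = tent A (\<tau> - \<xi>) / \<sigma>" using v0_eq[of "g \<xi>"] \<sigma> unfolding eg ln by simp
      have sq: "sqrt (\<sigma> / \<rho>) / (\<rho> + \<sigma>) = pi * sech_kernel \<xi> / \<rho>"
      proof -
        have "sqrt (\<sigma> / \<rho>) = exp (- \<xi> / 2)"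
        proof -
          have "\<sigma> / \<rho> = (exp (- \<xi> / 2))\<^sup>2" unfolding exp_half_squared using \<rho> by (simp add: \<sigma>_def)
          then show ?thesis by simp
        qed
        moreover have "\<rho> + \<sigma> = \<rho> * (1 + exp (- \<xi>))" by (simp add: \<sigma>_def algebra_simps)
        ultimately show ?thesis by (simp add: sech_kernel_def)
      qed
      have "\<gamma> / \<rho> * (sech_kernel \<xi> * tent A (\<tau> - \<xi>)) = e / pi * \<gamma> * (sqrt (\<sigma> / \<rho>) / (\<rho> + \<sigma>)) * (tent A (\<tau> - \<xi>) / e)"
        unfolding sq using e by simp
      also have "\<dots> \<le> K1 e x (g \<xi>) * (tent A (\<tau> - \<xi>) / e)"
        using K e by (intro mult_right_mono) (auto simp: tent_def)
      also have "\<dots> = (\<rho> / e * exp (- \<xi>)) *\<^sub>R F (g \<xi>)"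
        unfolding F_def v using \<sigma> \<rho> by (simp add: \<sigma>_def)
      finally show "\<gamma> / \<rho> * (sech_kernel \<xi> * tent A (\<tau> - \<xi>)) \<le> (\<rho> / e * exp (- \<xi>)) *\<^sub>R F (g \<xi>)" .
    qed
    moreover have "\<delta> * v0 x \<le> integral {-M..M} (\<lambda>\<xi>. \<gamma> / \<rho> * (sech_kernel \<xi> * tent A (\<tau> - \<xi>)))"
    proof -
      have "\<gamma> / \<rho> * (\<theta> * tent A \<tau>) \<le> \<gamma> / \<rho> * integral {-M..M} (\<lambda>\<xi>. sech_kernel \<xi> * tent A (\<tau> - \<xi>))"
        using repr[of \<tau>] M \<gamma> \<rho> by (intro mult_left_mono) (auto simp: m_def A_def)
      moreover have "\<gamma> / \<rho> * (\<theta> * tent A \<tau>) = \<delta> * v0 x" using \<gamma> by (simp add: vx \<theta>_def)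
      ultimately show ?thesis by simp
    qed
    ultimately show ?thesis by linarith
  qed
  have "sub \<delta> e v0"
    unfolding sub_def
  proof (intro conjI ballI v0c v0nn main)
    have "0 < v0 (1 - \<rho>0 / e)"
      using v0_eq[of "1 - \<rho>0 / e"] e \<rho>0 A by (simp add: tent_def)
    moreover have "1 - \<rho>0 / e \<in> {-1..1}"
    proof -
      have "\<rho>0 * 1 \<le> \<rho>0 * exp (A + M)" using \<rho>0 A M by (intro mult_left_mono) auto
      then have "\<rho>0 \<le> e" using \<rho>0 e d by simp
      then show ?thesis using \<rho>0 e by (simp add: divide_le_eq)
    qed
    ultimately show "\<exists>t\<in>{-1..1}. 0 < v0 t" by blast
  qed
  then show ?thesis using that e by blast
qed

end

section \<open>Eigenfunctions of the integral equation\<close>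

context cubic
begin

text \<open>Since \<open>disc\<close> is even, \<open>f X\<close> and \<open>- f (- X)\<close> are
  the two roots of the residual quadratic; its sum and product of roots give the
  factorisation.\<close>

lemma three_preimages:
  assumes X: "\<bar>X\<bar> < b"
  shows "T * (T\<^sup>2 - \<kappa>) - r X * (T\<^sup>2 - 1) = (T - X) * (T - f X) * (T + f (- X))"
proof -
  have Xc: "\<bar>X\<bar> < c" "\<bar>- X\<bar> < c" using X order_points by auto
  note R = range_facts[OF Xc(1)]
  have n: "X\<^sup>2 - 1 \<noteq> 0" "1 - X\<^sup>2 \<noteq> 0" using R by auto
  have D: "disc (- X) = disc X" by (simp add: disc_def)
  have p: "2 * (1 - X\<^sup>2) * f X = sqrt (disc X) - (1 - \<kappa>) * X"
    using f_root[OF Xc(1)] by simp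
  have m: "2 * (1 - X\<^sup>2) * f (- X) = sqrt (disc X) + (1 - \<kappa>) * X"
    using f_root[OF Xc(2)] D by simp
  have s: "(1 - X\<^sup>2) * (f X - f (- X)) = - (1 - \<kappa>) * X"
    using p m by (simp add: algebra_simps)
  have "4 * (1 - X\<^sup>2) * ((1 - X\<^sup>2) * (f X * f (- X))) = (2 * (1 - X\<^sup>2) * f X) * (2 * (1 - X\<^sup>2) * f (- X))"
    proof -
    have "4 * n * (n * (p * q)) = (2 * n * p) * (2 * n * q)" for n p q :: real by simp
    then show ?thesis .
  qed
  also have "\<dots> = disc X - ((1 - \<kappa>) * X)\<^sup>2"
    unfolding p m using R by (simp add: algebra_simps power2_eq_square)
  also have "\<dots> = 4 * (1 - X\<^sup>2) * (\<kappa> - X\<^sup>2)" by (simp add: disc_def power_mult_distrib)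
  finally have q: "(1 - X\<^sup>2) * (f X * f (- X)) = \<kappa> - X\<^sup>2" using n by simp
  have rX: "r X * (X\<^sup>2 - 1) = X * (X\<^sup>2 - \<kappa>)" using n by (simp add: r_def)
  have "(X\<^sup>2 - 1) * (T * (T\<^sup>2 - \<kappa>) - r X * (T\<^sup>2 - 1)) = (X\<^sup>2 - 1) * (T * (T\<^sup>2 - \<kappa>)) - (r X * (X\<^sup>2 - 1)) * (T\<^sup>2 - 1)"
    by (simp add: algebra_simps)
  also have "\<dots> = - (T - X) * ((1 - X\<^sup>2) * T\<^sup>2 - (- (1 - \<kappa>) * X) * T - (\<kappa> - X\<^sup>2))"
    unfolding rX by (simp add: algebra_simps power2_eq_square)
  also have "\<dots> = - (T - X) * ((1 - X\<^sup>2) * T\<^sup>2 - ((1 - X\<^sup>2) * (f X - f (- X))) * T - (1 - X\<^sup>2) * (f X * f (- X)))"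
    unfolding s q ..
  also have "\<dots> = (X\<^sup>2 - 1) * ((T - X) * (T - f X) * (T + f (- X)))"
    by (simp add: algebra_simps power2_eq_square)
  finally show ?thesis using n(1) by simp
qed

text \<open>This is the logarithmic derivative of \<open>r T - r X\<close>: each zero contributes a
  simple fraction with plus sign, and the poles \<plusminus>1 contribute the last term, which does
  not depend on \<open>X\<close>.\<close>

lemma logarithmic_derivative:
  assumes X: "\<bar>X\<bar> < b" and T: "T\<^sup>2 \<noteq> 1" "T \<noteq> X" "T \<noteq> f X" "T \<noteq> - f (- X)"
  shows "(T\<^sup>2 - b\<^sup>2) * (T\<^sup>2 - B\<^sup>2) / (T\<^sup>2 - 1)\<^sup>2 / (r T - r X) =
     1 / (T - X) + (1 / (T - f X) + 1 / (T + f (- X)) - 2 * T / (T\<^sup>2 - 1))"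
proof -
  define P where "P t = (t - X) * (t - f X) * (t + f (- X))" for t
  define P' where "P' t = (t - f X) * (t + f (- X)) + (t - X) * (t + f (- X)) + (t - X) * (t - f X)" for t
  have n: "T\<^sup>2 - 1 \<noteq> 0" using T by simp
  have nz: "T - X \<noteq> 0" "T - f X \<noteq> 0" "T + f (- X) \<noteq> 0" using T by auto
  then have P0: "P T \<noteq> 0" by (simp add: P_def)
  have rP: "r t - r X = P t / (t\<^sup>2 - 1)" if "t\<^sup>2 \<noteq> 1" for t
  proof -
    have "t\<^sup>2 - 1 \<noteq> 0" using that by simp
    then have "r t - r X = (t * (t\<^sup>2 - \<kappa>) - r X * (t\<^sup>2 - 1)) / (t\<^sup>2 - 1)"
      by (simp add: r_def diff_divide_distrib)
    then show ?thesis unfolding three_preimages[OF X] P_def .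
  qed
  have dP: "((\<lambda>t. P t / (t\<^sup>2 - 1)) has_real_derivative (P' T * (T\<^sup>2 - 1) - P T * (2 * T)) / ((T\<^sup>2 - 1) * (T\<^sup>2 - 1))) (at T)"
  proof (rule DERIV_divide)
    show "T\<^sup>2 - 1 \<noteq> 0" by (rule n)
    show "(P has_real_derivative P' T) (at T)"
      unfolding P_def[abs_def] P'_def by (rule derivative_eq_intros refl | simp add: algebra_simps)+
    show "((\<lambda>t. t\<^sup>2 - 1) has_real_derivative 2 * T) (at T)"
      by (rule derivative_eq_intros refl | simp)+
  qed
  have "((\<lambda>t. r t - r X) has_real_derivative (P' T * (T\<^sup>2 - 1) - P T * (2 * T)) / ((T\<^sup>2 - 1) * (T\<^sup>2 - 1))) (at T)"
  proof (rule has_field_derivative_transform_within_open[OF dP, of "- {1, -1}"])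
    show "open (- {1, -1 :: real})" by (simp add: open_Compl finite_imp_closed)
    show "T \<in> - {1, -1}" using T(1) by auto
    fix t :: real assume "t \<in> - {1, -1}"
    then show "P t / (t\<^sup>2 - 1) = r t - r X" using rP[of t] by (auto simp: power2_eq_1_iff)
  qed
  moreover have "((\<lambda>t. r t - r X) has_real_derivative (T\<^sup>2 - b\<^sup>2) * (T\<^sup>2 - B\<^sup>2) / (T\<^sup>2 - 1)\<^sup>2 - 0) (at T)"
    by (rule DERIV_diff[OF r_derivative[OF T(1)] DERIV_const])
  ultimately have "(T\<^sup>2 - b\<^sup>2) * (T\<^sup>2 - B\<^sup>2) / (T\<^sup>2 - 1)\<^sup>2 - 0 = (P' T * (T\<^sup>2 - 1) - P T * (2 * T)) / ((T\<^sup>2 - 1) * (T\<^sup>2 - 1))"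
    using DERIV_unique by blast
  then have L: "(T\<^sup>2 - b\<^sup>2) * (T\<^sup>2 - B\<^sup>2) / (T\<^sup>2 - 1)\<^sup>2 / (r T - r X) =
      (P' T * (T\<^sup>2 - 1) - P T * (2 * T)) / ((T\<^sup>2 - 1) * (T\<^sup>2 - 1)) / (P T / (T\<^sup>2 - 1))"
    unfolding rP[OF T(1)] by simp
  have "(a * d - p * t) / (d * d) / (p / d) = a / p - t / d" if "d \<noteq> 0" "p \<noteq> 0" for a d p t :: real
    using that by (simp add: field_simps)
  from this[OF n P0] have "(T\<^sup>2 - b\<^sup>2) * (T\<^sup>2 - B\<^sup>2) / (T\<^sup>2 - 1)\<^sup>2 / (r T - r X) = P' T / P T - 2 * T / (T\<^sup>2 - 1)"
    unfolding L .
  moreover have "P' T / P T = 1 / (T - X) + 1 / (T - f X) + 1 / (T + f (- X))"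
  proof -
    have "(y * z + x * z + x * y) / (x * y * z) = 1 / x + 1 / y + 1 / z" if "x \<noteq> 0" "y \<noteq> 0" "z \<noteq> 0" for x y z :: real
      using that by (simp add: add_divide_distrib)
    from this[OF nz] show ?thesis unfolding P_def P'_def .
  qed
  ultimately show ?thesis by (simp only: add.assoc add_diff_eq)
qed

end

context scaled_cubic
begin

lemma kernel_partial_fractions:
  assumes x: "x \<in> {-1..1}" and t: "t \<in> {-1..1}" and tx: "t \<noteq> x"
  shows "deriv (rat_fun R) t / (rat_fun R t - rat_fun R x) =
     1 / (t - x) + (1 / (t - f (e * x) / e) + 1 / (t + f (- (e * x)) / e) - 2 * e\<^sup>2 * t / ((e * t)\<^sup>2 - 1))"
proof -
  have X: "\<bar>e * x\<bar> < b" "\<bar>- (e * x)\<bar> < b" using eY2[OF x] by auto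
  have T: "(e * t)\<^sup>2 \<noteq> 1" "\<bar>e * t\<bar> < b" using eY2[OF t] by auto
  have e0: "e \<noteq> 0" using e by simp
  have n: "e * t \<noteq> e * x" "e * t \<noteq> f (e * x)" "e * t \<noteq> - f (- (e * x))"
    using tx e0 f_bounds(1)[OF X(1)] f_bounds(1)[OF X(2)] T(2) by auto
  have "deriv (rat_fun R) t / (rat_fun R t - rat_fun R x) =
     e * (((e * t)\<^sup>2 - b\<^sup>2) * ((e * t)\<^sup>2 - B\<^sup>2) / ((e * t)\<^sup>2 - 1)\<^sup>2 / (r (e * t) - r (e * x)))"
    unfolding DERIV_imp_deriv[OF rat_fun_derivative(1)[OF t]] rat_fun_R diff_divide_distrib[symmetric] using re by simp
  also have "\<dots> = e * (1 / (e * t - e * x) + (1 / (e * t - f (e * x)) + 1 / (e * t + f (- (e * x))) - 2 * (e * t) / ((e * t)\<^sup>2 - 1)))"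
    unfolding logarithmic_derivative[OF X(1) T(1) n] ..
  also have "\<dots> = e / (e * t - e * x) + (e / (e * t - f (e * x)) + e / (e * t + f (- (e * x))) - e * (2 * (e * t)) / ((e * t)\<^sup>2 - 1))"
    by (simp add: distrib_left right_diff_distrib)
  also have "e / (e * t - e * x) = 1 / (t - x)"
    using e0 by (simp add: right_diff_distrib[symmetric])
  also have "e / (e * t - f (e * x)) = 1 / (t - f (e * x) / e)"
  proof -
    have "e * t - f (e * x) = e * (t - f (e * x) / e)" using e0 by (simp add: right_diff_distrib)
    then show ?thesis using e0 by simp
  qed
  also have "e / (e * t + f (- (e * x))) = 1 / (t + f (- (e * x)) / e)"
  proof -
    have "e * t + f (- (e * x)) = e * (t + f (- (e * x)) / e)" using e0 by (simp add: distrib_left)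
    then show ?thesis using e0 by simp
  qed
  also have "e * (2 * (e * t)) = 2 * e\<^sup>2 * t" by (simp add: power2_eq_square)
  finally show ?thesis .
qed

lemma PS_eigenvalue_from_kernel:
  assumes \<delta>: "0 < \<delta>" and v: "continuous_on {-1..1} v" "\<And>x. x \<in> {-1..1} \<Longrightarrow> 0 < v x"
    and eigen: "\<And>x. x \<in> {-1..1} \<Longrightarrow> integral {-1..1} (\<lambda>t. K e x t * v t) = \<delta> * v x"
  shows "PS_eigenvalue (\<delta> + 1) R"
proof -
  have e0: "0 \<le> e" using e by simp
  \<comment> \<open>The index \<open>True\<close> stands for the preimage \<open>f\<close>,
    \<open>False\<close> for its mirror image; the sign puts the coordinate of the latter on the
    negative side of the disc.\<close>
  define S where "S i x = (if i then s e x else - s e (- x))" for i :: bool and x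
  define S' where "S' i x = (if i then s' e x else s' e (- x))" for i :: bool and x
  obtain s'' where s'': "continuous_on {-1..1} s''" "\<And>x. x \<in> {-1..1} \<Longrightarrow> (s' e has_real_derivative s'' x) (at x)"
    using s'_derivative[OF e0 e(2)] by blast
  define S'' where "S'' i x = (if i then s'' x else - s'' (- x))" for i :: bool and x
  have mx: "- x \<in> {-1..1}" if "x \<in> {-1..1}" for x :: real using that by auto
  have refl: "((\<lambda>x. g (- x)) has_real_derivative - D) (at x)" if "(g has_real_derivative D) (at (- x))" for g D and x :: real
    using DERIV_compose_scale[of g D "- 1" x] that by simp
  have Srange: "\<bar>S i x\<bar> < 1" if "x \<in> {-1..1}" for i x
    using s_range(1,2)[OF e0 e(2) that] s_range(1,2)[OF e0 e(2) mx[OF that]] by (auto simp: S_def)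
  have dS: "(S i has_real_derivative S' i x) (at x within {-1..1})" if x: "x \<in> {-1..1}" for i x
  proof (cases i)
    case True
    then show ?thesis using s_derivative[OF e0 e(2) x]
      by (simp add: S_def[abs_def] S'_def has_field_derivative_at_within)
  next
    case False
    from DERIV_minus[OF refl[OF s_derivative[OF e0 e(2) mx[OF x]]]]
    show ?thesis using False by (simp add: S_def[abs_def] S'_def has_field_derivative_at_within)
  qed
  have dS': "(S' i has_real_derivative S'' i x) (at x within {-1..1})" if x: "x \<in> {-1..1}" for i x
  proof (cases i)
    case True
    then show ?thesis using s''(2)[OF x]
      by (simp add: S'_def[abs_def] S''_def has_field_derivative_at_within)
  next
    case False
    from refl[OF s''(2)[OF mx[OF x]]]
    show ?thesis using False by (simp add: S'_def[abs_def] S''_def has_field_derivative_at_within)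
  qed
  have S''c: "continuous_on {-1..1} (S'' i)" for i
  proof (cases i)
    case True
    then show ?thesis using s''(1) by (simp add: S''_def[abs_def])
  next
    case False
    have "continuous_on {-1..1} (\<lambda>x. - s'' (- x))"
      by (intro continuous_intros continuous_on_compose2[OF s''(1)]) auto
    then show ?thesis using False by (simp add: S''_def[abs_def])
  qed
  have kernel: "\<delta> * v x = (\<Sum>i\<in>UNIV. S' i x * (2 / pi * integral {-1..1} (\<lambda>t. sqrt (1 - t\<^sup>2) * v t / (1 - 2 * S i x * t + (S i x)\<^sup>2))))"
    if x: "x \<in> {-1..1}" for x
  proof -
    define G where "G i t = sqrt (1 - t\<^sup>2) * v t / (1 - 2 * S i x * t + (S i x)\<^sup>2)" for i t
    have den: "1 - 2 * S i x * t + (S i x)\<^sup>2 \<noteq> 0" if t: "t \<in> {-1..1}" for i t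
      using kernel_denominator_pos[OF s_range(1,2)[OF e0 e(2) x] t]
        kernel_denominator_pos[OF s_range(1,2)[OF e0 e(2) mx[OF x]] mx[OF t]] by (auto simp: S_def)
    have Gi: "(G i has_integral integral {-1..1} (G i)) {-1..1}" for i
      unfolding G_def using den
      by (intro integrable_integral integrable_continuous_real continuous_intros v) auto
    have Keq: "K e x t * v t = S' True x * (2 / pi) * G True t + S' False x * (2 / pi) * G False t" for t
      by (simp add: K_def K1_def G_def S_def S'_def algebra_simps)
    have "((\<lambda>t. K e x t * v t) has_integral
        (S' True x * (2 / pi) * integral {-1..1} (G True) + S' False x * (2 / pi) * integral {-1..1} (G False))) {-1..1}"
      unfolding Keq by (intro has_integral_add has_integral_mult_right Gi)
    then have "\<delta> * v x = S' True x * (2 / pi) * integral {-1..1} (G True) + S' False x * (2 / pi) * integral {-1..1} (G False)"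
      using eigen[OF x] by (simp add: integral_unique)
    then show ?thesis by (simp add: G_def[abs_def] UNIV_bool mult.assoc)
  qed
  obtain cc C k where cc: "cc 0 = 0" "\<And>n. \<bar>cc (Suc n)\<bar> \<le> C / (real (Suc n))\<^sup>2" "\<exists>n. cc n \<noteq> 0"
    "\<And>\<theta>. \<theta> \<in> {0..pi} \<Longrightarrow>
        \<delta> * (\<Sum>n. cc n * cos (real n * \<theta>)) = (\<Sum>i\<in>UNIV. \<Sum>n. cc n * S i (cos \<theta>) ^ n) + k"
  proof (rule eigenfunction_sine_series)
    show "finite (UNIV :: bool set)" by simp
    show "\<delta> \<noteq> 0" using \<delta> by simp
    show "continuous_on {-1..1} v" by (rule v(1))
    show "0 < v x" if "x \<in> {-1..1}" for x using v(2) that .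
    show "\<bar>S i x\<bar> < 1" if "i \<in> UNIV" "x \<in> {-1..1}" for i x using Srange that(2) .
    show "(S i has_real_derivative S' i x) (at x within {-1..1})" if "i \<in> UNIV" "x \<in> {-1..1}" for i x
      using dS that(2) .
    show "(S' i has_real_derivative S'' i x) (at x within {-1..1})" if "i \<in> UNIV" "x \<in> {-1..1}" for i x
      using dS' that(2) .
    show "continuous_on {-1..1} (S'' i)" for i by (rule S''c)
    show "\<delta> * v x = (\<Sum>i\<in>UNIV. S' i x * (2 / pi * integral {-1..1} (\<lambda>t. sqrt (1 - t\<^sup>2) * v t / (1 - 2 * S i x * t + (S i x)\<^sup>2))))" if "x \<in> {-1..1}" for x
      by (rule kernel[OF that])
    fix cc C k
    assume "cc 0 = 0" "\<And>n. \<bar>cc (Suc n)\<bar> \<le> C / (real (Suc n))\<^sup>2" "\<exists>n. cc n \<noteq> 0"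
    "\<And>\<theta>. \<theta> \<in> {0..pi} \<Longrightarrow>
        \<delta> * (\<Sum>n. cc n * cos (real n * \<theta>)) = (\<Sum>i\<in>UNIV. \<Sum>n. cc n * S i (cos \<theta>) ^ n) + k"
    then show thesis by (rule that)
  qed
  interpret ss: sine_series cc C by unfold_locales (use cc in auto)
  \<comment> \<open>The contribution of the finite poles. It is independent of \<open>x\<close>, so
    its integral goes into the constant on the right-hand side.\<close>
  define g0 where "g0 t = ss.u t * (2 * e\<^sup>2 * t / ((e * t)\<^sup>2 - 1))" for t
  have g0c: "continuous_on {-1..1} g0"
    unfolding g0_def using eY2 by (intro continuous_intros ss.u_continuous) auto
  have outer: "(\<lambda>t. ss.u t / (t - z)) integrable_on {-1..1} \<and> integral {-1..1} (\<lambda>t. ss.u t / (t - z)) = (\<Sum>n. cc n * w ^ n)"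
    if w: "\<bar>w\<bar> < 1" "w \<noteq> 0" and z: "(w + 1 / w) / 2 = z" "1 < \<bar>z\<bar>" for w z
  proof -
    have c: "continuous_on {-1..1} (\<lambda>t. ss.u t / (t - z))"
      by (intro continuous_intros ss.u_continuous) (use z in auto)
    then have i: "(\<lambda>t. ss.u t / (t - z)) integrable_on {-1..1}" by (rule integrable_continuous_real)
    have zc: "(complex_of_real w + 1 / complex_of_real w) / 2 = of_real z" unfolding z(1)[symmetric] by simp
    have "cauchy_integral ss.u (of_real z) = of_real (integral {-1..1} (\<lambda>t. ss.u t / (t - z)))"
    proof -
      have "((\<lambda>t. complex_of_real (ss.u t / (t - z))) has_integral of_real (integral {-1..1} (\<lambda>t. ss.u t / (t - z)))) {-1..1}"
        by (intro has_integral_of_real integrable_integral i)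
      then show ?thesis unfolding cauchy_integral_def by (simp add: integral_unique)
    qed
    moreover have "cauchy_integral ss.u (of_real z) = of_real (\<Sum>n. cc n * w ^ n)"
      using ss.cauchy_integral_u[of "of_real w"] ss.P_real[OF w(1)] w unfolding zc by simp
    ultimately show ?thesis using i by (metis of_real_eq_iff)
  qed
  have "PS_solution (\<delta> + 1) R ss.u"
    unfolding PS_solution_def
  proof (intro conjI ss.u_hoelder ss.hoelder_boundary_values_u, rule exI[of _ "k + integral {-1..1} g0"], rule ballI)
    fix x :: real assume x': "x \<in> {-1<..<1}"
    then have x: "x \<in> {-1..1}" by auto
    define \<theta> where "\<theta> = arccos x"
    have \<theta>: "\<theta> \<in> {0..pi}" "cos \<theta> = x" using x by (auto simp: \<theta>_def arccos_lbound arccos_ubound)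
    define I where "I = (\<Sum>n. cc n * cos (real n * \<theta>))"
    define p1 p2 where "p1 = (\<Sum>n. cc n * S True x ^ n)" and "p2 = (\<Sum>n. cc n * S False x ^ n)"
    have eq: "\<delta> * I = p1 + p2 + k"
      using cc(4)[OF \<theta>(1)] by (simp add: I_def p1_def p2_def \<theta>(2) UNIV_bool)
    have pvI: "has_pv_integral (\<lambda>t. ss.u t / (t - x)) (-1) 1 x I"
      unfolding I_def \<theta>_def by (rule ss.pv_u[OF x'])
    define z1 z2 where "z1 = f (e * x) / e" and "z2 = - (f (- (e * x)) / e)"
    have z1: "1 < z1" and z2: "z2 < -1"
      using f_bounds(1)[OF ex_range(2)[OF e0 e(2) x]] f_bounds(1)[OF ex_range(2)[OF e0 e(2) mx[OF x]]] e
      by (auto simp: z1_def z2_def less_divide_eq)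
    have o1: "(\<lambda>t. ss.u t / (t - z1)) integrable_on {-1..1} \<and> integral {-1..1} (\<lambda>t. ss.u t / (t - z1)) = p1"
      unfolding p1_def
    proof (rule outer)
      show "\<bar>S True x\<bar> < 1" by (rule Srange[OF x])
      show "S True x \<noteq> 0" using s_range(3)[OF e0 e(2) x e(1)] by (simp add: S_def)
      show "(S True x + 1 / S True x) / 2 = z1" using s_joukowski[OF e x] by (simp add: S_def z1_def)
    qed (use z1 in simp)
    have o2: "(\<lambda>t. ss.u t / (t - z2)) integrable_on {-1..1} \<and> integral {-1..1} (\<lambda>t. ss.u t / (t - z2)) = p2"
      unfolding p2_def
    proof (rule outer)
      show "\<bar>S False x\<bar> < 1" by (rule Srange[OF x])
      show "S False x \<noteq> 0" using s_range(3)[OF e0 e(2) mx[OF x] e(1)] by (simp add: S_def)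
      have "- ((s e (- x) + 1 / s e (- x)) / 2) = z2" using s_joukowski[OF e mx[OF x]] by (simp add: z2_def)
      moreover have "(- w + 1 / - w) / 2 = - ((w + 1 / w) / 2)" for w :: real
        by (simp add: add_divide_distrib diff_divide_distrib)
      ultimately show "(S False x + 1 / S False x) / 2 = z2" by (simp only: S_def if_False)
    qed (use z2 in simp)
    define g where "g t = ss.u t / (t - z1) + ss.u t / (t - z2) - g0 t" for t
    have gc: "continuous_on {-1..1} g"
      unfolding g_def by (intro continuous_intros ss.u_continuous g0c) (use z1 z2 in auto)
    have gi: "integral {-1..1} g = p1 + p2 - integral {-1..1} g0"
    proof -
      have "(g has_integral p1 + p2 - integral {-1..1} g0) {-1..1}"
        unfolding g_def using o1 o2 integrable_continuous_real[OF g0c]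
        by (intro has_integral_diff has_integral_add) (auto simp: has_integral_iff)
      then show ?thesis by (rule integral_unique)
    qed
    have pvJ: "has_pv_integral (\<lambda>t. ss.u t * deriv (rat_fun R) t / (rat_fun R t - rat_fun R x)) (-1) 1 x (I + integral {-1..1} g)"
    proof (rule has_pv_integral_add_continuous[OF pvI gc])
      fix t :: real assume t: "t \<in> {-1..1}" "t \<noteq> x"
      have "ss.u t * deriv (rat_fun R) t / (rat_fun R t - rat_fun R x)
          = ss.u t * (deriv (rat_fun R) t / (rat_fun R t - rat_fun R x))" by simp
      also have "\<dots> = ss.u t * (1 / (t - x) + (1 / (t - z1) + 1 / (t - z2) - 2 * e\<^sup>2 * t / ((e * t)\<^sup>2 - 1)))"
        unfolding kernel_partial_fractions[OF x t] by (simp add: z1_def z2_def)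
      also have "\<dots> = ss.u t / (t - x) + g t"
        by (simp add: g_def g0_def distrib_left right_diff_distrib)
      finally show "ss.u t * deriv (rat_fun R) t / (rat_fun R t - rat_fun R x) = ss.u t / (t - x) + g t" .
    qed
    \<comment> \<open>One copy of \<open>I\<close> cancels against the Cauchy kernel in the second
      integral. What remains is \<open>\<delta> * I - p1 - p2 = k\<close> together with the pole
      term.\<close>
    have "(\<delta> + 1) * I - (I + integral {-1..1} g) = k + integral {-1..1} g0"
      unfolding gi using eq by (simp add: algebra_simps)
    then show "\<exists>I J. has_pv_integral (\<lambda>t. ss.u t / (t - x)) (-1) 1 x I \<and>
        has_pv_integral (\<lambda>t. ss.u t * deriv (rat_fun R) t / (rat_fun R t - rat_fun R x)) (-1) 1 x J \<and>
        (\<delta> + 1) * I - J = k + integral {-1..1} g0"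
      using pvI pvJ by blast
  qed
  moreover obtain n where "cc n \<noteq> 0" using cc(3) by blast
  then have "\<exists>x\<in>{-1..1}. ss.u x \<noteq> 0" by (rule ss.u_nonzero)
  ultimately show ?thesis unfolding PS_eigenvalue_def by blast
qed

end

section \<open>Assembling the infinite family\<close>

lemma cubic_exists:
  assumes "0 < b" "b < 1"
  shows "cubic b (sqrt ((3 - b\<^sup>2) / (1 + b\<^sup>2)))"
proof
  have b2: "b\<^sup>2 < 1" "0 < 1 + b\<^sup>2" using assms by (auto simp: abs_square_less_1 add_pos_nonneg)
  then have "1 < (3 - b\<^sup>2) / (1 + b\<^sup>2)" by (simp add: less_divide_eq)
  then show "1 < sqrt ((3 - b\<^sup>2) / (1 + b\<^sup>2))" by simp
  show "(1 + b\<^sup>2) * (1 + (sqrt ((3 - b\<^sup>2) / (1 + b\<^sup>2)))\<^sup>2) = 4"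
    using b2 by (simp add: distrib_left less_imp_neq[OF b2(2), symmetric])
qed (use assms in auto)

lemma (in cubic) exists_PS_eigenvalue:
  assumes \<delta>: "0 < \<delta>" "\<delta> < 1"
  shows "\<exists>e. scaled_cubic b B e \<and> PS_eigenvalue (\<delta> + 1) (scaled_cubic.R b B e)"
proof -
  obtain e1 v0 where e1_bounds: "0 < e1" "e1 < b" and sub0: "positive_kernel.sub K \<delta> e1 v0"
    using subsolution[OF \<delta>] by blast
  interpret positive_kernel K e1 by (rule positive_kernel_K[OF e1_bounds])
  obtain e v where e: "e \<in> {0<..e1}" and v: "continuous_on {-1..1} v" "\<And>x. x \<in> {-1..1} \<Longrightarrow> 0 < v x"
    "\<And>x. x \<in> {-1..1} \<Longrightarrow> T e v x = \<delta> * v x"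
    using eigenvalue_attained[OF \<delta>(1) sub0] by blast
  interpret sc: scaled_cubic b B e by unfold_locales (use e e1_bounds(2) in auto)
  have "PS_eigenvalue (\<delta> + 1) sc.R"
    by (rule sc.PS_eigenvalue_from_kernel[OF \<delta>(1) v(1,2)]) (use v(3) in \<open>auto simp: T_def\<close>)
  then show ?thesis using sc.scaled_cubic_axioms by blast
qed

text \<open>Reflexivity turns gauge inequivalence for distinct \<open>b\<close> into injectivity of
  the parametrisation, and hence into infinitely many functions.\<close>

lemma gauge_equivalent_refl: "gauge_equivalent R R"
proof -
  define L :: ratfun where "L = Fract [:0, 1:] [:1, 0:]"
  have id: "rat_map L = id"
    unfolding L_def by (subst rat_map_linear_monic) (auto simp: mobius_def fun_eq_iff split: option.splits)
  have "\<exists>\<alpha> \<beta> \<gamma> \<delta>. \<alpha> * \<delta> - \<beta> * \<gamma> \<noteq> 0 \<and> L = Fract [:\<beta>, \<alpha>:] [:\<delta>, \<gamma>:]"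
    by (rule exI[of _ 1], rule exI[of _ 0], rule exI[of _ 0], rule exI[of _ 1]) (simp add: L_def)
  then have "linear_fractional L" unfolding linear_fractional_def .
  moreover have "keeps_unit_segment L" unfolding keeps_unit_segment_def id by simp
  ultimately show ?thesis unfolding gauge_equivalent_def using id by (metis comp_id id_comp)
qed

theorem mainTheorem3:
  fixes lam :: real
  assumes "1 < lam" and "lam < 2"
  shows "\<exists>\<R> :: ratfun set.
           infinite \<R> \<and>
           (\<forall>R\<in>\<R>. admissible R \<and> PS_eigenvalue lam R) \<and>
           pairwise (\<lambda>R R'. \<not> gauge_equivalent R R') \<R>"
proof -
  define B where "B b = sqrt ((3 - b\<^sup>2) / (1 + b\<^sup>2))" for b :: real
  have "\<exists>e. scaled_cubic b (B b) e \<and> PS_eigenvalue lam (scaled_cubic.R b (B b) e)" if "b \<in> {0<..<1}" for b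
    using cubic.exists_PS_eigenvalue[of b "B b" "lam - 1"] cubic_exists[of b] that assms
    by (simp add: B_def)
  then obtain e where e: "\<And>b. b \<in> {0<..<1} \<Longrightarrow>
      scaled_cubic b (B b) (e b) \<and> PS_eigenvalue lam (scaled_cubic.R b (B b) (e b))"
    by metis
  define R where "R b = scaled_cubic.R b (B b) (e b)" for b
  have neq: "\<not> gauge_equivalent (R b) (R b')" if "b \<in> {0<..<1}" "b' \<in> {0<..<1}" "b \<noteq> b'" for b b'
    unfolding R_def using gauge_inequivalent_family e that by blast
  have inj: "inj_on R {0<..<1}" by (rule inj_onI) (metis neq gauge_equivalent_refl)
  show ?thesis
  proof (intro exI[of _ "R ` {0<..<1}"] conjI ballI)
    show "infinite (R ` {0<..<1})" using finite_imageD[OF _ inj] infinite_Ioo[of "0 :: real" 1] by auto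
    show "pairwise (\<lambda>R R'. \<not> gauge_equivalent R R') (R ` {0<..<1})"
    proof (rule pairwiseI)
      fix R1 R2 assume "R1 \<in> R ` {0<..<1}" "R2 \<in> R ` {0<..<1}" and ne: "R1 \<noteq> R2"
      then obtain b b' where b: "b \<in> {0<..<1}" "b' \<in> {0<..<1}" "R1 = R b" "R2 = R b'" by blast
      moreover from b ne have "b \<noteq> b'" by blast
      ultimately show "\<not> gauge_equivalent R1 R2" using neq by blast
    qed
    fix R' assume "R' \<in> R ` {0<..<1}"
    then show "admissible R'" "PS_eigenvalue lam R'"
      using e scaled_cubic.admissible_R by (auto simp: R_def)
  qed
qed

end
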